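(* Let $\sigma\ge\frac12$ and let $L$ be a link with $\mathrm{Thi}_\sigma(L)=1$ that is $\sigma$-balanced (by some strut measure $\mu$ and kink measure $\nu$). Suppose $A$ and $B$ are two subarcs of $L$ over which the kink measure $\nu$ vanishes, and suppose they are in one-to-one contact, meaning there is a homeomorphism $\phi:A\to B$ such that there is a strut from $a$ to $\phi(a)$ for each $a\in A$, but there are no other struts touching $A\cup B$. Then $A\cup B$ forms a piece of a standard symmetric double helix of pitch at least $1$, or of a circle.
   Context: Curves. A link $L\subset\mathbb{R}^3$ is a compact embedded 1-dimensional submanifold with boundary whose arclength parametrization is $C^{1,1}$; $T$ is the unit tangent, $'$ arclength derivative, $E_L$ the set of points where the arclength parametrization is twice differentiable, $\kappa=T'$ there. Thickness. $\mathrm{reach}(L)$ is the supremal $r\ge0$ such that every point at distance less than $r$ from $L$ has a unique nearest point on $L$. $\mathrm{Circ}=\{(p,T,\kappa):p\in\mathbb{R}^3,|T|=1,\kappa\perp T\}$, $R=1/|\kappa|$; $\overline{\mathrm{Osc}L}$ is the closure in $\mathrm{Circ}$ of $\{(x,T(x),\kappa(x)):x\in E_L\}$; $\rho(x)=\min\{R(c):c\in\overline{\mathrm{Osc}L}\text{ based at }x\}$; $\mathrm{Thi}_\sigma(L)=\min\{2\,\mathrm{reach}(L),\frac1\sigma\min_L\rho\}$. Struts and kinks. $T_xL$ is the tangent line (inward ray at an endpoint), $N_xL=\{p:\langle p-x,q-x\rangle\le0\ \forall q\in T_xL\}$. A strut is a pair $(x,y)$ of distinct points of $L$ with $x\in N_yL$,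 $y\in N_xL$, $|x-y|=\mathrm{Thi}_\sigma(L)$; a kink is $c\in\overline{\mathrm{Osc}L}$ with $R(c)=\sigma\mathrm{Thi}_\sigma(L)$. A kink measure is a nonnegative Radon measure $\nu$ on $\mathrm{Kink}(L)$; a strut measure is a nonnegative Radon measure $\mu$ on $\mathrm{Strut}(L)$ invariant under $(x,y)\mapsto(y,x)$, with strut force measure $\Omega$ = push-forward of $2(x-y)\mu$ to $L$ under $(x,y)\mapsto x$. Constraints. At each endpoint $p\in\partial L$ there are given an affine subspace $H^0_p\ni p$ of dimension at most 2 and a linear subspace $H^1_p\ni T(p)$ of dimension 1 or 3; $\xi\in C^2(\mathbb{R}^3,\mathbb{R}^3)$ is compatible if $\xi(p)$ is tangent to $H^0_p$ and $D_p\xi(T(p))\in H^1_p$ at each $p\in\partial L$. $\sigma$-balanced by $\mu,\nu$: for every compatible $\xi$, $\int_L\langle\xi',T\rangle ds=\int_L\langle\xi,d\Omega\rangle+\int_{\mathrm{Kink}(L)}\delta_\xi R\,d\nu$, where $\delta_\xi R(x,T,\kappa)=2R\langle T,D_x\xi(T)\rangle-R^3\langle\kappa,D_x^2\xi(T,T)+D_x\xi(\kappa)\rangle$, $R=1/|\kappa|$. A standard symmetric double helix of pitch $k$ is a pair of curves congruent to $\{\frac12(-\cos\theta,-\sin\theta,k\theta)\}$ and $\{\frac12(\cos\theta,\sin\theta,k\theta)\}$, $A$ and $B$ being subarcs of the two strands corresponding to the same $\theta$-interval; the degenerate case of infinite pitch (two parallel straight lines at unit distance, $A$ and $B$ being directly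 opposite segments) is included. In the circle case, $A$ and $B$ are antipodal arcs of a circle of diameter 1. *)

theory Defs
  imports "HOL-Analysis.Analysis"
begin

type_synonym vec3 = "real^3"

section \<open>Links\<close>

text \<open>
  A link is a set \<open>L\<close> together with an orientation, given by its unit tangent field \<open>T\<close>
  (only the values of \<open>T\<close> on \<open>L\<close> matter).  Half-open and closed parameter intervals \<open>I\<close>
  provide the charts at boundary points; derivatives there are one-sided.
\<close>

definition arclength_chart :: "vec3 set \<Rightarrow> (vec3 \<Rightarrow> vec3) \<Rightarrow> (real \<Rightarrow> vec3) \<Rightarrow> real set \<Rightarrow> bool" where
  "arclength_chart L T c I \<longleftrightarrow>
     is_interval I \<and> interior I \<noteq> {} \<and>
     openin (top_of_set L) (c ` I) \<and> (\<exists>g. homeomorphism I (c ` I) c g) \<and>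
     (\<forall>t\<in>I. norm (T (c t)) = 1 \<and> (c has_vector_derivative T (c t)) (at t within I)) \<and>
     (\<exists>M. M-lipschitz_on I (\<lambda>t. T (c t)))"

definition link :: "vec3 set \<Rightarrow> (vec3 \<Rightarrow> vec3) \<Rightarrow> bool" where
  "link L T \<longleftrightarrow> compact L \<and> (\<forall>x\<in>L. \<exists>c I. arclength_chart L T c I \<and> x \<in> c ` I)"

definition initial_point :: "vec3 set \<Rightarrow> (vec3 \<Rightarrow> vec3) \<Rightarrow> vec3 \<Rightarrow> bool" where
  "initial_point L T x \<longleftrightarrow>
     (\<exists>c I t. arclength_chart L T c I \<and> t \<in> I \<and> (\<forall>s\<in>I. t \<le> s) \<and> c t = x)"

definition terminal_point :: "vec3 set \<Rightarrow> (vec3 \<Rightarrow> vec3) \<Rightarrow> vec3 \<Rightarrow> bool" where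
  "terminal_point L T x \<longleftrightarrow>
     (\<exists>c I t. arclength_chart L T c I \<and> t \<in> I \<and> (\<forall>s\<in>I. s \<le> t) \<and> c t = x)"

definition link_boundary :: "vec3 set \<Rightarrow> (vec3 \<Rightarrow> vec3) \<Rightarrow> vec3 set" where
  "link_boundary L T = {x. initial_point L T x \<or> terminal_point L T x}"

definition has_arclength_derivative ::
    "vec3 set \<Rightarrow> (vec3 \<Rightarrow> vec3) \<Rightarrow> (vec3 \<Rightarrow> vec3) \<Rightarrow> vec3 \<Rightarrow> vec3 \<Rightarrow> bool" where
  "has_arclength_derivative L T f v x \<longleftrightarrow>
     (\<exists>c I t. arclength_chart L T c I \<and> t \<in> I \<and> c t = x \<and>
        ((\<lambda>s. f (c s)) has_vector_derivative v) (at t within I))"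

definition arclength_derivative ::
    "vec3 set \<Rightarrow> (vec3 \<Rightarrow> vec3) \<Rightarrow> (vec3 \<Rightarrow> vec3) \<Rightarrow> vec3 \<Rightarrow> vec3" where
  "arclength_derivative L T f x = (THE v. has_arclength_derivative L T f v x)"

text \<open>This determines the arclength measure \<open>S\<close> on \<open>L\<close> (the \<open>ds\<close> of line integrals) uniquely.\<close>

definition arclength_measure :: "vec3 set \<Rightarrow> (vec3 \<Rightarrow> vec3) \<Rightarrow> vec3 measure \<Rightarrow> bool" where
  "arclength_measure L T S \<longleftrightarrow>
     sets S = sets (restrict_space borel L) \<and>
     (\<forall>c I E. arclength_chart L T c I \<and> E \<in> sets borel \<and> E \<subseteq> I \<longrightarrow>
        emeasure S (c ` E) = emeasure lborel E)"

definition subarc :: "vec3 set \<Rightarrow> (vec3 \<Rightarrow> vec3) \<Rightarrow> vec3 set \<Rightarrow> bool" where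
  "subarc L T A \<longleftrightarrow> A \<subseteq> L \<and>
     (\<exists>\<gamma> s t. s < t \<and> inj_on \<gamma> {s..t} \<and> \<gamma> ` {s..t} = A \<and>
        (\<forall>u\<in>{s..t}. (\<gamma> has_vector_derivative T (\<gamma> u)) (at u within {s..t})))"

section \<open>Thickness\<close>

definition reach :: "vec3 set \<Rightarrow> ereal" where
  "reach L = Sup (ereal ` {r. 0 \<le> r \<and>
     (\<forall>p. infdist p L < r \<longrightarrow> (\<exists>!x. x \<in> L \<and> dist p x = infdist p L))})"

type_synonym circ = "vec3 \<times> vec3 \<times> vec3"

definition Circ :: "circ set" where
  "Circ = {(p, T, \<kappa>). norm T = 1 \<and> \<kappa> \<bullet> T = 0}"

text \<open>Here \<open>1 / 0 = \<infinity>\<close> in the extended reals, so degenerate circles (lines) have infinite radius.\<close>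

definition circ_radius :: "circ \<Rightarrow> ereal" where
  "circ_radius = (\<lambda>(p, T, \<kappa>). 1 / ereal (norm \<kappa>))"

text \<open>The base points \<open>x\<close> below are exactly the points of twice differentiability, and \<open>\<kappa> = T'\<close>.\<close>

definition osc_closure :: "vec3 set \<Rightarrow> (vec3 \<Rightarrow> vec3) \<Rightarrow> circ set" where
  "osc_closure L T =
     top_of_set Circ closure_of {(x, T x, \<kappa>) | x \<kappa>. has_arclength_derivative L T T \<kappa> x}"

text \<open>The minima in the definition of thickness are attained for a link, hence agree with infima.\<close>

definition rho :: "vec3 set \<Rightarrow> (vec3 \<Rightarrow> vec3) \<Rightarrow> vec3 \<Rightarrow> ereal" where
  "rho L T x = (INF c \<in> {c \<in> osc_closure L T. fst c = x}. circ_radius c)"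

definition Thi :: "real \<Rightarrow> vec3 set \<Rightarrow> (vec3 \<Rightarrow> vec3) \<Rightarrow> ereal" where
  "Thi \<sigma> L T = min (2 * reach L) (ereal (1 / \<sigma>) * (INF x \<in> L. rho L T x))"

section \<open>Struts and kinks\<close>

definition tangent_line :: "vec3 set \<Rightarrow> (vec3 \<Rightarrow> vec3) \<Rightarrow> vec3 \<Rightarrow> vec3 set" where
  "tangent_line L T x = {x + r *\<^sub>R T x | r.
     (initial_point L T x \<longrightarrow> 0 \<le> r) \<and> (terminal_point L T x \<longrightarrow> r \<le> 0)}"

definition normal_cone :: "vec3 set \<Rightarrow> (vec3 \<Rightarrow> vec3) \<Rightarrow> vec3 \<Rightarrow> vec3 set" where
  "normal_cone L T x = {p. \<forall>q \<in> tangent_line L T x. (p - x) \<bullet> (q - x) \<le> 0}"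

definition Strut :: "real \<Rightarrow> vec3 set \<Rightarrow> (vec3 \<Rightarrow> vec3) \<Rightarrow> (vec3 \<times> vec3) set" where
  "Strut \<sigma> L T = {(x, y). x \<in> L \<and> y \<in> L \<and> x \<noteq> y \<and>
     x \<in> normal_cone L T y \<and> y \<in> normal_cone L T x \<and> ereal (norm (x - y)) = Thi \<sigma> L T}"

definition Kink :: "real \<Rightarrow> vec3 set \<Rightarrow> (vec3 \<Rightarrow> vec3) \<Rightarrow> circ set" where
  "Kink \<sigma> L T = {c \<in> osc_closure L T. circ_radius c = ereal \<sigma> * Thi \<sigma> L T}"

definition radon_measure_on :: "'a::topological_space set \<Rightarrow> 'a measure \<Rightarrow> bool" where
  "radon_measure_on X M \<longleftrightarrow>
     sets M = sets (restrict_space borel X) \<and>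
     (\<forall>K. compact K \<and> K \<subseteq> X \<longrightarrow> emeasure M K < \<infinity>) \<and>
     (\<forall>E \<in> sets M. emeasure M E = (SUP K \<in> {K. compact K \<and> K \<subseteq> E}. emeasure M K))"

definition strut_measure :: "real \<Rightarrow> vec3 set \<Rightarrow> (vec3 \<Rightarrow> vec3) \<Rightarrow> (vec3 \<times> vec3) measure \<Rightarrow> bool" where
  "strut_measure \<sigma> L T \<mu> \<longleftrightarrow>
     radon_measure_on (Strut \<sigma> L T) \<mu> \<and> distr \<mu> \<mu> prod.swap = \<mu>"

definition kink_measure :: "real \<Rightarrow> vec3 set \<Rightarrow> (vec3 \<Rightarrow> vec3) \<Rightarrow> circ measure \<Rightarrow> bool" where
  "kink_measure \<sigma> L T \<nu> \<longleftrightarrow> radon_measure_on (Kink \<sigma> L T) \<nu>"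

text \<open>
  The integral of \<open>\<langle>\<xi>, d\<Omega>\<rangle>\<close> over \<open>L\<close>, where the vector-valued strut force measure \<open>\<Omega>\<close> is the
  push-forward of \<open>2 (x - y) \<mu>\<close> under \<open>(x, y) \<mapsto> x\<close>.
\<close>

definition strut_force_integral :: "(vec3 \<times> vec3) measure \<Rightarrow> (vec3 \<Rightarrow> vec3) \<Rightarrow> real" where
  "strut_force_integral \<mu> \<xi> = (LINT (x, y)|\<mu>. \<xi> x \<bullet> (2 *\<^sub>R (x - y)))"

section \<open>Balance\<close>

definition C2_with_derivatives ::
    "(vec3 \<Rightarrow> vec3) \<Rightarrow> (vec3 \<Rightarrow> vec3 \<Rightarrow>\<^sub>L vec3) \<Rightarrow> (vec3 \<Rightarrow> vec3 \<Rightarrow>\<^sub>L vec3 \<Rightarrow>\<^sub>L vec3) \<Rightarrow> bool" where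
  "C2_with_derivatives \<xi> D D2 \<longleftrightarrow>
     (\<forall>x. (\<xi> has_derivative blinfun_apply (D x)) (at x)) \<and>
     (\<forall>x. (D has_derivative blinfun_apply (D2 x)) (at x)) \<and>
     continuous_on UNIV D2"

definition endpoint_constraints ::
    "vec3 set \<Rightarrow> (vec3 \<Rightarrow> vec3) \<Rightarrow> (vec3 \<Rightarrow> vec3 set) \<Rightarrow> (vec3 \<Rightarrow> vec3 set) \<Rightarrow> bool" where
  "endpoint_constraints L T H0 H1 \<longleftrightarrow>
     (\<forall>p \<in> link_boundary L T.
        affine (H0 p) \<and> p \<in> H0 p \<and> aff_dim (H0 p) \<le> 2 \<and>
        subspace (H1 p) \<and> T p \<in> H1 p \<and> (dim (H1 p) = 1 \<or> dim (H1 p) = 3))"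

definition compatible ::
    "vec3 set \<Rightarrow> (vec3 \<Rightarrow> vec3) \<Rightarrow> (vec3 \<Rightarrow> vec3 set) \<Rightarrow> (vec3 \<Rightarrow> vec3 set) \<Rightarrow>
     (vec3 \<Rightarrow> vec3) \<Rightarrow> (vec3 \<Rightarrow> vec3 \<Rightarrow>\<^sub>L vec3) \<Rightarrow> bool" where
  "compatible L T H0 H1 \<xi> D \<longleftrightarrow>
     (\<forall>p \<in> link_boundary L T.
        \<xi> p \<in> {q - p | q. q \<in> H0 p} \<and> blinfun_apply (D p) (T p) \<in> H1 p)"

definition delta_radius ::
    "(vec3 \<Rightarrow> vec3 \<Rightarrow>\<^sub>L vec3) \<Rightarrow> (vec3 \<Rightarrow> vec3 \<Rightarrow>\<^sub>L vec3 \<Rightarrow>\<^sub>L vec3) \<Rightarrow> circ \<Rightarrow> real" where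
  "delta_radius D D2 = (\<lambda>(x, T, \<kappa>). let R = 1 / norm \<kappa> in
     2 * R * (T \<bullet> blinfun_apply (D x) T)
     - R ^ 3 * (\<kappa> \<bullet> (blinfun_apply (blinfun_apply (D2 x) T) T + blinfun_apply (D x) \<kappa>)))"

definition balanced_by ::
    "vec3 set \<Rightarrow> (vec3 \<Rightarrow> vec3) \<Rightarrow> vec3 measure \<Rightarrow> (vec3 \<Rightarrow> vec3 set) \<Rightarrow> (vec3 \<Rightarrow> vec3 set) \<Rightarrow>
     (vec3 \<times> vec3) measure \<Rightarrow> circ measure \<Rightarrow> bool" where
  "balanced_by L T S H0 H1 \<mu> \<nu> \<longleftrightarrow>
     (\<forall>\<xi> D D2. C2_with_derivatives \<xi> D D2 \<and> compatible L T H0 H1 \<xi> D \<longrightarrow>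
        (LINT x|S. arclength_derivative L T \<xi> x \<bullet> T x)
        = strut_force_integral \<mu> \<xi> + (LINT c|\<nu>. delta_radius D D2 c))"

section \<open>One-to-one contact, double helices and circles\<close>

text \<open>
  Every point of \<open>A\<close> and every point of \<open>B\<close> is touched by exactly one strut, the one given by
  \<open>\<phi>\<close>.  The arcs are allowed to overlap (as overlapping antipodal arcs of a circle do); in that
  case this excludes chains \<open>a, \<phi> a, \<phi> (\<phi> a)\<close> of three different points joined by struts.
\<close>

definition one_to_one_contact :: "real \<Rightarrow> vec3 set \<Rightarrow> (vec3 \<Rightarrow> vec3) \<Rightarrow> vec3 set \<Rightarrow> vec3 set \<Rightarrow> bool" where
  "one_to_one_contact \<sigma> L T A B \<longleftrightarrow>
     (\<exists>\<phi> \<psi>. homeomorphism A B \<phi> \<psi> \<and>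
        (\<forall>a \<in> A. (a, \<phi> a) \<in> Strut \<sigma> L T) \<and>
        (\<forall>(x, y) \<in> Strut \<sigma> L T. (x \<in> A \<longrightarrow> y = \<phi> x) \<and> (y \<in> B \<longrightarrow> x = \<psi> y)))"

text \<open>Congruence includes reflections, so helices of either handedness have positive pitch.\<close>

definition congruent_pair :: "vec3 set \<Rightarrow> vec3 set \<Rightarrow> vec3 set \<Rightarrow> vec3 set \<Rightarrow> bool" where
  "congruent_pair A B A' B' \<longleftrightarrow>
     (\<exists>f :: vec3 \<Rightarrow> vec3. (\<forall>x y. dist (f x) (f y) = dist x y) \<and> A = f ` A' \<and> B = f ` B')"

definition double_helix_piece :: "real \<Rightarrow> vec3 set \<Rightarrow> vec3 set \<Rightarrow> bool" where
  "double_helix_piece k A B \<longleftrightarrow> (\<exists>\<alpha> \<beta>. \<alpha> < \<beta> \<and>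
     congruent_pair A B
       ((\<lambda>\<theta>. (1/2) *\<^sub>R vector [- cos \<theta>, - sin \<theta>, k * \<theta>]) ` {\<alpha>..\<beta>})
       ((\<lambda>\<theta>. (1/2) *\<^sub>R vector [cos \<theta>, sin \<theta>, k * \<theta>]) ` {\<alpha>..\<beta>}))"

text \<open>The double helix of infinite pitch.\<close>

definition opposite_segments :: "vec3 set \<Rightarrow> vec3 set \<Rightarrow> bool" where
  "opposite_segments A B \<longleftrightarrow> (\<exists>\<alpha> \<beta>. \<alpha> < \<beta> \<and>
     congruent_pair A B
       ((\<lambda>z. vector [- 1/2, 0, z]) ` {\<alpha>..\<beta>}) ((\<lambda>z. vector [1/2, 0, z]) ` {\<alpha>..\<beta>}))"

definition antipodal_circle_arcs :: "vec3 set \<Rightarrow> vec3 set \<Rightarrow> bool" where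
  "antipodal_circle_arcs A B \<longleftrightarrow> (\<exists>\<alpha> \<beta>. \<alpha> < \<beta> \<and> \<beta> < \<alpha> + 2 * pi \<and>
     congruent_pair A B
       ((\<lambda>\<theta>. (1/2) *\<^sub>R vector [- cos \<theta>, - sin \<theta>, 0]) ` {\<alpha>..\<beta>})
       ((\<lambda>\<theta>. (1/2) *\<^sub>R vector [cos \<theta>, sin \<theta>, 0]) ` {\<alpha>..\<beta>}))"

end

theory Submission
  imports Defs
begin

text \<open>
  Reach at least \<open>1/2\<close> means that no open ball of radius \<open>1/2\<close> tangent to the link meets it; in
  particular tangents turn at rate at most \<open>2\<close>.  Testing the balance equation with bump fields around
  interior points of the arcs shows that the tangent changes along a piece of an arc by minus the strut
  force on that piece.  Corresponding pieces of \<open>A\<close> and \<open>B\<close> receive opposite forces, so, with suitable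
  orientations, the sum \<open>V\<close> of the tangents at \<open>a\<close> and \<open>\<phi> a\<close> is constant.  Struts are perpendicular to
  both tangents, hence to \<open>V\<close>, and \<open>\<phi>\<close> preserves arclength.  Thus the midpoints of the struts move with
  constant velocity \<open>V/2\<close>, while the strut is a unit vector rotating with constant speed in a plane.
  If \<open>V \<noteq> 0\<close>, that plane is orthogonal to \<open>V\<close>, and we obtain a double helix (or parallel
  segments), whose pitch is at least \<open>1\<close> because of the tangent balls.  If \<open>V = 0\<close>, the midpoint is fixed,
  the tangent balls force the arcs into a plane, and we obtain a circle.
\<close>

section \<open>Orthonormal frames and planar curves\<close>

text \<open>Tangents are merely Lipschitz and \<open>\<phi>\<close> is merely a homeomorphism, so
  neither second derivatives of the arcs nor a derivative of \<open>\<phi>\<close> is available at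
  the start. Turning rates and lengths are compared along short secants with a small relative error,
  which disappears when short intervals are chained. Sharp constants matter: when the tangents are
  opposite, preservation of arclength rests on a turning rate of at most 2 on both arcs.

  Force balance is tested on one arc at a time with bumps in a constant direction; the two arcs are
  compared only through the invariance of the strut measure under exchange of ends. Hence
  \<open>A\<close> and \<open>B\<close> may overlap. A test field must not see other parts of the
  link. This is arranged by balls that meet the link exactly in an open subarc, centred at a point
  of the arc equidistant from the two ends of that subarc.

  Balance and perpendicularity are obtained at interior points of the arcs only, where no endpoint
  constraint interferes; continuity carries them to the ends.\<close>

lemma locally_lipschitz_imp_lipschitz:
  fixes f :: "real \<Rightarrow> 'a::metric_space"
  assumes "\<delta> > 0"
    and loc: "\<And>x y. \<lbrakk>x \<in> {a..b}; y \<in> {a..b}; x \<le> y; y - x < \<delta>\<rbrakk> \<Longrightarrow> dist (f x) (f y) \<le> K * (y - x)"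
    and "x \<in> {a..b}" "y \<in> {a..b}" "x \<le> y"
  shows "dist (f x) (f y) \<le> K * (y - x)"
proof -
  have step: "dist (f x) (f y) \<le> K * (y - x)"
    if "x \<in> {a..b}" "y \<in> {a..b}" "x \<le> y" "y - x \<le> real n * (\<delta> / 2)" for n x y
    using that
  proof (induction n arbitrary: y)
    case 0
    then show ?case using \<open>\<delta> > 0\<close> by auto
  next
    case (Suc n)
    define z where "z = max x (y - \<delta> / 2)"
    have z: "z \<in> {a..b}" "x \<le> z" "z \<le> y" "y - z < \<delta>"
      using Suc.prems \<open>\<delta> > 0\<close> by (auto simp: z_def max_def)
    have "z - x \<le> real n * (\<delta> / 2)"
      using Suc.prems \<open>\<delta> > 0\<close> by (auto simp: z_def max_def algebra_simps)
    then have "dist (f x) (f z) \<le> K * (z - x)" using Suc.IH z Suc.prems by blast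
    moreover have "dist (f z) (f y) \<le> K * (y - z)" using loc z Suc.prems by blast
    moreover have "K * (z - x) + K * (y - z) = K * (y - x)" by (simp add: algebra_simps)
    ultimately show ?case using dist_triangle[of "f x" "f y" "f z"] by linarith
  qed
  obtain n where "(y - x) / (\<delta> / 2) \<le> real n" using real_arch_simple by blast
  then have "y - x \<le> real n * (\<delta> / 2)" using \<open>\<delta> > 0\<close> by (simp add: field_simps)
  then show ?thesis using step assms by blast
qed

text \<open>Secant estimates hold with a loss \<epsilon> on intervals whose length depends on
  \<epsilon>. The bound is additive in \<open>y - x\<close>, so the loss does not accumulate when
  short intervals are chained, and \<epsilon> can tend to 0 afterwards.\<close>

lemma lipschitz_from_infinitesimal:
  fixes f :: "real \<Rightarrow> 'a::metric_space"
  assumes loc: "\<And>\<epsilon>. \<epsilon> > 0 \<Longrightarrow> \<exists>\<delta>>0. \<forall>x\<in>{a..b}. \<forall>y\<in>{a..b}. x \<le> y \<longrightarrow> y - x < \<delta> \<longrightarrow>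
      dist (f x) (f y) \<le> (K + \<epsilon>) * (y - x)"
    and xy: "x \<in> {a..b}" "y \<in> {a..b}" "x \<le> y"
  shows "dist (f x) (f y) \<le> K * (y - x)"
proof (rule field_le_epsilon)
  fix e :: real assume "e > 0"
  define \<epsilon> where "\<epsilon> = e / (y - x + 1)"
  have "\<epsilon> > 0" using \<open>e > 0\<close> xy by (simp add: \<epsilon>_def)
  obtain \<delta> where "\<delta> > 0" and "\<forall>x\<in>{a..b}. \<forall>y\<in>{a..b}. x \<le> y \<longrightarrow> y - x < \<delta> \<longrightarrow>
      dist (f x) (f y) \<le> (K + \<epsilon>) * (y - x)" using loc[OF \<open>\<epsilon> > 0\<close>] by blast
  then have "dist (f x) (f y) \<le> (K + \<epsilon>) * (y - x)"
    using locally_lipschitz_imp_lipschitz[of \<delta> a b f "K + \<epsilon>" x y] xy by blast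
  moreover have "\<epsilon> * (y - x) \<le> e"
    using \<open>e > 0\<close> xy by (simp add: \<epsilon>_def field_simps)
  ultimately show "dist (f x) (f y) \<le> K * (y - x) + e" by (simp add: algebra_simps)
qed

section \<open>Uniform rotation in a plane of three-space\<close>

context
  includes cross3_syntax
begin

lemma cross_orthonormal:
  fixes e u :: vec3
  assumes "norm e = 1" "norm u = 1" "e \<bullet> u = 0"
  shows "norm (e \<times> u) = 1" "e \<bullet> (e \<times> u) = 0" "u \<bullet> (e \<times> u) = 0" "e \<times> (e \<times> u) = - u"
proof -
  have "(norm (e \<times> u))\<^sup>2 = 1" using norm_cross_dot[of e u] assms by simp
  then show "norm (e \<times> u) = 1" by (smt (verit) norm_ge_zero power2_eq_1_iff)
  show "e \<bullet> (e \<times> u) = 0" "u \<bullet> (e \<times> u) = 0" by (simp_all add: dot_cross_self)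
  have "e \<times> (e \<times> u) = (e \<bullet> u) *\<^sub>R e - (e \<bullet> e) *\<^sub>R u" by (rule Lagrange)
  then show "e \<times> (e \<times> u) = - u" using assms by (simp add: norm_eq_1)
qed

lemma orthonormal_expansion:
  fixes e u x :: vec3
  assumes "norm e = 1" "norm u = 1" "e \<bullet> u = 0"
  shows "x = (x \<bullet> e) *\<^sub>R e + (x \<bullet> u) *\<^sub>R u + (x \<bullet> (e \<times> u)) *\<^sub>R (e \<times> u)"
proof -
  note c = cross_orthonormal[OF assms]
  define y where "y = x - ((x \<bullet> e) *\<^sub>R e + (x \<bullet> u) *\<^sub>R u + (x \<bullet> (e \<times> u)) *\<^sub>R (e \<times> u))"
  have y: "y \<bullet> e = 0" "y \<bullet> u = 0" "y \<bullet> (e \<times> u) = 0"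
    using assms c unfolding y_def
    by (simp_all add: inner_diff_right inner_add_right norm_eq_1 inner_commute)
  have "y \<times> (e \<times> u) = (y \<bullet> u) *\<^sub>R e - (y \<bullet> e) *\<^sub>R u" by (rule Lagrange)
  then have "y \<times> (e \<times> u) = 0" using y by simp
  then have "y = 0 \<or> e \<times> u = 0" using y norm_and_cross_eq_0[of y "e \<times> u"] by blast
  then have "y = 0" using c by auto
  then show ?thesis unfolding y_def by simp
qed

text \<open>As \<open>u\<close> has length 1 and stays orthogonal to \<open>e\<close>, its
  derivative is a multiple \<open>l\<close> of \<open>e \<times> u\<close> with
  \<open>|l| = \<omega>\<close>. Continuity of \<open>w\<close> excludes a change of sign, so
  \<open>u\<close> rotates with constant velocity. No second derivative of \<open>u\<close> is
  needed.\<close>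

lemma planar_unit_speed_curve:
  fixes u w :: "real \<Rightarrow> vec3" and e :: vec3
  assumes "s0 < s1"
    and u': "\<And>s. s \<in> {s0..s1} \<Longrightarrow> (u has_vector_derivative w s) (at s within {s0..s1})"
    and cw: "continuous_on {s0..s1} w"
    and nu: "\<And>s. s \<in> {s0..s1} \<Longrightarrow> norm (u s) = 1"
    and nw: "\<And>s. s \<in> {s0..s1} \<Longrightarrow> norm (w s) = \<omega>"
    and ne: "norm e = 1"
    and ue: "\<And>s. s \<in> {s0..s1} \<Longrightarrow> e \<bullet> u s = 0"
  obtains p q where "norm p = 1" "norm q = 1" "p \<bullet> q = 0" "p \<bullet> e = 0" "q \<bullet> e = 0"
    "\<And>s. s \<in> {s0..s1} \<Longrightarrow> u s = cos (\<omega> * s) *\<^sub>R p + sin (\<omega> * s) *\<^sub>R q"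
    "\<And>s. s \<in> {s0..s1} \<Longrightarrow> w s = \<omega> *\<^sub>R (cos (\<omega> * s) *\<^sub>R q - sin (\<omega> * s) *\<^sub>R p)"
proof -
  let ?I = "{s0..s1}"
  have dconst: "v = 0" if "s \<in> ?I" "((\<lambda>s. c) has_vector_derivative v) (at s within ?I)" for s c and v :: real
    using vector_derivative_unique_within[OF _ that(2) has_vector_derivative_const] that(1) \<open>s0 < s1\<close>
    by (auto simp: trivial_limit_within intro!: connected_imp_perfect)
  have we: "e \<bullet> w s = 0" if s: "s \<in> ?I" for s
  proof (rule dconst[OF s, of 0])
    have "((\<lambda>s. e \<bullet> u s) has_vector_derivative e \<bullet> w s) (at s within ?I)"
      by (rule bounded_linear.has_vector_derivative[OF bounded_linear_inner_right u'[OF s]])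
    then show "((\<lambda>s. 0) has_vector_derivative e \<bullet> w s) (at s within ?I)"
      by (rule has_vector_derivative_transform[OF s, rotated]) (simp add: ue)
  qed
  have wu: "u s \<bullet> w s = 0" if s: "s \<in> ?I" for s
  proof -
    have "2 * (u s \<bullet> w s) = 0"
    proof (rule dconst[OF s, of 1])
      have "((\<lambda>s. u s \<bullet> u s) has_vector_derivative u s \<bullet> w s + w s \<bullet> u s) (at s within ?I)"
        by (rule bounded_bilinear.has_vector_derivative[OF bounded_bilinear_inner u'[OF s] u'[OF s]])
      then show "((\<lambda>s. 1) has_vector_derivative 2 * (u s \<bullet> w s)) (at s within ?I)"
        by (rule has_vector_derivative_transform[OF s, rotated, THEN has_vector_derivative_eq_rhs])
          (auto simp: nu norm_eq_1[symmetric] inner_commute)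
    qed
    then show ?thesis by simp
  qed
  define l where "l s = w s \<bullet> (e \<times> u s)" for s
  have wl: "w s = l s *\<^sub>R (e \<times> u s)" if "s \<in> ?I" for s
    using orthonormal_expansion[OF ne nu[OF that] ue[OF that], of "w s"] we[OF that] wu[OF that]
    by (simp add: l_def inner_commute)
  have abs_l: "\<bar>l s\<bar> = \<omega>" if "s \<in> ?I" for s
    using nw[OF that] wl[OF that] cross_orthonormal(1)[OF ne nu[OF that] ue[OF that]]
    by (metis norm_scaleR mult.right_neutral)
  have cu: "continuous_on ?I u"
    using u' by (meson continuous_on_eq_continuous_within has_vector_derivative_continuous)
  \<comment> \<open>A continuous function with at most two values on an interval is constant; this
    fixes the sense of rotation.\<close>
  have "continuous_on ?I l"
    unfolding l_def by (intro continuous_intros cw continuous_on_cross cu)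
  moreover have "l ` ?I \<subseteq> {\<omega>, -\<omega>}" using abs_l by force
  ultimately have "l constant_on ?I"
    by (meson continuous_finite_range_constant connected_Icc finite.emptyI finite.insertI finite_subset)
  then obtain k where l_eq: "\<And>s. s \<in> ?I \<Longrightarrow> l s = k" by (auto simp: constant_on_def)
  have k_abs: "\<bar>k\<bar> = \<omega>" using abs_l[of s0] l_eq[of s0] \<open>s0 < s1\<close> by auto
  \<comment> \<open>\<open>P s\<close> is \<open>u s\<close> turned back about \<open>e\<close> by
    the angle \<open>k * s\<close>. It is constant, and its value is the vector \<open>p\<close> of
    the claim.\<close>
  define P where "P s = cos (k * s) *\<^sub>R u s - sin (k * s) *\<^sub>R (e \<times> u s)" for s
  have cross': "((\<lambda>s. e \<times> u s) has_vector_derivative k *\<^sub>R - u s) (at s within ?I)" if s: "s \<in> ?I" for s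
  proof -
    have bl: "bounded_linear (\<lambda>x. e \<times> x)"
      using bilinear_cross by (simp add: bilinear_def linear_conv_bounded_linear)
    have "e \<times> w s = k *\<^sub>R - u s"
      using cross_orthonormal(4)[OF ne nu[OF s] ue[OF s]] wl[OF s] l_eq[OF s] by (simp add: cross_mult_right)
    then show ?thesis using bounded_linear.has_vector_derivative[OF bl u'[OF s]] by simp
  qed
  have "(P has_vector_derivative 0) (at s within ?I)" if s: "s \<in> ?I" for s
  proof -
    have c: "((\<lambda>s. cos (k * s)) has_real_derivative - sin (k * s) * k) (at s within ?I)"
      and sn: "((\<lambda>s. sin (k * s)) has_real_derivative cos (k * s) * k) (at s within ?I)"
      by (auto intro!: derivative_eq_intros)
    show ?thesis
      unfolding P_def
      using has_vector_derivative_diff[OF has_vector_derivative_scaleR[OF c u'[OF s]]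
          has_vector_derivative_scaleR[OF sn cross'[OF s]]]
      by (rule has_vector_derivative_eq_rhs)
        (simp add: wl[OF s] l_eq[OF s] algebra_simps)
  qed
  then have "\<exists>c. \<forall>s\<in>?I. P s = c"
    using has_vector_derivative_zero_constant[of ?I P] by (metis convex_real_interval(5))
  then obtain p where p: "\<And>s. s \<in> ?I \<Longrightarrow> P s = p" by blast
  have s0: "s0 \<in> ?I" using \<open>s0 < s1\<close> by simp
  note c0 = cross_orthonormal[OF ne nu[OF s0] ue[OF s0]]
  have pe: "e \<bullet> p = 0"
    using p[OF s0] ue[OF s0] c0 by (auto simp: P_def inner_diff_right)
  have "p \<bullet> p = (cos (k * s0))\<^sup>2 + (sin (k * s0))\<^sup>2"
    unfolding p[OF s0, symmetric] P_def using nu[OF s0] c0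
    by (simp add: inner_diff_right inner_diff_left norm_eq_1 power2_eq_square inner_commute algebra_simps)
  then have np: "norm p = 1" by (simp add: norm_eq_1)
  note cp = cross_orthonormal[OF ne np pe]
  have u_eq: "u s = cos (k * s) *\<^sub>R p + sin (k * s) *\<^sub>R (e \<times> p)" if s: "s \<in> ?I" for s
  proof -
    have sc: "\<And>x :: vec3. (cos (k * s) * cos (k * s)) *\<^sub>R x + (sin (k * s) * sin (k * s)) *\<^sub>R x = x"
      by (metis scaleR_left_distrib scaleR_one sin_cos_squared_add3)
    have p_eq: "p = cos (k * s) *\<^sub>R u s - sin (k * s) *\<^sub>R (e \<times> u s)"
      using p[OF s] by (simp add: P_def)
    have ep: "e \<times> p = cos (k * s) *\<^sub>R (e \<times> u s) + sin (k * s) *\<^sub>R u s"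
      unfolding p_eq using cross_orthonormal(4)[OF ne nu[OF s] ue[OF s]]
      by (simp add: cross_mult_right Cross3.right_diff_distrib)
    show ?thesis
      unfolding ep using sc[of "u s"] by (simp add: p_eq algebra_simps)
  qed
  have w_eq: "w s = k *\<^sub>R (cos (k * s) *\<^sub>R (e \<times> p) - sin (k * s) *\<^sub>R p)" if s: "s \<in> ?I" for s
    using wl[OF s] cp(4) by (simp add: l_eq[OF s] u_eq[OF s] cross_add_right cross_mult_right)
  show ?thesis
  proof (cases "k \<ge> 0")
    case True
    then have "k = \<omega>" using k_abs by simp
    then show ?thesis using that[of p "e \<times> p"] np cp pe u_eq w_eq by (simp add: inner_commute)
  next
    \<comment> \<open>Replacing \<open>e \<times> p\<close> by its negative reverses the sense of
      rotation, so that the nonnegative speed \<omega> can appear in the formulas.\<close>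
    case False
    then have "k = - \<omega>" using k_abs by simp
    then show ?thesis using that[of p "- (e \<times> p)"] np cp pe u_eq w_eq
      by (simp add: inner_commute scaleR_add_right scaleR_diff_right)
  qed
qed

end

section \<open>Isometries from orthonormal frames\<close>

lemma vec3_norm_power2: "(norm (x::vec3))\<^sup>2 = (x$1)\<^sup>2 + (x$2)\<^sup>2 + (x$3)\<^sup>2"
  unfolding power2_norm_eq_inner by (simp add: inner_vec_def sum_3 power2_eq_square)

lemma orthonormal_frame_isometry:
  fixes m p q e :: vec3
  assumes "norm p = 1" "norm q = 1" "norm e = 1" "p \<bullet> q = 0" "p \<bullet> e = 0" "q \<bullet> e = 0"
  defines "f \<equiv> \<lambda>x::vec3. m + x$1 *\<^sub>R p + x$2 *\<^sub>R q + x$3 *\<^sub>R e"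
  shows "dist (f x) (f y) = dist x y"
proof -
  have 1: "f x - f y = (x-y)$1 *\<^sub>R p + (x-y)$2 *\<^sub>R q + (x-y)$3 *\<^sub>R e"
    by (simp add: f_def algebra_simps)
  have "(norm (f x - f y))\<^sup>2 = (norm (x - y))\<^sup>2"
    unfolding vec3_norm_power2[of "x - y"] unfolding 1
    unfolding power2_norm_eq_inner using assms
    by (simp add: inner_add_left inner_add_right norm_eq_1 inner_commute power2_eq_square algebra_simps)
  then show ?thesis by (simp add: dist_norm)
qed

section \<open>Tangent balls of sets with reach\<close>

text \<open>Suppose the distance grew with slope at most \<open>l\<close> near \<open>q\<close>.
  Points slightly beyond \<open>q\<close> on the ray from its nearest point \<open>x\<close> would
  have nearest points \<open>y n\<close> with \<open>v \<bullet> (q - y n)\<close> at most about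
  \<open>d * l\<close>. A subsequence converges to a nearest point of \<open>q\<close>, which is
  \<open>x\<close> by uniqueness, where this product equals \<open>d\<close>. Without uniqueness the
  limit could be another nearest point, as at a local maximum of the distance.\<close>

lemma infdist_unit_growth:
  fixes L :: "'a::euclidean_space set"
  assumes "compact L" "L \<noteq> {}"
    and uniq: "\<exists>!x. x \<in> L \<and> dist q x = infdist q L"
    and pos: "0 < infdist q L" and "l < 1" and "\<eta> > 0"
  shows "\<exists>q'. dist q q' < \<eta> \<and> infdist q L + l * dist q q' < infdist q' L"
proof (rule ccontr)
  assume "\<not> ?thesis"
  then have contra: "\<And>q'. dist q q' < \<eta> \<Longrightarrow> infdist q' L \<le> infdist q L + l * dist q q'"
    by (meson not_le)
  define d where "d = infdist q L"
  obtain x where x: "x \<in> L" "dist q x = d" and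
    xu: "\<And>y. \<lbrakk>y \<in> L; dist q y = d\<rbrakk> \<Longrightarrow> y = x"
    using uniq by (auto simp: d_def)
  define v where "v = (1/d) *\<^sub>R (q - x)"
  have "d > 0" using pos by (simp add: d_def)
  have nv: "norm v = 1" using x \<open>d > 0\<close> by (simp add: v_def dist_norm)
  define \<epsilon> where "\<epsilon> n = \<eta> / (real n + 2)" for n :: nat
  have \<epsilon>: "0 < \<epsilon> n" "\<epsilon> n < \<eta>" for n using \<open>\<eta> > 0\<close> by (auto simp: \<epsilon>_def field_simps add_pos_nonneg)
  have \<epsilon>0: "\<epsilon> \<longlonglongrightarrow> 0"
    using LIMSEQ_Suc[OF LIMSEQ_Suc[OF lim_const_over_n[of \<eta>]]]
    by (simp add: \<epsilon>_def[abs_def] add.commute)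
  have "\<exists>y\<in>L. dist (q + \<epsilon> n *\<^sub>R v) y = infdist (q + \<epsilon> n *\<^sub>R v) L" for n
    using infdist_attains_inf[of L "q + \<epsilon> n *\<^sub>R v"] assms by (metis compact_imp_closed)
  then obtain y where y: "\<And>n. y n \<in> L"
    and yd: "\<And>n. dist (q + \<epsilon> n *\<^sub>R v) (y n) = infdist (q + \<epsilon> n *\<^sub>R v) L" by metis
  have yle: "dist (q + \<epsilon> n *\<^sub>R v) (y n) \<le> d + l * \<epsilon> n" for n
    using contra[of "q + \<epsilon> n *\<^sub>R v"] yd[of n] \<epsilon>[of n] nv by (simp add: dist_norm d_def)
  \<comment> \<open>Compares the squared distance from \<open>y n\<close> to \<open>q\<close>, at
    least the square of \<open>d\<close>, with the one to the shifted point; a factor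
    \<open>\<epsilon> n\<close> cancels.\<close>
  have ineq: "2 * (v \<bullet> (q - y n)) \<le> 2 * d * l + l\<^sup>2 * \<epsilon> n" for n
  proof -
    have "d \<le> norm (q - y n)" using infdist_le[OF y, of q] by (simp add: d_def dist_norm)
    then have "d\<^sup>2 \<le> (norm (q - y n))\<^sup>2" using \<open>d > 0\<close> by (intro power_mono) auto
    moreover have "(norm (q + \<epsilon> n *\<^sub>R v - y n))\<^sup>2 \<le> (d + l * \<epsilon> n)\<^sup>2"
      using yle[of n] by (intro power_mono) (auto simp: dist_norm)
    moreover have "(norm (q + \<epsilon> n *\<^sub>R v - y n))\<^sup>2
        = (norm (q - y n))\<^sup>2 + 2 * \<epsilon> n * (v \<bullet> (q - y n)) + (\<epsilon> n)\<^sup>2 * (norm v)\<^sup>2"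
      unfolding power2_norm_eq_inner
      by (simp add: inner_diff_left inner_diff_right inner_add_left inner_add_right inner_commute
          power2_eq_square algebra_simps)
    ultimately have "d\<^sup>2 + 2 * \<epsilon> n * (v \<bullet> (q - y n)) \<le> (d + l * \<epsilon> n)\<^sup>2"
      using zero_le_power2[of "\<epsilon> n"] unfolding nv power_one mult_1_right by linarith
    then have "\<epsilon> n * (2 * (v \<bullet> (q - y n))) \<le> \<epsilon> n * (2 * d * l + l\<^sup>2 * \<epsilon> n)"
      by (simp add: power2_eq_square algebra_simps)
    then show ?thesis using \<epsilon>(1)[of n] by (simp only: mult_le_cancel_left_pos)
  qed
  obtain z r where z: "z \<in> L" "strict_mono r" "(y \<circ> r) \<longlonglongrightarrow> z"
    using \<open>compact L\<close> y unfolding compact_def by metis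
  have er: "(\<lambda>n. \<epsilon> (r n)) \<longlonglongrightarrow> 0"
    using LIMSEQ_subseq_LIMSEQ[OF \<epsilon>0 z(2)] by (simp add: o_def)
  have yz: "(\<lambda>n. y (r n)) \<longlonglongrightarrow> z" using z(3) by (simp add: o_def)
  have "dist (q + 0 *\<^sub>R v) z \<le> d + l * 0"
    by (rule LIMSEQ_le[OF tendsto_dist[OF tendsto_add[OF tendsto_const tendsto_scaleR[OF er tendsto_const]] yz]
          tendsto_add[OF tendsto_const tendsto_mult[OF tendsto_const er]]])
      (use yle in blast)
  then have "dist q z = d" using infdist_le[OF z(1), of q] by (simp add: d_def)
  then have "z = x" using xu z by blast
  have "2 * (v \<bullet> (q - z)) \<le> 2 * d * l + l\<^sup>2 * 0"
    by (rule LIMSEQ_le[OF tendsto_mult[OF tendsto_const tendsto_inner[OF tendsto_const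
            tendsto_diff[OF tendsto_const yz]]]
          tendsto_add[OF tendsto_const tendsto_mult[OF tendsto_const er]]])
      (use ineq in blast)
  moreover have "v \<bullet> (q - x) = d"
    using x(2) \<open>d > 0\<close> by (simp add: v_def dist_norm power2_norm_eq_inner[symmetric] power2_eq_square)
  ultimately show False using \<open>z = x\<close> \<open>d > 0\<close> \<open>l < 1\<close> by simp
qed

text \<open>A maximiser of \<open>\<lambda>q. infdist q L - l * dist q p\<close> on a ball around \<open>p\<close> lies on the boundary for
  \<open>l < 1\<close>, as the distance function has slope \<open>1\<close> wherever the nearest point is unique.\<close>

lemma infdist_grows_along_sphere:
  fixes L :: "'a::euclidean_space set"
  assumes "compact L" "L \<noteq> {}"
    and uniq: "\<And>q. infdist q L < r \<Longrightarrow> \<exists>!x. x \<in> L \<and> dist q x = infdist q L"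
    and pos: "0 < infdist p L" "0 < t" "infdist p L + t < r"
  shows "\<exists>q. dist q p = t \<and> infdist q L = infdist p L + t"
proof -
  have lip: "infdist q L \<le> infdist p L + dist q p" for q using infdist_triangle[of q L p] by simp
  have step: "\<exists>q\<in>cball p t. infdist p L + l * t \<le> infdist q L" if l: "0 < l" "l < 1" for l
  proof -
    have "continuous_on (cball p t) (\<lambda>q. infdist q L - l * dist q p)"
      by (intro continuous_intros continuous_on_infdist)
    then obtain q where q: "q \<in> cball p t"
      and qmax: "\<And>q'. q' \<in> cball p t \<Longrightarrow> infdist q' L - l * dist q' p \<le> infdist q L - l * dist q p"
      using continuous_attains_sup[of "cball p t" "\<lambda>q. infdist q L - l * dist q p"] pos by auto
    have ge: "infdist p L + l * dist q p \<le> infdist q L" using qmax[of p] pos by simp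
    have "dist q p = t"
    proof (rule ccontr)
      assume "dist q p \<noteq> t"
      then have lt: "dist q p < t" using q by (simp add: dist_commute)
      have "0 < infdist q L" using ge pos l by (smt (verit) mult_nonneg_nonneg zero_le_dist)
      moreover have "infdist q L < r" using lip[of q] lt pos by linarith
      ultimately obtain q' where q': "dist q q' < t - dist q p" "infdist q L + l * dist q q' < infdist q' L"
        using infdist_unit_growth[OF assms(1,2) uniq, of q l "t - dist q p"] l lt by auto
      have tri: "dist q' p \<le> dist q q' + dist q p" by (metis dist_triangle3 dist_commute add.commute dist_triangle)
      then have "q' \<in> cball p t" using q' by (simp add: dist_commute)
      from qmax[OF this] q'(2) have "l * dist q q' + l * dist q p < l * dist q' p" by linarith
      moreover have "l * dist q' p \<le> l * (dist q q' + dist q p)" using tri l by (intro mult_left_mono) auto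
      ultimately show False by (simp add: algebra_simps)
    qed
    then show ?thesis using q ge by auto
  qed
  have "continuous_on (cball p t) (\<lambda>q. infdist q L)" by (intro continuous_intros continuous_on_infdist)
  then obtain q where q: "q \<in> cball p t" and qmax: "\<And>q'. q' \<in> cball p t \<Longrightarrow> infdist q' L \<le> infdist q L"
    using continuous_attains_sup[of "cball p t" "\<lambda>q. infdist q L"] pos by auto
  have "t \<le> infdist q L - infdist p L"
  proof (rule field_le_mult_one_interval)
    fix l :: real assume "0 < l" "l < 1"
    from step[OF this] qmax show "l * t \<le> infdist q L - infdist p L" by force
  qed
  then show ?thesis using lip[of q] q by (intro exI[of _ q]) (auto simp: dist_commute)
qed

text \<open>\<open>quad\<close> provides a small tangent ball at \<open>x\<close> that misses
  \<open>L\<close>. From its centre \<open>p\<close> the distance to \<open>L\<close> can be pushed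
  up to \<rho> by a move of length \<open>\<rho> - s\<close>. The point reached is at least \<rho>
  away from \<open>x\<close>, so the move went straight along \<open>n\<close>, and the tangent ball
  of radius \<rho> is empty too.\<close>

lemma unique_nearest_imp_empty_tangent_ball:
  fixes L :: "'a::euclidean_space set"
  assumes "compact L"
    and uniq: "\<And>q. infdist q L < r \<Longrightarrow> \<exists>!x. x \<in> L \<and> dist q x = infdist q L"
    and x: "x \<in> L" and n: "norm n = 1"
    and quad: "\<And>y. y \<in> L \<Longrightarrow> (y - x) \<bullet> n \<le> C * (norm (y - x))\<^sup>2"
    and rad: "0 \<le> \<rho>" "\<rho> < r" and y: "y \<in> L"
  shows "2 * \<rho> * ((y - x) \<bullet> n) \<le> (norm (y - x))\<^sup>2"
proof -
  have expand: "(norm (x + s *\<^sub>R n - y))\<^sup>2 = s\<^sup>2 + ((norm (y - x))\<^sup>2 - 2 * s * ((y - x) \<bullet> n))" for s y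
    using n unfolding power2_norm_eq_inner norm_eq_1
    by (simp add: inner_diff_left inner_diff_right inner_add_left inner_add_right inner_commute
          power2_eq_square algebra_simps)
  \<comment> \<open>Both sides say that the open ball of radius \<open>s\<close> about
    \<open>x + s n\<close> misses \<open>L\<close>; the point \<open>x\<close> lies on its
    sphere.\<close>
  have iff: "infdist (x + s *\<^sub>R n) L = s \<longleftrightarrow> (\<forall>y\<in>L. 2 * s * ((y - x) \<bullet> n) \<le> (norm (y - x))\<^sup>2)"
    if "s \<ge> 0" for s
  proof
    assume a: "infdist (x + s *\<^sub>R n) L = s"
    show "\<forall>y\<in>L. 2 * s * ((y - x) \<bullet> n) \<le> (norm (y - x))\<^sup>2"
    proof
      fix y assume "y \<in> L"
      then have "s \<le> norm (x + s *\<^sub>R n - y)" using infdist_le[of y L "x + s *\<^sub>R n"] a by (simp add: dist_norm)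
      then have "s\<^sup>2 \<le> (norm (x + s *\<^sub>R n - y))\<^sup>2" using that by (rule power_mono)
      then show "2 * s * ((y - x) \<bullet> n) \<le> (norm (y - x))\<^sup>2" unfolding expand by simp
    qed
  next
    assume a: "\<forall>y\<in>L. 2 * s * ((y - x) \<bullet> n) \<le> (norm (y - x))\<^sup>2"
    have "s \<le> dist (x + s *\<^sub>R n) y" if "y \<in> L" for y
    proof -
      have "s\<^sup>2 \<le> (norm (x + s *\<^sub>R n - y))\<^sup>2" using a that unfolding expand by simp
      then show ?thesis unfolding dist_norm by (rule power2_le_imp_le) simp
    qed
    then have "s \<le> infdist (x + s *\<^sub>R n) L" 
      using x unfolding infdist_notempty[OF ex_in_conv[THEN iffD1, OF exI, OF x]] by (intro cINF_greatest) auto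
    moreover have "infdist (x + s *\<^sub>R n) L \<le> s"
      using infdist_le[OF x, of "x + s *\<^sub>R n"] n that by (simp add: dist_norm)
    ultimately show "infdist (x + s *\<^sub>R n) L = s" by simp
  qed
  define K where "K = \<bar>C\<bar> + 1"
  have K: "K > 0" by (simp add: K_def add_nonneg_pos)
  \<comment> \<open>This radius satisfies \<open>2 * s * K = 1\<close>, which turns the quadratic
    bound into an empty ball; \<open>K\<close> is positive whatever the sign of
    \<open>C\<close>.\<close>
  define s where "s = 1 / K / 2"
  have s: "s > 0" using K by (simp add: s_def)
  have small: "2 * s * ((y - x) \<bullet> n) \<le> (norm (y - x))\<^sup>2" if "y \<in> L" for y
  proof -
    have "C * (norm (y - x))\<^sup>2 \<le> K * (norm (y - x))\<^sup>2"
      unfolding K_def by (intro mult_right_mono) auto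
    then have "(y - x) \<bullet> n \<le> K * (norm (y - x))\<^sup>2" using quad[OF that] by linarith
    then show ?thesis using K by (simp add: s_def pos_divide_le_eq mult.commute)
  qed
  show ?thesis
  proof (cases "\<rho> \<le> s")
    case True
    show ?thesis
    proof (cases "(y - x) \<bullet> n \<le> 0")
      case True
      then have "2 * \<rho> * ((y - x) \<bullet> n) \<le> 0" using rad by (simp add: mult_nonneg_nonpos)
      then show ?thesis by (smt (verit) zero_le_power2)
    next
      case False
      then have "2 * \<rho> * ((y - x) \<bullet> n) \<le> 2 * s * ((y - x) \<bullet> n)"
        using \<open>\<rho> \<le> s\<close> by (intro mult_right_mono) auto
      then show ?thesis using small[OF y] by linarith
    qed
  next
    case False
    define p where "p = x + s *\<^sub>R n"
    have dp: "infdist p L = s" unfolding p_def using iff s small by simp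
    obtain q where q: "dist q p = \<rho> - s" "infdist q L = \<rho>"
      using infdist_grows_along_sphere[OF \<open>compact L\<close> _ uniq, where p = p and t = "\<rho> - s"] x dp s False rad by auto
    have le: "\<rho> \<le> norm (q - x)" using infdist_le[OF x, of q] q by (simp add: dist_norm)
    \<comment> \<open>The equality case of the triangle inequality: \<open>w\<close> has length
      \<open>\<rho> - s\<close> and \<open>w + s n\<close> has length at least \<rho>, so
      \<open>w\<close> is \<open>\<rho> - s\<close> times \<open>n\<close>.\<close>
    define w where "w = q - p"
    have nw: "norm w = \<rho> - s" using q by (simp add: w_def dist_norm)
    have qx: "q - x = w + s *\<^sub>R n" by (simp add: w_def p_def)
    define c where "c = \<rho> - s"
    have ww: "w \<bullet> w = c * c" using nw by (metis c_def power2_norm_eq_inner power2_eq_square)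
    have nn: "n \<bullet> n = 1" using n by (simp add: norm_eq_1)
    have "\<rho>\<^sup>2 \<le> (norm (q - x))\<^sup>2" using le rad by (intro power_mono)
    also have "\<dots> = c * c + 2 * s * (w \<bullet> n) + s\<^sup>2"
      unfolding qx power2_norm_eq_inner
      by (simp add: inner_add_left inner_add_right inner_commute[of n w] power2_eq_square ww nn distrib_left)
    finally have "s * (\<rho> - s) \<le> s * (w \<bullet> n)" by (simp add: c_def power2_eq_square algebra_simps)
    then have wn: "c \<le> w \<bullet> n" using s by (simp add: c_def)
    have "(norm (w - c *\<^sub>R n))\<^sup>2 = 2 * (c * c - c * (w \<bullet> n))"
      unfolding power2_norm_eq_inner
      by (simp add: inner_diff_left inner_diff_right inner_commute[of n w] ww nn algebra_simps)
    also have "\<dots> \<le> 0" using False mult_left_mono[OF wn, of c] by (simp add: c_def)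
    finally have "w = (\<rho> - s) *\<^sub>R n" by (simp add: c_def)
    then have "q = x + \<rho> *\<^sub>R n" using qx by (simp add: algebra_simps)
    then show ?thesis using iff[of \<rho>] q rad y by simp
  qed
qed

text \<open>The supremum in \<open>reach\<close> need not be attained, so balls of radius
  \<open>l / 2\<close> are used for all \<open>l < 1\<close> and \<open>l\<close> tends to
  1.\<close>

lemma reach_half_imp_empty_tangent_ball:
  fixes L :: "vec3 set"
  assumes "compact L" and reach: "1 \<le> 2 * reach L"
    and x: "x \<in> L" and n: "norm n = 1"
    and quad: "\<And>y. y \<in> L \<Longrightarrow> (y - x) \<bullet> n \<le> C * (norm (y - x))\<^sup>2"
    and y: "y \<in> L"
  shows "(y - x) \<bullet> n \<le> (norm (y - x))\<^sup>2"
proof (rule field_le_mult_one_interval)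
  fix l :: real assume l: "0 < l" "l < 1"
  have "ereal (l / 2) < reach L"
  proof (rule ccontr)
    assume "\<not> ?thesis"
    then have "2 * reach L \<le> 2 * ereal (l / 2)" by (intro ereal_mult_left_mono) auto
    also have "2 * ereal (l / 2) = ereal l"
      using times_ereal.simps(1)[of 2 "l / 2"] by simp
    finally have "(1::ereal) \<le> ereal l" using reach by (rule order_trans[rotated])
    then show False using l by simp
  qed
  then obtain r where r: "l / 2 < r" and
    "\<And>p. infdist p L < r \<Longrightarrow> \<exists>!x. x \<in> L \<and> dist p x = infdist p L"
    unfolding reach_def less_Sup_iff by auto
  then have "2 * (l / 2) * ((y - x) \<bullet> n) \<le> (norm (y - x))\<^sup>2"
    using unique_nearest_imp_empty_tangent_ball[OF \<open>compact L\<close> _ x n quad, of r "l / 2" y] l y by auto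
  then show "l * ((y - x) \<bullet> n) \<le> (norm (y - x))\<^sup>2" by simp
qed

section \<open>Arcs of a link\<close>

text \<open>By uniform continuity of \<open>c'\<close> one \<delta> serves all base points, and the
  comparison tangent may sit anywhere between \<open>u\<close> and \<open>v\<close>. This takes the
  place of a second-order Taylor expansion.\<close>

lemma uniform_linearization:
  fixes c c' :: "real \<Rightarrow> 'a::real_normed_vector"
  assumes c': "\<And>u. u \<in> {s..t} \<Longrightarrow> (c has_vector_derivative c' u) (at u within {s..t})"
    and "continuous_on {s..t} c'" and "\<epsilon> > 0"
  obtains \<delta> where "\<delta> > 0"
    "\<And>u v x. \<lbrakk>u \<in> {s..t}; v \<in> {s..t}; u \<le> v; v - u < \<delta>; x \<in> {u..v}\<rbrakk>
        \<Longrightarrow> norm (c v - c u - (v - u) *\<^sub>R c' x) \<le> \<epsilon> * (v - u)"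
proof -
  have "uniformly_continuous_on {s..t} c'"
    using assms(2) compact_uniformly_continuous compact_Icc by blast
  then obtain \<delta> where "\<delta> > 0" and \<delta>: "\<And>u v. \<lbrakk>u \<in> {s..t}; v \<in> {s..t}; dist v u < \<delta>\<rbrakk> \<Longrightarrow> dist (c' v) (c' u) < \<epsilon>"
    using \<open>\<epsilon> > 0\<close> unfolding uniformly_continuous_on_def by metis
  show thesis
  proof (rule that[OF \<open>\<delta> > 0\<close>])
    fix u v x assume uv: "u \<in> {s..t}" "v \<in> {s..t}" "u \<le> v" "v - u < \<delta>" "x \<in> {u..v}"
    have "norm (c v - c u - (v - u) *\<^sub>R c' x) \<le> norm (v - u) * \<epsilon>"
    proof (rule vector_differentiable_bound_linearization[where S = "{u..v}"])
      fix y assume "y \<in> {u..v}"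
      then show "(c has_vector_derivative c' y) (at y within {u..v})"
        using uv by (intro has_vector_derivative_within_subset[OF c']) auto
      show "norm (c' y - c' x) \<le> \<epsilon>"
        using \<delta>[of x y] uv \<open>y \<in> {u..v}\<close> by (auto simp: dist_norm dist_real_def less_imp_le)
    qed (use uv in \<open>auto simp: closed_segment_eq_real_ivl\<close>)
    then show "norm (c v - c u - (v - u) *\<^sub>R c' x) \<le> \<epsilon> * (v - u)"
      using uv by (simp add: mult.commute)
  qed
qed

lemma unit_speed_dist_le:
  fixes c :: "real \<Rightarrow> 'a::real_normed_vector"
  assumes c': "\<And>u. u \<in> {s..t} \<Longrightarrow> (c has_vector_derivative c' u) (at u within {s..t})"
    and n: "\<And>u. u \<in> {s..t} \<Longrightarrow> norm (c' u) \<le> 1"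
    and uv: "u \<in> {s..t}" "v \<in> {s..t}"
  shows "norm (c v - c u) \<le> \<bar>v - u\<bar>"
proof -
  have "norm (c v - c u) \<le> 1 * norm (v - u)"
  proof (rule differentiable_bound[where S = "{s..t}" and f' = "\<lambda>x h. h *\<^sub>R c' x"])
    fix x assume x: "x \<in> {s..t}"
    show "(c has_derivative (\<lambda>h. h *\<^sub>R c' x)) (at x within {s..t})"
      using c'[OF x] by (simp add: has_vector_derivative_def)
    show "onorm (\<lambda>h. h *\<^sub>R c' x) \<le> 1"
      using n[OF x] by (intro onorm_le) (simp add: mult_left_le)
  qed (use uv in auto)
  then show ?thesis by simp
qed

text \<open>For a unit vector \<open>n\<close> the inequality says that \<open>y\<close> lies
  outside the open ball of radius 1/2 centred at \<open>x + n / 2\<close>. The homogeneous form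
  admits normals of any length, so that computed normals need no scaling.\<close>

definition empty_tangent_balls :: "vec3 set \<Rightarrow> (vec3 \<Rightarrow> vec3) \<Rightarrow> bool" where
  "empty_tangent_balls L T \<longleftrightarrow>
     (\<forall>x\<in>L. \<forall>y\<in>L. \<forall>n. n \<bullet> T x = 0 \<longrightarrow> (y - x) \<bullet> n \<le> norm n * (norm (y - x))\<^sup>2)"

definition arc_param :: "vec3 set \<Rightarrow> (vec3 \<Rightarrow> vec3) \<Rightarrow> (real \<Rightarrow> vec3) \<Rightarrow> real \<Rightarrow> real \<Rightarrow> bool" where
  "arc_param L T \<gamma> s t \<longleftrightarrow> s < t \<and> inj_on \<gamma> {s..t} \<and> \<gamma> ` {s..t} \<subseteq> L \<and>
     (\<forall>u\<in>{s..t}. (\<gamma> has_vector_derivative T (\<gamma> u)) (at u within {s..t}))"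

lemma subarc_imp_arc_param:
  assumes "subarc L T A"
  obtains \<gamma> s t where "arc_param L T \<gamma> s t" "\<gamma> ` {s..t} = A"
  using assms unfolding subarc_def arc_param_def by blast

lemma norm_tangent:
  assumes "link L T" "x \<in> L" shows "norm (T x) = 1"
proof -
  obtain c I where "arclength_chart L T c I" "x \<in> c ` I" using assms unfolding link_def by blast
  then show ?thesis unfolding arclength_chart_def by blast
qed

text \<open>A Lipschitz tangent keeps the chart within \<open>M\<close> times the squared parameter
  distance of its tangent line, and near \<open>t0\<close> this distance is at most twice the chord.
  Points of \<open>L\<close> outside a short piece of the chart keep a positive distance
  \<open>e\<close>, where the chord itself is a sufficient bound. This yields the small ball from
  which larger tangent balls are grown.\<close>

lemma chart_quadratic_contact:
  assumes ch: "arclength_chart L T c I" and t0: "t0 \<in> I" and n: "norm n = 1" "n \<bullet> T (c t0) = 0"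
  shows "\<exists>C. \<forall>y\<in>L. (y - c t0) \<bullet> n \<le> C * (norm (y - c t0))\<^sup>2"
proof -
  from ch obtain g M where I: "is_interval I" and op: "openin (top_of_set L) (c ` I)"
    and hom: "homeomorphism I (c ` I) c g"
    and c': "\<And>t. t \<in> I \<Longrightarrow> (c has_vector_derivative T (c t)) (at t within I)"
    and n1: "\<And>t. t \<in> I \<Longrightarrow> norm (T (c t)) = 1"
    and M: "M-lipschitz_on I (\<lambda>t. T (c t))" unfolding arclength_chart_def by blast
  have M0: "M \<ge> 0" using M by (rule lipschitz_on_nonneg)
  have lin: "norm (c s - c t0 - (s - t0) *\<^sub>R T (c t0)) \<le> M * (s - t0)\<^sup>2" if s: "s \<in> I" for s
  proof -
    have sub: "closed_segment t0 s \<subseteq> I"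
      using I t0 s by (simp add: closed_segment_subset is_interval_convex)
    have "norm (c s - c t0 - (s - t0) *\<^sub>R T (c t0)) \<le> norm (s - t0) * (M * \<bar>s - t0\<bar>)"
    proof (rule vector_differentiable_bound_linearization[where S = "closed_segment t0 s"])
      fix y assume y: "y \<in> closed_segment t0 s"
      then show "(c has_vector_derivative T (c y)) (at y within closed_segment t0 s)"
        using sub by (intro has_vector_derivative_within_subset[OF c']) auto
      have "norm (T (c y) - T (c t0)) \<le> M * \<bar>y - t0\<bar>"
        using lipschitz_onD[OF M, of y t0] y sub t0 by (auto simp: dist_norm dist_real_def)
      also have "\<dots> \<le> M * \<bar>s - t0\<bar>"
        using y M0 by (intro mult_left_mono) (auto simp: closed_segment_eq_real_ivl split: if_splits)
      finally show "norm (T (c y) - T (c t0)) \<le> M * \<bar>s - t0\<bar>" .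
    qed auto
    then show ?thesis by (simp add: power2_eq_square abs_mult_self_eq mult.left_commute)
  qed
  \<comment> \<open>Ensures \<open>M * \<delta> \<le> 1/2\<close>, so that the chart deviates from
    the tangent line by at most half the parameter distance; the summand 1 covers
    \<open>M = 0\<close>.\<close>
  define \<delta> where "\<delta> = 1 / (2 * (M + 1))"
  have \<delta>: "\<delta> > 0" "M * \<delta> \<le> 1/2" using M0 by (auto simp: \<delta>_def field_simps)
  have near: "(c s - c t0) \<bullet> n \<le> 4 * M * (norm (c s - c t0))\<^sup>2" if s: "s \<in> I" "\<bar>s - t0\<bar> < \<delta>" for s
  proof -
    have "(c s - c t0) \<bullet> n = (c s - c t0 - (s - t0) *\<^sub>R T (c t0)) \<bullet> n"
      using n(2) by (simp add: inner_diff_left inner_commute[of "T (c t0)"])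
    also have "\<dots> \<le> norm (c s - c t0 - (s - t0) *\<^sub>R T (c t0))"
      using Cauchy_Schwarz_ineq2[of "c s - c t0 - (s - t0) *\<^sub>R T (c t0)" n]
      unfolding n(1) mult_1_right by linarith
    finally have 1: "(c s - c t0) \<bullet> n \<le> M * (s - t0)\<^sup>2" using lin[OF s(1)] by linarith
    have "M * \<bar>s - t0\<bar> \<le> 1/2" using \<delta>(2) s(2) M0 mult_left_mono[of "\<bar>s - t0\<bar>" \<delta> M] by linarith
    then have "M * (s - t0)\<^sup>2 \<le> 1/2 * \<bar>s - t0\<bar>"
      using mult_right_mono[of "M * \<bar>s - t0\<bar>" "1/2" "\<bar>s - t0\<bar>"] by (simp add: power2_eq_square mult.assoc)
    then have half: "norm (c s - c t0 - (s - t0) *\<^sub>R T (c t0)) \<le> 1/2 * \<bar>s - t0\<bar>"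
      using lin[OF s(1)] by (rule order_trans[rotated])
    have "\<bar>s - t0\<bar> = norm ((s - t0) *\<^sub>R T (c t0))" using n1[OF t0] by simp
    also have "\<dots> \<le> norm (c s - c t0) + norm (c s - c t0 - (s - t0) *\<^sub>R T (c t0))"
      by (metis norm_triangle_sub norm_minus_commute)
    also have "\<dots> \<le> norm (c s - c t0) + 1/2 * \<bar>s - t0\<bar>" using half by (rule add_left_mono)
    finally have "\<bar>s - t0\<bar> \<le> 2 * norm (c s - c t0)" by simp
    then have "\<bar>s - t0\<bar>\<^sup>2 \<le> (2 * norm (c s - c t0))\<^sup>2" by (intro power_mono) auto
    then have "(s - t0)\<^sup>2 \<le> 4 * (norm (c s - c t0))\<^sup>2" by (simp add: power_mult_distrib)
    then have "M * (s - t0)\<^sup>2 \<le> M * (4 * (norm (c s - c t0))\<^sup>2)" using M0 by (rule mult_left_mono)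
    then show ?thesis using 1 by simp
  qed
  \<comment> \<open>A short piece of the chart is still open in \<open>L\<close>, hence no other
    strand of the link comes arbitrarily close to \<open>c t0\<close>.\<close>
  have "openin (top_of_set I) (I \<inter> {t0 - \<delta><..<t0 + \<delta>})" by (simp add: openin_open_Int)
  then have "openin (top_of_set (c ` I)) (c ` (I \<inter> {t0 - \<delta><..<t0 + \<delta>}))"
    using hom homeomorphism_imp_open_map by blast
  then have "openin (top_of_set L) (c ` (I \<inter> {t0 - \<delta><..<t0 + \<delta>}))" using op openin_trans by blast
  moreover have "c t0 \<in> c ` (I \<inter> {t0 - \<delta><..<t0 + \<delta>})" using t0 \<delta> by auto
  ultimately obtain e where e: "e > 0"
    "\<And>y. \<lbrakk>y \<in> L; dist y (c t0) < e\<rbrakk> \<Longrightarrow> y \<in> c ` (I \<inter> {t0 - \<delta><..<t0 + \<delta>})"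
    unfolding openin_euclidean_subtopology_iff by blast
  show ?thesis
  proof (intro exI ballI)
    fix y assume y: "y \<in> L"
    define N where "N = norm (y - c t0)"
    show "(y - c t0) \<bullet> n \<le> max (4 * M) (1 / e) * (norm (y - c t0))\<^sup>2"
    proof (cases "dist y (c t0) < e")
      case True
      then obtain s where s: "s \<in> I" "\<bar>s - t0\<bar> < \<delta>" "y = c s" using e(2)[OF y] by auto
      have "4 * M * (norm (y - c t0))\<^sup>2 \<le> max (4 * M) (1 / e) * (norm (y - c t0))\<^sup>2"
        by (intro mult_right_mono) auto
      then show ?thesis using near[OF s(1,2)] s(3) by simp
    next
      case False
      then have "e \<le> N" by (simp add: dist_norm N_def)
      then have "N * e \<le> N * N" using e by (intro mult_left_mono) auto
      then have "N \<le> 1 / e * N\<^sup>2" using e by (simp add: field_simps power2_eq_square)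
      also have "\<dots> \<le> max (4 * M) (1 / e) * N\<^sup>2" by (intro mult_right_mono) auto
      finally show ?thesis
        using Cauchy_Schwarz_ineq2[of "y - c t0" n] n by (simp add: N_def)
    qed
  qed
qed

lemma Thi_one_imp_empty_tangent_balls:
  assumes "link L T" "Thi \<sigma> L T = 1"
  shows "empty_tangent_balls L T"
  unfolding empty_tangent_balls_def
proof (intro ballI allI impI)
  fix x y n assume x: "x \<in> L" and y: "y \<in> L" and n: "n \<bullet> T x = 0"
  have r: "1 \<le> 2 * reach L" using assms(2) unfolding Thi_def by (metis min.cobounded1)
  show "(y - x) \<bullet> n \<le> norm n * (norm (y - x))\<^sup>2"
  proof (cases "n = 0")
    case False
    define m where "m = (1 / norm n) *\<^sub>R n"
    have m: "norm m = 1" "m \<bullet> T x = 0" using False n by (auto simp: m_def)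
    obtain c I t where "arclength_chart L T c I" "t \<in> I" "x = c t"
      using assms(1) x unfolding link_def by blast
    then obtain C where "\<forall>y\<in>L. (y - x) \<bullet> m \<le> C * (norm (y - x))\<^sup>2"
      using chart_quadratic_contact m by blast
    then have "(y - x) \<bullet> m \<le> (norm (y - x))\<^sup>2"
      using reach_half_imp_empty_tangent_ball[OF _ r x m(1) _ y] assms(1) unfolding link_def by blast
    then show ?thesis using False by (simp add: m_def field_simps)
  qed simp
qed

section \<open>Position of arcs inside the link\<close>

lemma continuous_on_tangent:
  assumes "link L T" shows "continuous_on L T"
  unfolding continuous_on_eq_continuous_within
proof
  fix x assume "x \<in> L"
  then obtain c I where ch: "arclength_chart L T c I" and x: "x \<in> c ` I"
    using assms unfolding link_def by blast
  from ch obtain g M where op: "openin (top_of_set L) (c ` I)"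
    and hom: "homeomorphism I (c ` I) c g"
    and M: "M-lipschitz_on I (\<lambda>t. T (c t))" unfolding arclength_chart_def by blast
  have "continuous_on (c ` I) (\<lambda>y. T (c (g y)))"
    by (rule continuous_on_compose2[OF lipschitz_on_continuous_on[OF M]])
      (use hom in \<open>auto simp: homeomorphism_def\<close>)
  then have "continuous_on (c ` I) T"
    by (rule continuous_on_cong[THEN iffD1, rotated -1]) (use hom in \<open>auto simp: homeomorphism_def\<close>)
  then have "continuous (at x within c ` I) T" using x continuous_on_eq_continuous_within by blast
  moreover obtain O' where O': "open O'" "c ` I = L \<inter> O'" using op by (auto simp: openin_open)
  have "at x within c ` I = at x within L"
    by (rule at_within_nhd[where S = O']) (use O' x in auto)
  ultimately show "continuous (at x within L) T" by simp
qed

lemma arc_param_continuous: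
  assumes "arc_param L T \<gamma> s t" shows "continuous_on {s..t} \<gamma>"
  using assms unfolding arc_param_def
  by (meson continuous_on_eq_continuous_within has_vector_derivative_continuous)

text \<open>In a chart around an interior point the arc runs monotonically, so it covers a full
  neighbourhood and the point is no end of the chart.\<close>

lemma arc_param_interior:
  assumes ap: "arc_param L T \<gamma> s t" and u: "u \<in> {s<..<t}"
    and ch: "arclength_chart L T c I" and v: "v \<in> I" "c v = \<gamma> u" and ab: "a < u" "u < b"
  shows "v \<in> interior I"
    and "\<exists>U. openin (top_of_set L) U \<and> \<gamma> u \<in> U \<and> U \<subseteq> \<gamma> ` {a<..<b}"
proof -
  from ch obtain g where op: "openin (top_of_set L) (c ` I)" and I: "is_interval I"
    and hom: "homeomorphism I (c ` I) c g" unfolding arclength_chart_def by blast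
  obtain O' where O': "open O'" "c ` I = L \<inter> O'" using op by (auto simp: openin_open)
  have cont: "continuous_on {s..t} \<gamma>" using ap by (rule arc_param_continuous)
  have gL: "\<gamma> ` {s..t} \<subseteq> L" and inj: "inj_on \<gamma> {s..t}" using ap by (auto simp: arc_param_def)
  have "continuous (at u) \<gamma>"
    using cont u by (simp add: continuous_on_interior)
  moreover have "\<gamma> u \<in> O'" using O' v by (metis IntD2 imageI)
  ultimately have "\<forall>\<^sub>F w in at u. \<gamma> w \<in> O'"
    using O'(1) by (simp add: continuous_at topological_tendstoD)
  then obtain d where "d > 0" and d': "\<forall>w. w \<noteq> u \<and> dist w u < d \<longrightarrow> \<gamma> w \<in> O'"
    using eventually_at[of "\<lambda>w. \<gamma> w \<in> O'" u UNIV] by auto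
  then have d: "\<gamma> w \<in> O'" if "dist w u < d" for w
    using that \<open>\<gamma> u \<in> O'\<close> by (cases "w = u") auto
  define m where "m = min d (min (min (u - s) (t - u)) (min (u - a) (b - u)))"
  have "m > 0" using \<open>d > 0\<close> u ab by (simp add: m_def)
  moreover have "m \<le> d" "m \<le> u - s" "m \<le> t - u" "m \<le> u - a" "m \<le> b - u"
    unfolding m_def by (rule min.coboundedI1 min.coboundedI2 order_refl)+
  moreover define h where "h = m / 2"
  ultimately have h: "h > 0" "h < d" "h < u - s" "h < t - u" "h < u - a" "h < b - u"
    by linarith+
  define J where "J = {u - h..u + h}"
  have J: "J \<subseteq> {s..t}" "J \<subseteq> {a<..<b}" using h by (auto simp: J_def)
  have JI: "\<gamma> ` J \<subseteq> c ` I"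
    unfolding O'(2) using d gL J h by (auto simp: J_def dist_real_def)
  define \<tau> where "\<tau> = g \<circ> \<gamma>"
  have gc: "\<And>x. x \<in> I \<Longrightarrow> g (c x) = x" and cg: "\<And>y. y \<in> c ` I \<Longrightarrow> c (g y) = y"
    and gI: "\<And>y. y \<in> c ` I \<Longrightarrow> g y \<in> I"
    using hom by (auto simp: homeomorphism_def)
  have contg: "continuous_on (c ` I) g" using hom by (simp add: homeomorphism_def)
  have ct: "continuous_on J \<tau>" unfolding \<tau>_def
    by (intro continuous_on_compose continuous_on_subset[OF cont] J continuous_on_subset[OF contg] JI)
  have it: "inj_on \<tau> J"
  proof (rule inj_onI)
    fix x y assume xy: "x \<in> J" "y \<in> J" "\<tau> x = \<tau> y"
    then have "c (\<tau> x) = c (\<tau> y)" by simp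
    moreover have "\<gamma> x \<in> c ` I" "\<gamma> y \<in> c ` I" using JI xy by blast+
    ultimately have "\<gamma> x = \<gamma> y" by (simp add: \<tau>_def cg)
    then show "x = y" by (rule inj_onD[OF inj]) (use xy J in blast)+
  qed
  have tu: "\<tau> u = v" using gc[OF v(1)] v(2) by (simp add: \<tau>_def)
  have mono: "\<tau> (u - h) < v \<and> v < \<tau> (u + h) \<or> \<tau> (u + h) < v \<and> v < \<tau> (u - h)"
    using continuous_inj_imp_mono[of "u - h" u "u + h" \<tau>] ct it h tu by (auto simp: J_def)
  define lo hi where "lo = min (\<tau> (u - h)) (\<tau> (u + h))" and "hi = max (\<tau> (u - h)) (\<tau> (u + h))"
  have lohi: "lo < v" "v < hi" using mono by (auto simp: lo_def hi_def)
  have conn: "is_interval (\<tau> ` J)"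
    using connected_continuous_image[OF ct] by (simp add: J_def is_interval_connected_1)
  have "\<tau> (u - h) \<in> \<tau> ` J" "\<tau> (u + h) \<in> \<tau> ` J" using h by (auto simp: J_def)
  then have lohiJ: "lo \<in> \<tau> ` J" "hi \<in> \<tau> ` J" by (simp_all add: lo_def hi_def min_def max_def)
  have sub: "{lo<..<hi} \<subseteq> \<tau> ` J"
  proof
    fix x assume "x \<in> {lo<..<hi}"
    then show "x \<in> \<tau> ` J"
      using conn[unfolded is_interval_1, rule_format, OF lohiJ, of x] by simp
  qed
  have subI: "\<tau> ` J \<subseteq> I" using gI JI by (auto simp: \<tau>_def)
  show "v \<in> interior I" 
    by (rule interiorI[of "{lo<..<hi}"]) (use sub subI lohi in auto)
  have "openin (top_of_set I) {lo<..<hi}" 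
    by (rule open_subset) (use sub subI in auto)
  then have "openin (top_of_set (c ` I)) (c ` {lo<..<hi})" using hom homeomorphism_imp_open_map by blast
  then have "openin (top_of_set L) (c ` {lo<..<hi})" using op openin_trans by blast
  moreover have "\<gamma> u \<in> c ` {lo<..<hi}" using lohi v by (metis greaterThanLessThan_iff imageI)
  moreover have "c ` {lo<..<hi} \<subseteq> \<gamma> ` {a<..<b}"
  proof -
    have "c ` {lo<..<hi} \<subseteq> c ` \<tau> ` J" using sub by blast
    also have "\<dots> = \<gamma> ` J"
      unfolding image_image \<tau>_def using cg JI by (intro image_cong) auto
    also have "\<dots> \<subseteq> \<gamma> ` {a<..<b}" using J by blast
    finally show ?thesis .
  qed
  ultimately show "\<exists>U. openin (top_of_set L) U \<and> \<gamma> u \<in> U \<and> U \<subseteq> \<gamma> ` {a<..<b}" by blast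
qed

text \<open>Serves two purposes: fields supported near interior points of an arc are compatible with
  every endpoint constraint, and at such points the normal cone condition on struts becomes
  perpendicularity.\<close>

lemma arc_param_not_end:
  assumes ap: "arc_param L T \<gamma> s t" and u: "u \<in> {s<..<t}"
  shows "\<not> initial_point L T (\<gamma> u)" "\<not> terminal_point L T (\<gamma> u)"
proof -
  have int: "v \<in> interior I" if "arclength_chart L T c I" "v \<in> I" "c v = \<gamma> u" for c I v
    using arc_param_interior(1)[OF ap u that, of s t] u by auto
  have nb: "(\<exists>w\<in>I. w < v) \<and> (\<exists>w\<in>I. v < w)" if v: "v \<in> interior I" for v :: real and I
  proof -
    obtain e where e: "e > 0" "ball v e \<subseteq> I" using v unfolding mem_interior by blast
    then have "v - e/2 \<in> I" "v + e/2 \<in> I" by (auto simp: subset_iff dist_real_def)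
    then show ?thesis using \<open>e > 0\<close>
      by (intro conjI bexI[of _ "v - e/2"] bexI[of _ "v + e/2"]) auto
  qed
  show "\<not> initial_point L T (\<gamma> u)" "\<not> terminal_point L T (\<gamma> u)"
    unfolding initial_point_def terminal_point_def using int nb by (metis not_le)+
qed

lemma arc_param_open:
  assumes "link L T" "arc_param L T \<gamma> s t" "s \<le> a" "b \<le> t"
  shows "openin (top_of_set L) (\<gamma> ` {a<..<b})"
proof (subst openin_subopen, intro ballI)
  fix x assume "x \<in> \<gamma> ` {a<..<b}"
  then obtain u where u: "u \<in> {a<..<b}" "x = \<gamma> u" by blast
  have "x \<in> L" using u assms by (auto simp: arc_param_def)
  then obtain c I v where "arclength_chart L T c I" "v \<in> I" "c v = x"
    using assms(1) unfolding link_def by (metis imageE)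
  then show "\<exists>U. openin (top_of_set L) U \<and> x \<in> U \<and> U \<subseteq> \<gamma> ` {a<..<b}"
    using arc_param_interior(2)[OF assms(2), of u c I v a b] u assms by auto
qed

text \<open>The part of \<open>T y\<close> normal to \<open>T x\<close> is a normal at
  \<open>x\<close>, and likewise with \<open>x\<close> and \<open>y\<close> exchanged. Both ends
  thus supply an empty ball; adding the two inequalities and cancelling one factor \<open>N\<close>
  gives the bound. For points at small distance \<open>h\<close> along an arc the left side is about
  \<open>2 * h * N\<close>, which bounds the turning rate by 2.\<close>

lemma tangent_rotation_bound:
  assumes "link L T" "empty_tangent_balls L T" "x \<in> L" "y \<in> L"
  shows "norm (T y - T x) * ((y - x) \<bullet> (T x + T y)) \<le> 4 * (norm (y - x))\<^sup>2"
proof -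
  define d where "d = y - x"
  define c where "c = T x \<bullet> T y"
  define N where "N = norm (T y - T x)"
  define M where "M = norm (T x + T y)"
  have one: "T x \<bullet> T x = 1" "T y \<bullet> T y = 1"
    using norm_tangent[OF assms(1)] assms(3,4) by (auto simp: norm_eq_1)
  have yx: "T y \<bullet> T x = c" and xy: "T x \<bullet> T y = c" by (simp_all add: c_def inner_commute)
  have N2: "N\<^sup>2 = 2 * (1 - c)" and M2: "M\<^sup>2 = 2 * (1 + c)"
    unfolding N_def M_def power2_norm_eq_inner
    by (simp_all add: inner_diff_left inner_diff_right inner_add_left inner_add_right one xy yx)
  \<comment> \<open>If \<theta> is the angle between the tangents, then
    \<open>N = 2 * sin (\<theta> / 2)\<close> and \<open>M = 2 * cos (\<theta> / 2)\<close>; both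
    norms equal \<open>sin \<theta>\<close>.\<close>
  have nw: "norm (T y - c *\<^sub>R T x) = N * M / 2" "norm (T x - c *\<^sub>R T y) = N * M / 2"
  proof -
    have "(norm (T y - c *\<^sub>R T x))\<^sup>2 = 1 - c\<^sup>2" "(norm (T x - c *\<^sub>R T y))\<^sup>2 = 1 - c\<^sup>2"
      unfolding power2_norm_eq_inner
      by (simp_all add: inner_diff_left inner_diff_right one xy yx power2_eq_square)
    moreover have "(N * M / 2)\<^sup>2 = 1 - c\<^sup>2"
      using N2 M2 by (simp add: power_mult_distrib power_divide) (simp add: power2_eq_square algebra_simps)
    moreover have "N * M / 2 \<ge> 0" by (simp add: N_def M_def)
    ultimately show "norm (T y - c *\<^sub>R T x) = N * M / 2" "norm (T x - c *\<^sub>R T y) = N * M / 2"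
      by (metis norm_ge_zero power2_eq_imp_eq)+
  qed
  have "d \<bullet> (T y - c *\<^sub>R T x) \<le> norm (T y - c *\<^sub>R T x) * (norm d)\<^sup>2"
    using assms(2-4) unfolding empty_tangent_balls_def d_def
    by (auto simp: inner_diff_left one yx)
  moreover have "- d \<bullet> - (T x - c *\<^sub>R T y) \<le> norm (- (T x - c *\<^sub>R T y)) * (norm (- d))\<^sup>2"
    using assms(2)[unfolded empty_tangent_balls_def, rule_format, OF assms(4,3), of "- (T x - c *\<^sub>R T y)"]
    by (simp add: d_def inner_diff_left one xy)
  ultimately have "d \<bullet> (T y - c *\<^sub>R T x) + d \<bullet> (T x - c *\<^sub>R T y) \<le> 2 * (N * M / 2 * (norm d)\<^sup>2)"
    unfolding norm_minus_cancel inner_minus_left inner_minus_right minus_minus nw by linarith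
  then have "(1 - c) * (d \<bullet> (T x + T y)) \<le> N * M * (norm d)\<^sup>2"
    by (simp add: inner_diff_right inner_add_right algebra_simps)
  moreover have "1 - c = N * N / 2" using N2 by (simp add: power2_eq_square)
  ultimately have "N * (N * (d \<bullet> (T x + T y))) \<le> N * (2 * M * (norm d)\<^sup>2)" by (simp add: algebra_simps)
  moreover have "M \<le> 2"
    unfolding M_def using norm_triangle_ineq[of "T x" "T y"] one by (simp add: norm_eq_1[symmetric])
  then have "2 * M * (norm d)\<^sup>2 \<le> 4 * (norm d)\<^sup>2" by (intro mult_right_mono) auto
  moreover have "N \<ge> 0" by (simp add: N_def)
  ultimately have "N * (d \<bullet> (T x + T y)) \<le> 4 * (norm d)\<^sup>2"
    by (cases "N = 0") (auto simp: mult_le_cancel_left_pos)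
  then show ?thesis by (simp add: N_def d_def)
qed

text \<open>Charts have some Lipschitz constant; the tangent balls give 2, the curvature of a circle
  of diameter 1. For parameters at small distance \<open>h\<close> the chord is at most
  \<open>h\<close>, while its inner product with either end tangent is at least
  \<open>(1 - \<eta>) * h\<close>. Then \<open>tangent_rotation_bound\<close> yields
  \<open>N * (1 - \<eta>) \<le> 2 * h\<close>.\<close>

lemma arc_param_tangent_lipschitz:
  assumes lk: "link L T" and etb: "empty_tangent_balls L T" and ap: "arc_param L T \<gamma> s t"
  shows "2-lipschitz_on {s..t} (\<lambda>u. T (\<gamma> u))"
proof -
  have gL: "\<And>u. u \<in> {s..t} \<Longrightarrow> \<gamma> u \<in> L" using ap by (auto simp: arc_param_def)
  have c': "\<And>u. u \<in> {s..t} \<Longrightarrow> (\<gamma> has_vector_derivative T (\<gamma> u)) (at u within {s..t})"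
    using ap by (auto simp: arc_param_def)
  have cT: "continuous_on {s..t} (\<lambda>u. T (\<gamma> u))"
    using continuous_on_compose2[OF continuous_on_tangent[OF lk] arc_param_continuous[OF ap]] gL by blast
  have n1: "\<And>u. u \<in> {s..t} \<Longrightarrow> norm (T (\<gamma> u)) = 1" using norm_tangent[OF lk] gL by blast
  have le: "dist (T (\<gamma> u)) (T (\<gamma> v)) \<le> 2 * (v - u)" if uv: "u \<in> {s..t}" "v \<in> {s..t}" "u \<le> v" for u v
  proof (rule lipschitz_from_infinitesimal[where a = s and b = t])
    fix \<epsilon> :: real assume "\<epsilon> > 0"
    \<comment> \<open>Chosen so that \<open>2 / (1 - \<eta>) = 2 + \<epsilon>\<close>.\<close>
    define \<eta> where "\<eta> = \<epsilon> / (2 + \<epsilon>)"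
    have \<eta>: "\<eta> > 0" "(1 - \<eta>) * (2 + \<epsilon>) = 2" using \<open>\<epsilon> > 0\<close> by (auto simp: \<eta>_def field_simps)
    obtain \<delta> where \<delta>: "\<delta> > 0" and lin: "\<And>u v x. \<lbrakk>u \<in> {s..t}; v \<in> {s..t}; u \<le> v; v - u < \<delta>; x \<in> {u..v}\<rbrakk>
        \<Longrightarrow> norm (\<gamma> v - \<gamma> u - (v - u) *\<^sub>R T (\<gamma> x)) \<le> \<eta> * (v - u)"
      using uniform_linearization[OF c' cT \<eta>(1)] by blast
    have "dist (T (\<gamma> u)) (T (\<gamma> v)) \<le> (2 + \<epsilon>) * (v - u)"
      if uv: "u \<in> {s..t}" "v \<in> {s..t}" "u \<le> v" "v - u < \<delta>" for u v
    proof (cases "u = v")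
      case False
      define h where "h = v - u"
      have h: "h > 0" using False uv by (simp add: h_def)
      define N where "N = norm (T (\<gamma> v) - T (\<gamma> u))"
      have sec: "(1 - \<eta>) * h \<le> (\<gamma> v - \<gamma> u) \<bullet> T (\<gamma> x)" if x: "x \<in> {u..v}" for x
      proof -
        have nx: "norm (T (\<gamma> x)) = 1" using n1 x uv by auto
        have "\<bar>(\<gamma> v - \<gamma> u - h *\<^sub>R T (\<gamma> x)) \<bullet> T (\<gamma> x)\<bar> \<le> norm (\<gamma> v - \<gamma> u - h *\<^sub>R T (\<gamma> x))"
          using Cauchy_Schwarz_ineq2[of _ "T (\<gamma> x)"] nx by (metis mult.right_neutral)
        also have "\<dots> \<le> \<eta> * h" using lin[OF uv x] by (simp add: h_def)
        finally have "\<bar>(\<gamma> v - \<gamma> u) \<bullet> T (\<gamma> x) - h\<bar> \<le> \<eta> * h"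
          using nx by (simp add: inner_diff_left norm_eq_1)
        then show ?thesis by (simp add: algebra_simps)
      qed
      have "2 * ((1 - \<eta>) * h) \<le> (\<gamma> v - \<gamma> u) \<bullet> (T (\<gamma> u) + T (\<gamma> v))"
        using sec[of u] sec[of v] uv by (simp add: inner_add_right)
      then have "N * (2 * ((1 - \<eta>) * h)) \<le> N * ((\<gamma> v - \<gamma> u) \<bullet> (T (\<gamma> u) + T (\<gamma> v)))"
        by (intro mult_left_mono) (auto simp: N_def)
      also have "\<dots> \<le> 4 * (norm (\<gamma> v - \<gamma> u))\<^sup>2"
        unfolding N_def using tangent_rotation_bound[OF lk etb] gL uv by blast
      also have "\<dots> \<le> 4 * h\<^sup>2"
        using unit_speed_dist_le[OF c' _ uv(1,2)] n1 uv(3) by (auto simp: h_def intro!: power_mono)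
      finally have "h * (N * (1 - \<eta>)) \<le> h * (2 * h)" by (simp add: power2_eq_square algebra_simps)
      then have "N * (1 - \<eta>) \<le> 2 * h" using h by simp
      then have "N * (1 - \<eta>) * (2 + \<epsilon>) \<le> 2 * h * (2 + \<epsilon>)" using \<open>\<epsilon> > 0\<close> by (intro mult_right_mono) auto
      then have "N * ((1 - \<eta>) * (2 + \<epsilon>)) \<le> 2 * h * (2 + \<epsilon>)" by (simp only: mult.assoc)
      then have "N \<le> (2 + \<epsilon>) * h" unfolding \<eta>(2) by (simp add: algebra_simps)
      then show ?thesis by (simp add: N_def h_def dist_norm norm_minus_commute)
    qed simp
    then show "\<exists>\<delta>>0. \<forall>x\<in>{s..t}. \<forall>y\<in>{s..t}. x \<le> y \<longrightarrow> y - x < \<delta> \<longrightarrow>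
        dist (T (\<gamma> x)) (T (\<gamma> y)) \<le> (2 + \<epsilon>) * (y - x)" using \<delta> by blast
  qed (use uv in auto)
  show ?thesis
  proof (rule lipschitz_onI)
    fix u v assume "u \<in> {s..t}" "v \<in> {s..t}"
    then show "dist (T (\<gamma> u)) (T (\<gamma> v)) \<le> 2 * dist u v"
      using le[of u v] le[of v u] by (cases "u \<le> v") (auto simp: dist_real_def dist_commute)
  qed simp
qed

text \<open>Arclength measure is prescribed through charts, so an arc must be one before integrals
  can be taken along it. The interval is open because the closed arc need not be open in
  \<open>L\<close>; the Lipschitz condition on charts comes from the tangent balls.\<close>

lemma arc_param_interior_chart:
  assumes lk: "link L T" and etb: "empty_tangent_balls L T" and ap: "arc_param L T \<gamma> s t"
  shows "arclength_chart L T \<gamma> {s<..<t}"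
  unfolding arclength_chart_def
proof (intro conjI ballI)
  have st: "s < t" and inj: "inj_on \<gamma> {s..t}" and gL: "\<gamma> ` {s..t} \<subseteq> L"
    and c': "\<And>u. u \<in> {s..t} \<Longrightarrow> (\<gamma> has_vector_derivative T (\<gamma> u)) (at u within {s..t})"
    using ap by (auto simp: arc_param_def)
  show "is_interval {s<..<t}" by (simp add: is_interval_1)
  show "interior {s<..<t} \<noteq> {}" using st by simp
  show "openin (top_of_set L) (\<gamma> ` {s<..<t})" using arc_param_open[OF lk ap] by simp
  obtain g where "homeomorphism {s..t} (\<gamma> ` {s..t}) \<gamma> g"
    using homeomorphism_compact[OF compact_Icc arc_param_continuous[OF ap] refl inj] by blast
  then show "\<exists>g. homeomorphism {s<..<t} (\<gamma> ` {s<..<t}) \<gamma> g"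
    using homeomorphism_of_subsets[of "{s..t}" "\<gamma> ` {s..t}" \<gamma> g "{s<..<t}" "\<gamma> ` {s<..<t}"] by (meson greaterThanLessThan_subseteq_atLeastAtMost_iff image_mono order_refl)
  show "\<exists>M. M-lipschitz_on {s<..<t} (\<lambda>u. T (\<gamma> u))"
    using lipschitz_on_subset[OF arc_param_tangent_lipschitz[OF assms] greaterThanLessThan_subseteq_atLeastAtMost_iff[THEN iffD2]]
    by blast
  fix u assume u: "u \<in> {s<..<t}"
  show "norm (T (\<gamma> u)) = 1" using norm_tangent[OF lk] gL u by (auto simp: image_subset_iff)
  show "(\<gamma> has_vector_derivative T (\<gamma> u)) (at u within {s<..<t})"
    using u by (intro has_vector_derivative_within_subset[OF c']) auto
qed

section \<open>Test fields\<close>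

lemma DERIV_max_0_power:
  assumes "n \<ge> 2"
  shows "((\<lambda>z::real. (max 0 z) ^ n) has_real_derivative real n * (max 0 z) ^ (n - 1)) (at z within S)"
proof -
  obtain k where k: "n = Suc (Suc k)" using assms by (metis add_2_eq_Suc le_Suc_ex)
  have "((\<lambda>z::real. (max 0 z) ^ n) has_real_derivative real n * (max 0 z) ^ (n - 1)) (at z)"
  proof (cases z "0::real" rule: linorder_cases)
    case less
    have "((\<lambda>z::real. 0) has_real_derivative real n * (max 0 z) ^ (n - 1)) (at z)"
      using less by (simp add: k)
    then show ?thesis
      by (rule has_field_derivative_transform_within_open[where S = "{..<0}"]) (use less in \<open>auto simp: k\<close>)
  next
    case greater
    have "((\<lambda>z::real. z ^ n) has_real_derivative real n * (max 0 z) ^ (n - 1)) (at z)"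
      using greater DERIV_pow[of n z UNIV] by (simp add: max_def)
    then show ?thesis
      by (rule has_field_derivative_transform_within_open[where S = "{0<..}"])
        (use greater in \<open>auto simp: max_def\<close>)
  next
    \<comment> \<open>Caratheodory's criterion at 0: the difference factors through
      \<open>w - 0\<close>, and the other factor is continuous and vanishes at 0 since its exponent
      is still positive.\<close>
    case equal
    have "(max 0 w) ^ n - (max 0 0) ^ n = (max 0 w) ^ Suc k * (w - 0)" for w :: real
      by (cases "w \<ge> 0") (simp_all add: k)
    moreover have "isCont (\<lambda>w::real. (max 0 w) ^ Suc k) 0" by (intro continuous_intros)
    moreover have "(max 0 (0::real)) ^ Suc k = real n * (max 0 0) ^ (n - 1)" by (simp add: k)
    ultimately show ?thesis unfolding equal CARAT_DERIV
      by (intro exI[of _ "\<lambda>w. (max 0 w) ^ Suc k"] conjI allI)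
  qed
  then show ?thesis by (rule DERIV_subset) simp
qed

text \<open>For \<open>k \<rightarrow> \<infinity>\<close> the \<open>C\<^sup>2\<close> functions \<open>smooth_step k\<close> tend to the indicator of \<open>{0<..}\<close>;
  suffixes \<open>1\<close> and \<open>2\<close> mark derivatives.\<close>

definition smooth_step :: "real \<Rightarrow> real \<Rightarrow> real" where
  "smooth_step k z = 1 - exp (- k * (max 0 z) ^ 3)"

definition smooth_step1 :: "real \<Rightarrow> real \<Rightarrow> real" where
  "smooth_step1 k z = 3 * k * (max 0 z) ^ 2 * exp (- k * (max 0 z) ^ 3)"

definition smooth_step2 :: "real \<Rightarrow> real \<Rightarrow> real" where
  "smooth_step2 k z = (6 * k * max 0 z - 9 * k\<^sup>2 * (max 0 z) ^ 4) * exp (- k * (max 0 z) ^ 3)"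

lemma smooth_step_deriv:
  "(smooth_step k has_real_derivative smooth_step1 k z) (at z within S)"
proof -
  have "((\<lambda>z. 1 - exp (- k * (max 0 z) ^ 3)) has_real_derivative
      0 - exp (- k * (max 0 z) ^ 3) * (- k * (real 3 * (max 0 z) ^ (3 - 1)))) (at z within S)"
    by (intro DERIV_diff DERIV_const DERIV_chain2[OF DERIV_exp] DERIV_cmult DERIV_max_0_power) simp
  then show ?thesis
    by (simp add: smooth_step_def[abs_def] smooth_step1_def algebra_simps)
qed

lemma smooth_step1_deriv:
  "(smooth_step1 k has_real_derivative smooth_step2 k z) (at z within S)"
proof -
  have "((\<lambda>z. 3 * k * (max 0 z) ^ 2 * exp (- k * (max 0 z) ^ 3)) has_real_derivative
      (3 * k * (real 2 * (max 0 z) ^ (2 - 1))) * exp (- k * (max 0 z) ^ 3) +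
      (exp (- k * (max 0 z) ^ 3) * (- k * (real 3 * (max 0 z) ^ (3 - 1)))) * (3 * k * (max 0 z) ^ 2))
      (at z within S)"
    by (intro DERIV_mult DERIV_chain2[OF DERIV_exp] DERIV_cmult DERIV_max_0_power) simp_all
  then show ?thesis
    by (simp add: smooth_step1_def[abs_def] smooth_step2_def algebra_simps power2_eq_square eval_nat_numeral)
qed

lemma continuous_on_smooth_step1: "continuous_on S (smooth_step1 k)"
  unfolding smooth_step1_def by (intro continuous_intros)

lemma continuous_on_smooth_step: "continuous_on S (smooth_step k)"
  unfolding smooth_step_def by (intro continuous_intros)

text \<open>This explains the cube in \<open>smooth_step\<close>: it is the least integer power of
  \<open>max 0 z\<close> whose second derivative is continuous at 0.\<close>

lemma continuous_on_smooth_step2: "continuous_on S (smooth_step2 k)"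
  unfolding smooth_step2_def by (intro continuous_intros)

lemma smooth_step_nonpos:
  assumes "z \<le> 0" shows "smooth_step k z = 0" "smooth_step1 k z = 0" "smooth_step2 k z = 0"
  using assms by (auto simp: smooth_step_def smooth_step1_def smooth_step2_def)

lemma smooth_step_bounds:
  assumes "k \<ge> 0" shows "0 \<le> smooth_step k z" "smooth_step k z \<le> 1" "0 \<le> smooth_step1 k z"
  using assms by (auto simp: smooth_step_def smooth_step1_def)

lemma smooth_step_tendsto:
  assumes "z > 0" shows "(\<lambda>n. smooth_step (real n) z) \<longlonglongrightarrow> 1"
proof -
  have "(\<lambda>n. exp (- (z ^ 3)) ^ n) \<longlonglongrightarrow> 0"
    using assms by (intro LIMSEQ_realpow_zero) auto
  then have "(\<lambda>n. exp (- real n * z ^ 3)) \<longlonglongrightarrow> 0"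
    by (simp add: exp_of_nat_mult[symmetric])
  then have "(\<lambda>n. 1 - exp (- real n * z ^ 3)) \<longlonglongrightarrow> 1 - 0"
    by (intro tendsto_intros)
  then show ?thesis using assms by (simp add: smooth_step_def[abs_def] max_def)
qed

text \<open>The bilinear map sending \<open>v\<close> and \<open>w\<close> to
  \<open>(v \<bullet> w) *\<^sub>R e\<close>, in curried form. It is the second derivative of half
  the squared norm times \<open>e\<close>, and so it occurs in both derivatives of a radial
  field.\<close>

definition radial_form :: "vec3 \<Rightarrow> vec3 \<Rightarrow>\<^sub>L vec3 \<Rightarrow>\<^sub>L vec3" where
  "radial_form e = Blinfun (\<lambda>v. blinfun_scaleR_left e o\<^sub>L blinfun_inner_right v)"

lemma radial_form_apply: "blinfun_apply (radial_form e) v = blinfun_scaleR_left e o\<^sub>L blinfun_inner_right v"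
proof -
  have "bounded_linear (\<lambda>v::vec3. blinfun_scaleR_left e o\<^sub>L blinfun_inner_right v)"
    by (intro bounded_linear_intros)
  then show ?thesis unfolding radial_form_def by (simp add: bounded_linear_Blinfun_apply)
qed

text \<open>A constant direction \<open>e\<close> cut off to the ball of radius \<open>r\<close>
  about \<open>x0\<close>. The cutoff uses the squared distance, which is smooth also at the centre.
  Along a curve the field varies only through \<open>(x - x0) \<bullet> T\<close>, whose sign tells
  whether the curve enters or leaves the ball.\<close>

definition bump_field :: "real \<Rightarrow> vec3 \<Rightarrow> real \<Rightarrow> vec3 \<Rightarrow> vec3 \<Rightarrow> vec3" where
  "bump_field k x0 r e x = smooth_step k (r\<^sup>2 - (x - x0) \<bullet> (x - x0)) *\<^sub>R e"

definition bump_field1 :: "real \<Rightarrow> vec3 \<Rightarrow> real \<Rightarrow> vec3 \<Rightarrow> vec3 \<Rightarrow> vec3 \<Rightarrow>\<^sub>L vec3" where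
  "bump_field1 k x0 r e x =
     (- 2 * smooth_step1 k (r\<^sup>2 - (x - x0) \<bullet> (x - x0))) *\<^sub>R radial_form e (x - x0)"

definition bump_field2 :: "real \<Rightarrow> vec3 \<Rightarrow> real \<Rightarrow> vec3 \<Rightarrow> vec3 \<Rightarrow> vec3 \<Rightarrow>\<^sub>L vec3 \<Rightarrow>\<^sub>L vec3" where
  "bump_field2 k x0 r e x =
     (blinfun_scaleR_left (radial_form e (x - x0)) o\<^sub>L
       ((4 * smooth_step2 k (r\<^sup>2 - (x - x0) \<bullet> (x - x0))) *\<^sub>R blinfun_inner_right (x - x0)))
     + (- 2 * smooth_step1 k (r\<^sup>2 - (x - x0) \<bullet> (x - x0))) *\<^sub>R radial_form e"

lemma bump_field_C2: "C2_with_derivatives (bump_field k x0 r e) (bump_field1 k x0 r e) (bump_field2 k x0 r e)"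
  unfolding C2_with_derivatives_def
proof (intro conjI allI)
  fix x :: vec3
  let ?q = "\<lambda>x. r\<^sup>2 - (x - x0) \<bullet> (x - x0)"
  have q: "(?q has_derivative (\<lambda>v. - 2 * ((x - x0) \<bullet> v))) (at x)"
    by (auto intro!: derivative_eq_intros simp: inner_commute)
  have s: "((\<lambda>x. smooth_step k (?q x)) has_derivative (\<lambda>v. smooth_step1 k (?q x) * (- 2 * ((x - x0) \<bullet> v)))) (at x)"
    using has_derivative_compose[OF q smooth_step_deriv[unfolded has_field_derivative_def]] by simp
  have s1: "((\<lambda>x. smooth_step1 k (?q x)) has_derivative (\<lambda>v. smooth_step2 k (?q x) * (- 2 * ((x - x0) \<bullet> v)))) (at x)"
    using has_derivative_compose[OF q smooth_step1_deriv[unfolded has_field_derivative_def]] by simp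
  have "(bump_field k x0 r e has_derivative (\<lambda>v. (smooth_step1 k (?q x) * (- 2 * ((x - x0) \<bullet> v))) *\<^sub>R e)) (at x)"
    unfolding bump_field_def[abs_def] by (rule has_derivative_scaleR_left[OF s])
  then show "(bump_field k x0 r e has_derivative blinfun_apply (bump_field1 k x0 r e x)) (at x)"
    by (rule has_derivative_eq_rhs)
      (auto simp: bump_field1_def radial_form_apply blinfun.bilinear_simps fun_eq_iff inner_diff_left algebra_simps)
  have "((\<lambda>x. blinfun_apply (radial_form e) (x - x0)) has_derivative blinfun_apply (radial_form e)) (at x)"
    by (auto intro!: derivative_eq_intros)
  from has_derivative_scaleR[OF has_derivative_mult_right[OF s1, of "-2"] this]
  show "(bump_field1 k x0 r e has_derivative blinfun_apply (bump_field2 k x0 r e x)) (at x)"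
    unfolding bump_field1_def[abs_def]
    by (rule has_derivative_eq_rhs)
      (auto simp: bump_field2_def blinfun.bilinear_simps fun_eq_iff)
next
  show "continuous_on UNIV (bump_field2 k x0 r e)"
    unfolding bump_field2_def[abs_def]
    by (intro continuous_intros continuous_on_compose2[OF continuous_on_smooth_step1[of UNIV]]
        continuous_on_compose2[OF continuous_on_smooth_step2[of UNIV]]
        bounded_linear.continuous_on[OF bounded_linear_blinfun_scaleR_left]
        bounded_linear.continuous_on[OF bounded_linear_blinfun_inner_right]) auto
qed

lemma bump_field_support:
  assumes "r > 0" "x \<notin> ball x0 r"
  shows "bump_field k x0 r e x = 0" "bump_field1 k x0 r e x = 0" "bump_field2 k x0 r e x = 0"
proof -
  have "r\<^sup>2 \<le> (norm (x - x0))\<^sup>2"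
    using assms by (intro power_mono) (auto simp: dist_norm norm_minus_commute)
  then have "r\<^sup>2 - (x - x0) \<bullet> (x - x0) \<le> 0" by (simp add: power2_norm_eq_inner)
  then show "bump_field k x0 r e x = 0" "bump_field1 k x0 r e x = 0" "bump_field2 k x0 r e x = 0"
    using smooth_step_nonpos by (auto simp: bump_field_def bump_field1_def bump_field2_def)
qed

text \<open>Derivatives of step functions that jump near \<open>p\<close> act in the limit like a point mass at \<open>p\<close>.\<close>

lemma integral_step_deriv_tendsto:
  fixes F F' :: "nat \<Rightarrow> real \<Rightarrow> real" and h :: "real \<Rightarrow> real"
  assumes "p < m"
    and F: "\<And>n x. x \<in> {p..m} \<Longrightarrow> (F n has_real_derivative F' n x) (at x within {p..m})"
    and cF': "\<And>n. continuous_on {p..m} (F' n)"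
    and F'0: "\<And>n x. x \<in> {p..m} \<Longrightarrow> 0 \<le> F' n x"
    and Fp: "\<And>n. F n p = 0" and F1: "\<And>n x. x \<in> {p..m} \<Longrightarrow> F n x \<le> 1"
    and lim: "\<And>x. \<lbrakk>p < x; x \<le> m\<rbrakk> \<Longrightarrow> (\<lambda>n. F n x) \<longlonglongrightarrow> 1"
    and h: "continuous_on {p..m} h"
  shows "(\<lambda>n. integral {p..m} (\<lambda>x. F' n x * h x)) \<longlonglongrightarrow> h p"
proof -
  have int: "(\<lambda>x. F' n x * (h x - h p)) integrable_on {a..b}" "(F' n) integrable_on {a..b}"
    "(\<lambda>x. F' n x * h x) integrable_on {a..b}"
    if "p \<le> a" "b \<le> m" for n a b
    using that by (auto intro!: integrable_continuous_real continuous_intros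
        continuous_on_subset[OF cF'] continuous_on_subset[OF h])
  have ftc: "integral {a..b} (F' n) = F n b - F n a" if "p \<le> a" "a \<le> b" "b \<le> m" for n a b
    using that by (intro integral_unique fundamental_theorem_of_calculus)
      (auto simp: has_real_derivative_iff_has_vector_derivative[symmetric] intro!: DERIV_subset[OF F])
  obtain C where C: "C > 0" "\<And>x. x \<in> {p..m} \<Longrightarrow> \<bar>h x - h p\<bar> \<le> C"
  proof -
    have "bounded ((\<lambda>x. h x - h p) ` {p..m})"
      by (intro compact_imp_bounded compact_continuous_image continuous_intros h compact_Icc)
    then show ?thesis using that unfolding bounded_pos by auto
  qed
  have key: "(\<lambda>n. integral {p..m} (\<lambda>x. F' n x * (h x - h p))) \<longlonglongrightarrow> 0"
  proof (rule LIMSEQ_I)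
    fix \<epsilon> :: real assume "\<epsilon> > 0"
    have "continuous (at p within {p..m}) h"
      using h \<open>p < m\<close> by (simp add: continuous_on_eq_continuous_within)
    then obtain d where d: "d > 0" "\<And>x. \<lbrakk>x \<in> {p..m}; dist x p < d\<rbrakk> \<Longrightarrow> dist (h x) (h p) < \<epsilon> / 2"
      using \<open>\<epsilon> > 0\<close> unfolding continuous_within_eps_delta by (metis half_gt_zero)
    \<comment> \<open>Up to \<open>x1\<close> the function \<open>h\<close> is within
      \<open>\<epsilon> / 2\<close> of \<open>h p\<close> and the mass of \<open>F' n\<close> is at
      most 1. Beyond \<open>x1\<close> the mass is \<open>F n m - F n x1\<close>, which tends to 0
      because both values tend to 1.\<close>
    define x1 where "x1 = min m (p + d / 2)"
    have x1: "p < x1" "x1 \<le> m" using \<open>p < m\<close> d by (auto simp: x1_def)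
    have near: "\<bar>h x - h p\<bar> \<le> \<epsilon> / 2" if "x \<in> {p..x1}" for x
      using d(2)[of x] d(1) that x1 by (auto simp: x1_def dist_real_def)
    have "(\<lambda>n. F n m - F n x1) \<longlonglongrightarrow> 1 - 1"
      by (intro tendsto_diff lim) (use x1 \<open>p < m\<close> in auto)
    moreover have "0 < \<epsilon> / (2 * C)" using \<open>\<epsilon> > 0\<close> C(1) by simp
    ultimately obtain N where "\<forall>n\<ge>N. norm (F n m - F n x1 - (1 - 1)) < \<epsilon> / (2 * C)"
      using LIMSEQ_D by blast
    then have N: "\<And>n. n \<ge> N \<Longrightarrow> \<bar>F n m - F n x1\<bar> < \<epsilon> / (2 * C)" by simp
    have bnd: "\<bar>integral {a..b} (\<lambda>x. F' n x * (h x - h p))\<bar> \<le> K * (F n b - F n a)"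
      if "p \<le> a" "a \<le> b" "b \<le> m" and K: "\<And>x. x \<in> {a..b} \<Longrightarrow> \<bar>h x - h p\<bar> \<le> K" for n a b K
    proof -
      have "norm (integral {a..b} (\<lambda>x. F' n x * (h x - h p))) \<le> integral {a..b} (\<lambda>x. K * F' n x)"
      proof (rule integral_norm_bound_integral)
        fix x assume x: "x \<in> {a..b}"
        then have "F' n x * \<bar>h x - h p\<bar> \<le> F' n x * K" using that F'0 by (intro mult_left_mono) auto
        then show "norm (F' n x * (h x - h p)) \<le> K * F' n x"
          using F'0[of x n] x that by (simp add: abs_mult mult.commute)
      qed (use int that in \<open>auto intro: integrable_on_mult_right\<close>)
      then show ?thesis using ftc[OF that(1-3)] by simp
    qed
    have "norm (integral {p..m} (\<lambda>x. F' n x * (h x - h p)) - 0) < \<epsilon>" if "n \<ge> N" for n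
    proof -
      have "integral {p..m} (\<lambda>x. F' n x * (h x - h p)) =
          integral {p..x1} (\<lambda>x. F' n x * (h x - h p)) + integral {x1..m} (\<lambda>x. F' n x * (h x - h p))"
        using x1 int[of p m n] by (simp add: Henstock_Kurzweil_Integration.integral_combine)
      moreover have "\<bar>integral {p..x1} (\<lambda>x. F' n x * (h x - h p))\<bar> \<le> \<epsilon> / 2 * (F n x1 - F n p)"
        using x1 near by (intro bnd) auto
      moreover have "\<epsilon> / 2 * (F n x1 - F n p) \<le> \<epsilon> / 2 * 1"
        using F1[of x1 n] Fp[of n] x1 \<open>\<epsilon> > 0\<close> by (intro mult_left_mono) auto
      moreover have "\<bar>integral {x1..m} (\<lambda>x. F' n x * (h x - h p))\<bar> \<le> C * (F n m - F n x1)"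
        using x1 C by (intro bnd) auto
      moreover have "C * (F n m - F n x1) < \<epsilon> / 2"
        using N[OF that] C(1) by (simp add: field_simps abs_less_iff)
      ultimately show ?thesis by simp
    qed
    then show "\<exists>N. \<forall>n\<ge>N. norm (integral {p..m} (\<lambda>x. F' n x * (h x - h p)) - 0) < \<epsilon>" by blast
  qed
  have "integral {p..m} (\<lambda>x. F' n x * h x) = integral {p..m} (\<lambda>x. F' n x * (h x - h p)) + h p * F n m" for n
  proof -
    have "integral {p..m} (\<lambda>x. F' n x * h x) = integral {p..m} (\<lambda>x. F' n x * (h x - h p) + h p * F' n x)"
      by (simp add: algebra_simps)
    also have "\<dots> = integral {p..m} (\<lambda>x. F' n x * (h x - h p)) + integral {p..m} (\<lambda>x. h p * F' n x)"
      using int[of p m n] by (intro integral_add) (auto intro: integrable_on_mult_right)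
    also have "integral {p..m} (\<lambda>x. h p * F' n x) = h p * F n m"
      using ftc[of p m n] Fp \<open>p < m\<close> by simp
    finally show ?thesis .
  qed
  moreover have "(\<lambda>n. integral {p..m} (\<lambda>x. F' n x * (h x - h p)) + h p * F n m) \<longlonglongrightarrow> 0 + h p * 1"
    by (intro tendsto_intros key lim) (use \<open>p < m\<close> in auto)
  ultimately show ?thesis by simp
qed

text \<open>The mirror image under reflection of the line. Here \<open>F n\<close> falls to 0 at
  \<open>q\<close>, so its derivative tends to the negative of a point mass.\<close>

lemma integral_step_deriv_tendsto_right:
  fixes F F' :: "nat \<Rightarrow> real \<Rightarrow> real" and h :: "real \<Rightarrow> real"
  assumes "m < q"
    and F: "\<And>n x. x \<in> {m..q} \<Longrightarrow> (F n has_real_derivative F' n x) (at x within {m..q})"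
    and cF': "\<And>n. continuous_on {m..q} (F' n)"
    and F'0: "\<And>n x. x \<in> {m..q} \<Longrightarrow> F' n x \<le> 0"
    and Fq: "\<And>n. F n q = 0" and F1: "\<And>n x. x \<in> {m..q} \<Longrightarrow> F n x \<le> 1"
    and lim: "\<And>x. \<lbrakk>m \<le> x; x < q\<rbrakk> \<Longrightarrow> (\<lambda>n. F n x) \<longlonglongrightarrow> 1"
    and h: "continuous_on {m..q} h"
  shows "(\<lambda>n. integral {m..q} (\<lambda>x. F' n x * h x)) \<longlonglongrightarrow> - h q"
proof -
  have im: "uminus ` {- q..- m} = {m..q}" by auto
  have "(\<lambda>n. integral {-q..-m} (\<lambda>x. (- F' n (- x)) * h (- x))) \<longlonglongrightarrow> h (- (- q))"
  proof (rule integral_step_deriv_tendsto[where F = "\<lambda>n x. F n (- x)"])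
    fix n x assume x: "x \<in> {-q..-m}"
    have "(F n has_real_derivative F' n (- x)) (at (- x) within uminus ` {- q..- m})"
      unfolding im using x by (intro F) auto
    moreover have "(uminus has_real_derivative -1) (at x within {- q..- m})"
      by (auto intro!: derivative_eq_intros)
    ultimately show "((\<lambda>x. F n (- x)) has_real_derivative - F' n (- x)) (at x within {- q..- m})"
      using DERIV_image_chain[of "F n" "F' n (- x)" uminus x "{- q..- m}" "-1"] by (simp add: o_def)
  next
    show "continuous_on {-q..-m} (\<lambda>x. h (- x))"
      by (rule continuous_on_compose2[OF h]) (auto intro!: continuous_intros)
    show "continuous_on {-q..-m} (\<lambda>x. - F' n (- x))" for n
      by (intro continuous_on_minus continuous_on_compose2[OF cF']) (auto intro!: continuous_intros)
  qed (use assms in auto)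
  moreover have "integral {-q..-m} (\<lambda>x. (- F' n (- x)) * h (- x)) = - integral {m..q} (\<lambda>x. F' n x * h x)" for n
    using Henstock_Kurzweil_Integration.integral_reflect_real[where f = "\<lambda>x. - F' n x * h x" and a = m and b = q] by simp
  ultimately have "(\<lambda>n. - integral {m..q} (\<lambda>x. F' n x * h x)) \<longlonglongrightarrow> h q" by simp
  from tendsto_minus[OF this] show ?thesis by simp
qed

section \<open>Force balance\<close>

lemma space_of_sets_restrict_borel:
  "sets M = sets (restrict_space borel X) \<Longrightarrow> space M = X"
  by (drule sets_eq_imp_space_eq) (simp add: space_restrict_space)

text \<open>\<open>arclength_derivative\<close> is a definite description, so uniqueness over all
  charts through \<open>x\<close> has to be shown as well. It holds at boundary points too: chart
  intervals are nondegenerate, which makes one-sided derivatives unique.\<close>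

lemma arclength_derivative_eq:
  assumes lk: "link L T" and x: "x \<in> L" and \<xi>: "(\<xi> has_derivative blinfun_apply D) (at x)"
  shows "arclength_derivative L T \<xi> x = blinfun_apply D (T x)"
proof -
  have chain: "((\<lambda>s. \<xi> (c s)) has_vector_derivative blinfun_apply D (T x)) (at t within I)"
    if "arclength_chart L T c I" "t \<in> I" "c t = x" for c I t
  proof -
    have c': "(c has_vector_derivative T x) (at t within I)"
      using that unfolding arclength_chart_def by blast
    have "((\<lambda>s. \<xi> (c s)) has_derivative (\<lambda>h. blinfun_apply D (h *\<^sub>R T x))) (at t within I)"
      using has_derivative_compose[OF c'[unfolded has_vector_derivative_def]] \<xi> that(3) by simp
    then show ?thesis by (simp add: has_vector_derivative_def blinfun.scaleR_right)
  qed
  obtain c I t where ch: "arclength_chart L T c I" "t \<in> I" "c t = x"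
    using lk x unfolding link_def by (metis imageE)
  have "has_arclength_derivative L T \<xi> (blinfun_apply D (T x)) x"
    unfolding has_arclength_derivative_def using ch chain[OF ch] by blast
  moreover have "v = blinfun_apply D (T x)" if v: "has_arclength_derivative L T \<xi> v x" for v
  proof -
    obtain c I t where ch: "arclength_chart L T c I" "t \<in> I" "c t = x"
      and d: "((\<lambda>s. \<xi> (c s)) has_vector_derivative v) (at t within I)"
      using v unfolding has_arclength_derivative_def by blast
    have I: "is_interval I" "interior I \<noteq> {}" using ch(1) unfolding arclength_chart_def by blast+
    have "I \<noteq> {t}" using I(2) by auto
    then have "t islimpt I"
      using I(1) ch(2) by (intro connected_imp_perfect) (auto simp: is_interval_connected)
    then have "at t within I \<noteq> bot" by (simp add: trivial_limit_within)
    then show ?thesis using vector_derivative_unique_within d chain[OF ch] by blast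
  qed
  ultimately show ?thesis unfolding arclength_derivative_def by (rule the_equality)
qed

text \<open>The defining property of \<open>S\<close> speaks of images of Borel sets under charts.
  It identifies the restriction of \<open>S\<close> to the arc with the push-forward of Lebesgue
  measure, and the integral is transported along \<gamma>.\<close>

lemma arclength_integral_on_arc:
  fixes g :: "vec3 \<Rightarrow> real"
  assumes S: "arclength_measure L T S" and ch: "arclength_chart L T \<gamma> J"
    and g: "continuous_on L g" and J: "open J"
    and supp: "\<And>x. \<lbrakk>x \<in> L; x \<notin> \<gamma> ` J\<rbrakk> \<Longrightarrow> g x = 0"
  shows "(LINT x|S. g x) = (LINT u:J|lborel. g (\<gamma> u))"
proof -
  have setsS: "sets S = sets (restrict_space borel L)" using S unfolding arclength_measure_def by blast
  then have spS: "space S = L" by (rule space_of_sets_restrict_borel)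
  have op: "openin (top_of_set L) (\<gamma> ` J)" and c\<gamma>: "continuous_on J \<gamma>" and inj: "inj_on \<gamma> J"
    using ch unfolding arclength_chart_def homeomorphism_def by (auto intro: inj_on_inverseI)
  have sub: "\<gamma> ` J \<subseteq> L" using op openin_imp_subset by blast
  obtain U where "open U" "\<gamma> ` J = L \<inter> U" using op by (auto simp: openin_open)
  then have mJ: "\<gamma> ` J \<in> sets S" unfolding setsS by (auto simp: sets_restrict_space)
  have sets_eq: "sets (restrict_space S (\<gamma> ` J)) = sets (restrict_space borel (\<gamma> ` J))"
    using sets_restrict_space_cong[OF setsS, of "\<gamma> ` J"] sub
    by (simp add: sets_restrict_restrict_space Int_absorb1)
  have m\<gamma>: "\<gamma> \<in> measurable (restrict_space lborel J) (restrict_space S (\<gamma> ` J))"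
  proof -
    have "\<gamma> \<in> measurable (restrict_space borel J) (restrict_space borel (\<gamma> ` J))"
      using borel_measurable_continuous_on_restrict[OF c\<gamma>]
      by (intro measurable_restrict_space2) (auto simp: space_restrict_space)
    then show ?thesis
      using measurable_cong_sets[OF sets_restrict_space_cong[OF sets_lborel] sets_eq] by blast
  qed
  have eq: "restrict_space S (\<gamma> ` J) = distr (restrict_space lborel J) (restrict_space S (\<gamma> ` J)) \<gamma>"
  proof (rule measure_eqI)
    fix F assume F: "F \<in> sets (restrict_space S (\<gamma> ` J))"
    then have F': "F \<subseteq> \<gamma> ` J" "F \<in> sets S"
      using mJ spS sub by (auto simp: sets_restrict_space_iff Int_absorb2)
    define E where "E = \<gamma> -` F \<inter> J"
    have FE: "F = \<gamma> ` E" using F' by (auto simp: E_def)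
    have "E \<in> sets (restrict_space lborel J)"
      using measurable_sets[OF m\<gamma> F] by (simp add: E_def space_restrict_space)
    then have E: "E \<in> sets borel" "E \<subseteq> J"
      using J by (auto simp: sets_restrict_space_iff E_def)
    have "emeasure (restrict_space S (\<gamma> ` J)) F = emeasure S F"
      using F' mJ spS sub by (intro emeasure_restrict_space) (auto simp: Int_absorb2)
    also have "\<dots> = emeasure lborel E"
      using S ch E unfolding FE arclength_measure_def by blast
    also have "\<dots> = emeasure (restrict_space lborel J) E"
      using E J by (intro emeasure_restrict_space[symmetric]) auto
    also have "\<dots> = emeasure (distr (restrict_space lborel J) (restrict_space S (\<gamma> ` J)) \<gamma>) F"
      by (subst emeasure_distr[OF m\<gamma> F]) (simp add: E_def space_restrict_space)
    finally show "emeasure (restrict_space S (\<gamma> ` J)) F =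
        emeasure (distr (restrict_space lborel J) (restrict_space S (\<gamma> ` J)) \<gamma>) F" .
  qed simp
  have mg: "g \<in> borel_measurable (restrict_space S (\<gamma> ` J))"
    using borel_measurable_continuous_on_restrict[OF continuous_on_subset[OF g sub]]
      measurable_cong_sets[OF sets_eq refl] by blast
  have "(LINT x|S. g x) = (LINT x|S. indicator (\<gamma> ` J) x *\<^sub>R g x)"
    using supp spS by (intro Bochner_Integration.integral_cong) (auto simp: indicator_def)
  also have "\<dots> = (LINT x|restrict_space S (\<gamma> ` J). g x)"
    using mJ spS sub by (intro integral_restrict_space[symmetric]) (simp add: Int_absorb2)
  also have "\<dots> = (LINT x|distr (restrict_space lborel J) (restrict_space S (\<gamma> ` J)) \<gamma>. g x)"
    using eq by simp
  also have "\<dots> = (LINT u|restrict_space lborel J. g (\<gamma> u))" by (rule integral_distr[OF m\<gamma> mg])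
  also have "\<dots> = (LINT u:J|lborel. g (\<gamma> u))"
    using J unfolding set_lebesgue_integral_def by (intro integral_restrict_space) simp
  finally show ?thesis .
qed

text \<open>Taking the closure adds no base points outside \<open>L\<close>, because
  \<open>L\<close> is closed. Hence a kink that is not based on an arc is based on the rest of the
  link, where the test fields vanish.\<close>

lemma osc_closure_base_point:
  assumes lk: "link L T" and c: "c \<in> osc_closure L T" shows "fst c \<in> L"
proof -
  define Q where "Q = {(x, T x, \<kappa>) | x \<kappa>. has_arclength_derivative L T T \<kappa> x}"
  have "closed L" using lk unfolding link_def by (simp add: compact_imp_closed)
  then have "closed (fst -` L :: circ set)" by (rule closed_vimage_fst)
  then have cl: "closedin (top_of_set Circ) (Circ \<inter> fst -` L)" by (auto simp: closedin_closed)
  have "x \<in> L" if h: "has_arclength_derivative L T T \<kappa> x" for x \<kappa>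
  proof -
    obtain c I t where "arclength_chart L T c I" "t \<in> I" "c t = x"
      using h unfolding has_arclength_derivative_def by blast
    then show ?thesis unfolding arclength_chart_def using openin_imp_subset by blast
  qed
  then have "topspace (top_of_set Circ) \<inter> Q \<subseteq> Circ \<inter> fst -` L" by (auto simp: Q_def)
  then have "top_of_set Circ closure_of Q \<subseteq> Circ \<inter> fst -` L"
    by (subst closure_of_restrict) (rule closure_of_minimal[OF _ cl])
  then show ?thesis using c unfolding osc_closure_def Q_def by auto
qed

text \<open>At boundary points the field and its derivative are 0, which every endpoint constraint
  admits. Kinks based on the arc form a null set, and all others are based at points of
  \<open>L\<close> outside \<open>U\<close>, where \<open>delta_radius\<close> vanishes with the
  derivatives of \<xi>. Only tension along the arc and strut forces remain.\<close>

lemma balance_on_kink_free_arc: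
  assumes lk: "link L T" and S: "arclength_measure L T S" and H: "endpoint_constraints L T H0 H1"
    and \<nu>: "kink_measure \<sigma> L T \<nu>" and bal: "balanced_by L T S H0 H1 \<mu> \<nu>"
    and etb: "empty_tangent_balls L T" and ap: "arc_param L T \<gamma> s t"
    and null: "AE c in \<nu>. fst c \<notin> \<gamma> ` {s..t}"
    and C2: "C2_with_derivatives \<xi> D D2"
    and supp: "\<And>x. x \<notin> U \<Longrightarrow> \<xi> x = 0 \<and> D x = 0 \<and> D2 x = 0"
    and U: "L \<inter> U \<subseteq> \<gamma> ` {s<..<t}"
  shows "(LINT u:{s<..<t}|lborel. blinfun_apply (D (\<gamma> u)) (T (\<gamma> u)) \<bullet> T (\<gamma> u))
    = strut_force_integral \<mu> \<xi>"
proof -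
  have \<xi>': "(\<xi> has_derivative blinfun_apply (D x)) (at x)" for x
    using C2 unfolding C2_with_derivatives_def by blast
  have D': "(D has_derivative blinfun_apply (D2 x)) (at x)" for x
    using C2 unfolding C2_with_derivatives_def by blast
  have bdL: "p \<in> L" if "p \<in> link_boundary L T" for p
    using that unfolding link_boundary_def initial_point_def terminal_point_def arclength_chart_def
    using openin_imp_subset by blast
  have comp: "compatible L T H0 H1 \<xi> D"
    unfolding compatible_def
  proof
    fix p assume p: "p \<in> link_boundary L T"
    have "p \<notin> U"
    proof
      assume "p \<in> U"
      then obtain u where "u \<in> {s<..<t}" "p = \<gamma> u" using U bdL[OF p] by blast
      then show False using arc_param_not_end[OF ap] p unfolding link_boundary_def by blast
    qed
    then have "\<xi> p = p - p" "blinfun_apply (D p) (T p) = 0" using supp by auto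
    moreover have "p \<in> H0 p" "0 \<in> H1 p"
      using H p unfolding endpoint_constraints_def by (auto intro: subspace_0)
    ultimately show "\<xi> p \<in> {q - p | q. q \<in> H0 p} \<and> blinfun_apply (D p) (T p) \<in> H1 p"
      by auto
  qed
  have sp\<nu>: "space \<nu> = Kink \<sigma> L T"
    using \<nu> space_of_sets_restrict_borel unfolding kink_measure_def radon_measure_on_def by blast
  have "(LINT c|\<nu>. delta_radius D D2 c) = 0"
  proof (rule integral_eq_zero_AE)
    have *: "delta_radius D D2 c = 0" if "c \<in> space \<nu>" "fst c \<notin> \<gamma> ` {s..t}" for c
    proof -
      have "fst c \<in> L" using that(1) osc_closure_base_point[OF lk] unfolding sp\<nu> Kink_def by blast
      then have "fst c \<notin> U" using U that(2) by fastforce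
      then show ?thesis using supp by (auto simp: delta_radius_def Let_def split: prod.split)
    qed
    show "AE c in \<nu>. delta_radius D D2 c = 0"
      by (rule AE_mp[OF null AE_I2]) (use * in blast)
  qed
  moreover have "(LINT x|S. arclength_derivative L T \<xi> x \<bullet> T x) =
      strut_force_integral \<mu> \<xi> + (LINT c|\<nu>. delta_radius D D2 c)"
    using bal C2 comp unfolding balanced_by_def by blast
  moreover have "(LINT x|S. arclength_derivative L T \<xi> x \<bullet> T x)
      = (LINT x|S. blinfun_apply (D x) (T x) \<bullet> T x)"
  proof (rule Bochner_Integration.integral_cong[OF refl])
    fix x assume "x \<in> space S"
    then have "x \<in> L"
      using S space_of_sets_restrict_borel unfolding arclength_measure_def by blast
    then show "arclength_derivative L T \<xi> x \<bullet> T x = blinfun_apply (D x) (T x) \<bullet> T x"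
      using arclength_derivative_eq[OF lk _ \<xi>'] by simp
  qed
  moreover have "(LINT x|S. blinfun_apply (D x) (T x) \<bullet> T x) =
      (LINT u:{s<..<t}|lborel. blinfun_apply (D (\<gamma> u)) (T (\<gamma> u)) \<bullet> T (\<gamma> u))"
  proof (rule arclength_integral_on_arc[OF S arc_param_interior_chart[OF lk etb ap]])
    have "continuous_on UNIV D"
      using D' by (meson continuous_at_imp_continuous_on has_derivative_continuous)
    then show "continuous_on L (\<lambda>x. blinfun_apply (D x) (T x) \<bullet> T x)"
      by (intro continuous_intros continuous_on_tangent[OF lk]) (auto intro: continuous_on_subset)
    show "blinfun_apply (D x) (T x) \<bullet> T x = 0" if "x \<in> L" "x \<notin> \<gamma> ` {s<..<t}" for x
    proof -
      have "x \<notin> U" using that U by blast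
      then show ?thesis using supp[of x] by simp
    qed
  qed simp
  ultimately show ?thesis by simp
qed

text \<open>The test fields are bumps on the ball about \<open>\<gamma> c\<close>, which meets
  \<open>L\<close> exactly in the open arc from \<open>p\<close> to \<open>q\<close>. Along the arc
  they rise before \<open>c\<close> and fall after it, so their derivatives tend to a positive point
  mass at \<open>p\<close> and a negative one at \<open>q\<close>. The strut integral meanwhile
  tends to the force on the open arc.\<close>

lemma arc_balance_symmetric:
  assumes lk: "link L T" and S: "arclength_measure L T S" and H: "endpoint_constraints L T H0 H1"
    and \<nu>: "kink_measure \<sigma> L T \<nu>" and bal: "balanced_by L T S H0 H1 \<mu> \<nu>"
    and etb: "empty_tangent_balls L T" and ap: "arc_param L T \<gamma> s t"
    and null: "AE c in \<nu>. fst c \<notin> \<gamma> ` {s..t}"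
    and \<mu>: "sets \<mu> = sets (restrict_space borel X)"
    and X: "\<And>x y. (x, y) \<in> X \<Longrightarrow> x \<in> L \<and> norm (x - y) = 1"
    and fin: "{z \<in> X. fst z \<in> \<gamma> ` {s..t}} \<in> sets \<mu>" "emeasure \<mu> {z \<in> X. fst z \<in> \<gamma> ` {s..t}} < \<infinity>"
    and pq: "s < p" "p < c" "c < q" "q < t"
    and r: "norm (\<gamma> p - \<gamma> c) = r" "norm (\<gamma> q - \<gamma> c) = r"
    and ball: "L \<inter> ball (\<gamma> c) r = \<gamma> ` {p<..<q}"
    and left: "\<And>u. u \<in> {p..c} \<Longrightarrow> (\<gamma> u - \<gamma> c) \<bullet> T (\<gamma> u) \<le> 0"
    and right: "\<And>u. u \<in> {c..q} \<Longrightarrow> 0 \<le> (\<gamma> u - \<gamma> c) \<bullet> T (\<gamma> u)"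
  shows "e \<bullet> T (\<gamma> p) - e \<bullet> T (\<gamma> q) =
    (LINT z|\<mu>. indicator (\<gamma> ` {p<..<q}) (fst z) * (e \<bullet> (2 *\<^sub>R (fst z - snd z))))"
proof -
  define x0 where "x0 = \<gamma> c"
  define w where "w u = r\<^sup>2 - (\<gamma> u - x0) \<bullet> (\<gamma> u - x0)" for u
  define F where "F n u = smooth_step (real n) (w u)" for n u
  define w' where "w' u = - 2 * ((\<gamma> u - x0) \<bullet> T (\<gamma> u))" for u
  define F' where "F' n u = smooth_step1 (real n) (w u) * w' u" for n u
  define h where "h u = e \<bullet> T (\<gamma> u)" for u
  define I where "I = {z \<in> X. fst z \<in> \<gamma> ` {s..t}}"
  have inj: "inj_on \<gamma> {s..t}" and gL: "\<gamma> ` {s..t} \<subseteq> L"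
    and \<gamma>': "\<And>u. u \<in> {s..t} \<Longrightarrow> (\<gamma> has_vector_derivative T (\<gamma> u)) (at u within {s..t})"
    using ap by (auto simp: arc_param_def)
  have "\<gamma> p \<noteq> \<gamma> c" using inj_onD[OF inj, of p c] pq by auto
  then have r0: "r > 0" using r by auto
  have c\<gamma>: "continuous_on {s..t} \<gamma>" using ap by (rule arc_param_continuous)
  have cT: "continuous_on {s..t} (\<lambda>u. T (\<gamma> u))"
    using continuous_on_compose2[OF continuous_on_tangent[OF lk] c\<gamma> gL] .
  have cw: "continuous_on {s..t} w" "continuous_on {s..t} w'" "continuous_on {s..t} h"
    unfolding w_def[abs_def] w'_def[abs_def] h_def[abs_def] by (intro continuous_intros c\<gamma> cT)+
  have cF': "continuous_on {s..t} (F' n)" for n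
    unfolding F'_def[abs_def]
    by (intro continuous_intros cw continuous_on_compose2[OF continuous_on_smooth_step1[of UNIV]]) auto
  have w_deriv: "(w has_real_derivative w' u) (at u within {s..t})" if "u \<in> {s..t}" for u
  proof -
    have d: "((\<lambda>u. \<gamma> u - x0) has_vector_derivative T (\<gamma> u)) (at u within {s..t})"
      using has_vector_derivative_diff[OF \<gamma>'[OF that] has_vector_derivative_const[of x0]] by simp
    have "((\<lambda>u. (\<gamma> u - x0) \<bullet> (\<gamma> u - x0)) has_vector_derivative
        ((\<gamma> u - x0) \<bullet> T (\<gamma> u) + T (\<gamma> u) \<bullet> (\<gamma> u - x0))) (at u within {s..t})"
      by (rule bounded_bilinear.has_vector_derivative[OF bounded_bilinear_inner d d])
    from has_vector_derivative_diff[OF has_vector_derivative_const[of "r\<^sup>2"] this]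
    show ?thesis
      unfolding w_def[abs_def] w'_def has_real_derivative_iff_has_vector_derivative
      by (rule has_vector_derivative_eq_rhs) (simp add: inner_commute)
  qed
  have F_deriv: "(F n has_real_derivative F' n u) (at u within {s..t})" if "u \<in> {s..t}" for n u
    unfolding F_def[abs_def] F'_def by (rule DERIV_chain2[OF smooth_step_deriv w_deriv[OF that]])
  have w_pos: "w u > 0" if "u \<in> {p<..<q}" for u
  proof -
    have "\<gamma> u \<in> ball x0 r" using ball that by (auto simp: x0_def)
    then have "(norm (\<gamma> u - x0))\<^sup>2 < r\<^sup>2"
      by (intro power_strict_mono) (auto simp: dist_norm norm_minus_commute)
    then show ?thesis by (simp add: w_def power2_norm_eq_inner)
  qed
  have w_ends: "w p = 0" "w q = 0"
    unfolding w_def x0_def using r by (simp_all add: power2_norm_eq_inner[symmetric])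
  have w_out: "w u \<le> 0" if u: "u \<in> {s..t}" "u \<notin> {p<..<q}" for u
  proof -
    have "\<gamma> u \<notin> \<gamma> ` {p<..<q}"
    proof
      assume "\<gamma> u \<in> \<gamma> ` {p<..<q}"
      then obtain v where "v \<in> {p<..<q}" "\<gamma> u = \<gamma> v" by blast
      then show False using inj_onD[OF inj, of u v] u pq by auto
    qed
    then have "\<gamma> u \<notin> ball x0 r" using ball gL u(1) unfolding x0_def by blast
    then have "r\<^sup>2 \<le> (norm (\<gamma> u - x0))\<^sup>2"
      using r0 by (intro power_mono) (auto simp: dist_norm norm_minus_commute)
    then show ?thesis by (simp add: w_def power2_norm_eq_inner)
  qed
  have lim: "(\<lambda>n. F n u) \<longlonglongrightarrow> 1" if "u \<in> {p<..<q}" for u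
    unfolding F_def by (rule smooth_step_tendsto[OF w_pos[OF that]])
  have F_le: "F n u \<le> 1" for n u using smooth_step_bounds by (simp add: F_def)
  have F_ends: "F n p = 0" "F n q = 0" for n by (simp_all add: F_def w_ends smooth_step_nonpos)
  have L1: "(\<lambda>n. integral {p..c} (\<lambda>u. F' n u * h u)) \<longlonglongrightarrow> h p"
  proof (rule integral_step_deriv_tendsto[OF \<open>p < c\<close>, where F = F])
    show "0 \<le> F' n u" if "u \<in> {p..c}" for n u
    proof -
      have "0 \<le> w' u" using left[OF that] by (simp add: w'_def x0_def)
      then show ?thesis unfolding F'_def using smooth_step_bounds(3)[of "real n"] by simp
    qed
  qed (use pq F_ends F_le lim in \<open>auto intro!: DERIV_subset[OF F_deriv]
        continuous_on_subset[OF cF'] continuous_on_subset[OF cw(3)]\<close>)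
  have L2: "(\<lambda>n. integral {c..q} (\<lambda>u. F' n u * h u)) \<longlonglongrightarrow> - h q"
  proof (rule integral_step_deriv_tendsto_right[OF \<open>c < q\<close>, where F = F])
    show "F' n u \<le> 0" if "u \<in> {c..q}" for n u
    proof -
      have "w' u \<le> 0" using right[OF that] by (simp add: w'_def x0_def)
      then show ?thesis unfolding F'_def using smooth_step_bounds(3)[of "real n"]
        by (simp add: mult_nonneg_nonpos)
    qed
  qed (use pq F_ends F_le lim in \<open>auto intro!: DERIV_subset[OF F_deriv]
        continuous_on_subset[OF cF'] continuous_on_subset[OF cw(3)]\<close>)
  have cFh: "continuous_on {p..q} (\<lambda>u. F' n u * h u)" for n
    using pq by (intro continuous_intros continuous_on_subset[OF cF'] continuous_on_subset[OF cw(3)]) auto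
  have "(\<lambda>n. integral {p..q} (\<lambda>u. F' n u * h u)) \<longlonglongrightarrow> h p + - h q"
  proof -
    have "integral {p..q} (\<lambda>u. F' n u * h u) =
        integral {p..c} (\<lambda>u. F' n u * h u) + integral {c..q} (\<lambda>u. F' n u * h u)" for n
      using pq integrable_continuous_real[OF cFh[of n]]
      by (simp add: Henstock_Kurzweil_Integration.integral_combine)
    then show ?thesis using tendsto_add[OF L1 L2] by simp
  qed
  moreover have "integral {p..q} (\<lambda>u. F' n u * h u) = strut_force_integral \<mu> (bump_field (real n) x0 r e)" for n
  proof -
    have "strut_force_integral \<mu> (bump_field (real n) x0 r e)
      = (LINT u:{s<..<t}|lborel. blinfun_apply (bump_field1 (real n) x0 r e (\<gamma> u)) (T (\<gamma> u)) \<bullet> T (\<gamma> u))"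
    proof (rule balance_on_kink_free_arc[OF lk S H \<nu> bal etb ap null bump_field_C2, symmetric])
      show "L \<inter> ball x0 r \<subseteq> \<gamma> ` {s<..<t}" unfolding x0_def ball using pq by auto
    qed (use bump_field_support[OF r0] in blast)
    also have "\<dots> = (LINT u:{p..q}|lborel. F' n u * h u)"
      unfolding set_lebesgue_integral_def
    proof (rule Bochner_Integration.integral_cong[OF refl])
      fix u
      show "indicator {s<..<t} u *\<^sub>R
          (blinfun_apply (bump_field1 (real n) x0 r e (\<gamma> u)) (T (\<gamma> u)) \<bullet> T (\<gamma> u)) =
          indicator {p..q} u *\<^sub>R (F' n u * h u)"
      proof (cases "u \<in> {s<..<t}")
        case True
        have "blinfun_apply (bump_field1 (real n) x0 r e (\<gamma> u)) (T (\<gamma> u)) \<bullet> T (\<gamma> u) = F' n u * h u"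
          by (simp add: bump_field1_def radial_form_apply blinfun.bilinear_simps F'_def w'_def h_def w_def
              inner_diff_left algebra_simps)
        moreover have "F' n u = 0" if "u \<notin> {p..q}"
        proof -
          have "w u \<le> 0" by (rule w_out) (use True that in auto)
          then show ?thesis by (simp add: F'_def smooth_step_nonpos)
        qed
        ultimately show ?thesis using True by (auto simp: indicator_def)
      next
        case False
        then show ?thesis using pq by (auto simp: indicator_def)
      qed
    qed
    also have "\<dots> = integral {p..q} (\<lambda>u. F' n u * h u)"
      by (intro set_borel_integral_eq_integral borel_integrable_atLeastAtMost' cFh)
    finally show ?thesis by simp
  qed
  ultimately have lhs: "(\<lambda>n. strut_force_integral \<mu> (bump_field (real n) x0 r e)) \<longlonglongrightarrow> h p + - h q" by simp
  have sp: "space \<mu> = X" using \<mu> by (rule space_of_sets_restrict_borel)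
  have meas: "f \<in> borel_measurable \<mu>" if "f \<in> borel_measurable borel" for f :: "vec3 \<times> vec3 \<Rightarrow> real"
    using measurable_restrict_space1[OF that] measurable_cong_sets[OF \<mu> refl] by blast
  have fst_ball: "x \<in> \<gamma> ` {p<..<q} \<longleftrightarrow> x \<in> ball x0 r" if "(x, y) \<in> X" for x y
    using X[OF that] ball unfolding x0_def by blast
  \<comment> \<open>The bumps vanish on the sphere as well, so the limit is the indicator of the
    open ball. Struts have length 1; hence \<open>2 * norm e\<close> on the struts based on the arc,
    a set of finite measure, dominates the integrands.\<close>
  have "(\<lambda>n. LINT z|\<mu>. bump_field (real n) x0 r e (fst z) \<bullet> (2 *\<^sub>R (fst z - snd z)))
    \<longlonglongrightarrow> (LINT z|\<mu>. indicator (ball x0 r) (fst z) * (e \<bullet> (2 *\<^sub>R (fst z - snd z))))"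
  proof (rule integral_dominated_convergence[where w = "\<lambda>z. indicator I z * (2 * norm e)"])
    show "(\<lambda>z. indicator (ball x0 r) (fst z) * (e \<bullet> (2 *\<^sub>R (fst z - snd z)))) \<in> borel_measurable \<mu>"
    proof (rule meas)
      have "fst -` ball x0 r \<in> sets (borel :: (vec3 \<times> vec3) measure)"
        by (intro borel_open open_vimage_fst) simp
      then have "(indicator (fst -` ball x0 r) :: vec3 \<times> vec3 \<Rightarrow> real) \<in> borel_measurable borel"
        by (rule borel_measurable_indicator)
      moreover have "(\<lambda>z. indicator (ball x0 r) (fst z)) = (indicator (fst -` ball x0 r) :: vec3 \<times> vec3 \<Rightarrow> real)"
        by (auto simp: indicator_def)
      ultimately have "(\<lambda>z. indicator (ball x0 r) (fst z) :: real) \<in> borel_measurable (borel :: (vec3 \<times> vec3) measure)"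
        by simp
      moreover have "(\<lambda>z::vec3 \<times> vec3. e \<bullet> (2 *\<^sub>R (fst z - snd z))) \<in> borel_measurable borel"
        by (intro borel_measurable_continuous_onI continuous_intros)
      ultimately show "(\<lambda>z. indicator (ball x0 r) (fst z) * (e \<bullet> (2 *\<^sub>R (fst z - snd z)))) \<in> borel_measurable borel"
        by (rule borel_measurable_times)
    qed
    show "(\<lambda>z. bump_field (real n) x0 r e (fst z) \<bullet> (2 *\<^sub>R (fst z - snd z))) \<in> borel_measurable \<mu>" for n
      unfolding bump_field_def
      by (intro meas borel_measurable_continuous_onI continuous_intros
          continuous_on_compose2[OF continuous_on_smooth_step[of UNIV]]) auto
    show "integrable \<mu> (\<lambda>z. indicator I z * (2 * norm e))"
      using fin unfolding I_def by (intro integrable_mult_left integrable_real_indicator) auto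
    show "AE z in \<mu>. (\<lambda>n. bump_field (real n) x0 r e (fst z) \<bullet> (2 *\<^sub>R (fst z - snd z)))
        \<longlonglongrightarrow> indicator (ball x0 r) (fst z) * (e \<bullet> (2 *\<^sub>R (fst z - snd z)))"
    proof (rule AE_I2)
      fix z :: "vec3 \<times> vec3"
      have "(\<lambda>n. smooth_step (real n) (r\<^sup>2 - (fst z - x0) \<bullet> (fst z - x0))) \<longlonglongrightarrow> indicator (ball x0 r) (fst z)"
      proof (cases "fst z \<in> ball x0 r")
        case True
        then have "(norm (fst z - x0))\<^sup>2 < r\<^sup>2"
          by (intro power_strict_mono) (auto simp: dist_norm norm_minus_commute)
        then show ?thesis using smooth_step_tendsto True by (simp add: power2_norm_eq_inner)
      next
        case False
        then have "r\<^sup>2 \<le> (norm (fst z - x0))\<^sup>2"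
          using r0 by (intro power_mono) (auto simp: dist_norm norm_minus_commute)
        then show ?thesis using False by (simp add: power2_norm_eq_inner smooth_step_nonpos)
      qed
      then show "(\<lambda>n. bump_field (real n) x0 r e (fst z) \<bullet> (2 *\<^sub>R (fst z - snd z)))
        \<longlonglongrightarrow> indicator (ball x0 r) (fst z) * (e \<bullet> (2 *\<^sub>R (fst z - snd z)))"
        unfolding bump_field_def inner_scaleR_left by (rule tendsto_mult_right)
    qed
    show "AE z in \<mu>. norm (bump_field (real n) x0 r e (fst z) \<bullet> (2 *\<^sub>R (fst z - snd z)))
        \<le> indicator I z * (2 * norm e)" for n
    proof (rule AE_I2)
      fix z assume "z \<in> space \<mu>"
      then obtain x y where z: "z = (x, y)" "(x, y) \<in> X" unfolding sp by (cases z) auto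
      show "norm (bump_field (real n) x0 r e (fst z) \<bullet> (2 *\<^sub>R (fst z - snd z))) \<le> indicator I z * (2 * norm e)"
      proof (cases "x \<in> ball x0 r")
        case True
        then have "z \<in> I" using fst_ball[OF z(2)] z pq by (auto simp: I_def)
        have "norm (bump_field (real n) x0 r e x) \<le> 1 * norm e"
          unfolding bump_field_def norm_scaleR
          using smooth_step_bounds[of "real n"] by (intro mult_right_mono) auto
        then have "\<bar>bump_field (real n) x0 r e x \<bullet> (x - y)\<bar> \<le> norm e * 1"
          using Cauchy_Schwarz_ineq2[of "bump_field (real n) x0 r e x" "x - y"] X[OF z(2)] by simp
        then show ?thesis using \<open>z \<in> I\<close> z by (simp add: abs_mult)
      next
        case False
        then show ?thesis using bump_field_support(1)[OF r0 False] z by (simp add: indicator_def)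
      qed
    qed
  qed
  then have "(\<lambda>n. strut_force_integral \<mu> (bump_field (real n) x0 r e))
    \<longlonglongrightarrow> (LINT z|\<mu>. indicator (ball x0 r) (fst z) * (e \<bullet> (2 *\<^sub>R (fst z - snd z))))"
    unfolding strut_force_integral_def by (simp add: case_prod_beta')
  from LIMSEQ_unique[OF lhs this]
  have "h p - h q = (LINT z|\<mu>. indicator (ball x0 r) (fst z) * (e \<bullet> (2 *\<^sub>R (fst z - snd z))))" by simp
  also have "\<dots> = (LINT z|\<mu>. indicator (\<gamma> ` {p<..<q}) (fst z) * (e \<bullet> (2 *\<^sub>R (fst z - snd z))))"
  proof (rule Bochner_Integration.integral_cong[OF refl])
    fix z assume "z \<in> space \<mu>"
    then have "fst z \<in> \<gamma> ` {p<..<q} \<longleftrightarrow> fst z \<in> ball x0 r" using fst_ball unfolding sp by (cases z) auto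
    then show "indicator (ball x0 r) (fst z) * (e \<bullet> (2 *\<^sub>R (fst z - snd z))) =
        (indicator (\<gamma> ` {p<..<q}) (fst z) * (e \<bullet> (2 *\<^sub>R (fst z - snd z))) :: real)"
      by (simp add: indicator_def)
  qed
  finally show ?thesis by (simp add: h_def)
qed

text \<open>For given \<open>p\<close> and \<open>q\<close> the centre \<open>c\<close> comes from
  the intermediate value theorem for the difference of the distances to the two ends. Near
  \<open>m\<close> the distance from \<open>\<gamma> c\<close> is strictly monotone along the arc on
  either side of \<open>c\<close>, so the ball meets this part of the arc in exactly the open
  subarc; openness of the arc in \<open>L\<close> keeps everything else out.\<close>

lemma arc_balance_local:
  assumes lk: "link L T" and S: "arclength_measure L T S" and H: "endpoint_constraints L T H0 H1"
    and \<nu>: "kink_measure \<sigma> L T \<nu>" and bal: "balanced_by L T S H0 H1 \<mu> \<nu>"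
    and etb: "empty_tangent_balls L T" and ap: "arc_param L T \<gamma> s t"
    and null: "AE c in \<nu>. fst c \<notin> \<gamma> ` {s..t}"
    and \<mu>: "sets \<mu> = sets (restrict_space borel X)"
    and X: "\<And>x y. (x, y) \<in> X \<Longrightarrow> x \<in> L \<and> norm (x - y) = 1"
    and fin: "{z \<in> X. fst z \<in> \<gamma> ` {s..t}} \<in> sets \<mu>" "emeasure \<mu> {z \<in> X. fst z \<in> \<gamma> ` {s..t}} < \<infinity>"
    and m: "s < m" "m < t"
  shows "\<exists>\<delta>>0. \<forall>p q e. m - \<delta> < p \<longrightarrow> p < q \<longrightarrow> q < m + \<delta> \<longrightarrow> s < p \<and> q < t \<and>
    e \<bullet> T (\<gamma> p) - e \<bullet> T (\<gamma> q) =
    (LINT z|\<mu>. indicator (\<gamma> ` {p<..<q}) (fst z) * (e \<bullet> (2 *\<^sub>R (fst z - snd z))))"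
proof -
  have inj: "inj_on \<gamma> {s..t}" and gL: "\<gamma> ` {s..t} \<subseteq> L"
    and \<gamma>': "\<And>u. u \<in> {s..t} \<Longrightarrow> (\<gamma> has_vector_derivative T (\<gamma> u)) (at u within {s..t})"
    using ap by (auto simp: arc_param_def)
  have n1: "\<And>u. u \<in> {s..t} \<Longrightarrow> norm (T (\<gamma> u)) = 1" using norm_tangent[OF lk] gL by blast
  have c\<gamma>: "continuous_on {s..t} \<gamma>" using ap by (rule arc_param_continuous)
  have cT: "continuous_on {s..t} (\<lambda>u. T (\<gamma> u))"
    using continuous_on_compose2[OF continuous_on_tangent[OF lk] c\<gamma> gL] .
  obtain d1 where d1: "d1 > 0" and lin: "\<And>u v x. \<lbrakk>u \<in> {s..t}; v \<in> {s..t}; u \<le> v; v - u < d1; x \<in> {u..v}\<rbrakk>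
      \<Longrightarrow> norm (\<gamma> v - \<gamma> u - (v - u) *\<^sub>R T (\<gamma> x)) \<le> 1/2 * (v - u)"
    using uniform_linearization[OF \<gamma>' cT, of "1/2"] by (metis half_gt_zero_iff zero_less_one)
  have sec: "1/2 * (v - u) \<le> (\<gamma> v - \<gamma> u) \<bullet> T (\<gamma> x)"
    if uv: "u \<in> {s..t}" "v \<in> {s..t}" "u \<le> v" "v - u < d1" "x \<in> {u..v}" for u v x
  proof -
    have nx: "norm (T (\<gamma> x)) = 1" using n1 uv by auto
    have "\<bar>(\<gamma> v - \<gamma> u - (v - u) *\<^sub>R T (\<gamma> x)) \<bullet> T (\<gamma> x)\<bar> \<le> norm (\<gamma> v - \<gamma> u - (v - u) *\<^sub>R T (\<gamma> x))"
      using Cauchy_Schwarz_ineq2[of _ "T (\<gamma> x)"] nx by (metis mult.right_neutral)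
    also have "\<dots> \<le> 1/2 * (v - u)" by (rule lin[OF uv])
    finally have "\<bar>(\<gamma> v - \<gamma> u) \<bullet> T (\<gamma> x) - (v - u)\<bar> \<le> 1/2 * (v - u)"
      using nx by (simp add: inner_diff_left norm_eq_1)
    moreover have "1/2 * h \<le> A" if "\<bar>A - h\<bar> \<le> 1/2 * h" for A h :: real using that by linarith
    ultimately show ?thesis by blast
  qed
  define d2 where "d2 = min (d1 / 2) (min (m - s) (t - m))"
  have "d2 > 0" using d1 m by (simp add: d2_def)
  moreover have "d2 \<le> d1 / 2" "d2 \<le> m - s" "d2 \<le> t - m"
    unfolding d2_def by (rule min.coboundedI1 min.coboundedI2 order_refl)+
  ultimately have d2: "d2 > 0" "d2 \<le> d1 / 2" "d2 \<le> m - s" "d2 \<le> t - m" by blast+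
  have "openin (top_of_set L) (\<gamma> ` {m - d2<..<m + d2})"
    using d2 by (intro arc_param_open[OF lk ap]) auto
  moreover have "\<gamma> m \<in> \<gamma> ` {m - d2<..<m + d2}" using d2 by auto
  ultimately obtain R where R: "R > 0"
    "\<And>y. \<lbrakk>y \<in> L; dist y (\<gamma> m) < R\<rbrakk> \<Longrightarrow> y \<in> \<gamma> ` {m - d2<..<m + d2}"
    unfolding openin_euclidean_subtopology_iff by blast
  \<comment> \<open>The centre lies within \<delta> of \<open>\<gamma> m\<close> and the radius is
    below \<open>2 * \<delta>\<close>, so the ball about \<open>\<gamma> c\<close> stays within
    \<open>3 * \<delta> < R\<close> of \<open>\<gamma> m\<close>.\<close>
  define \<delta> where "\<delta> = min d2 (R / 4)"
  have \<delta>: "\<delta> > 0" "\<delta> \<le> d2" "\<delta> \<le> R / 4" using d2 R by (auto simp: \<delta>_def)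
  have "s < p \<and> q < t \<and> e \<bullet> T (\<gamma> p) - e \<bullet> T (\<gamma> q) =
    (LINT z|\<mu>. indicator (\<gamma> ` {p<..<q}) (fst z) * (e \<bullet> (2 *\<^sub>R (fst z - snd z))))"
    if pq: "m - \<delta> < p" "p < q" "q < m + \<delta>" for p q e
  proof -
    have st: "s < p" "q < t" using pq \<delta> d2 by auto
    define f where "f u = norm (\<gamma> u - \<gamma> p) - norm (\<gamma> u - \<gamma> q)" for u
    have ne: "\<gamma> p \<noteq> \<gamma> q" using inj_onD[OF inj, of p q] st pq by auto
    have "continuous_on {p..q} f"
      unfolding f_def[abs_def] using st
      by (intro continuous_intros continuous_on_subset[OF c\<gamma>]) auto
    moreover have "f p \<le> 0" "0 \<le> f q" by (auto simp: f_def)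
    ultimately obtain c where c: "p \<le> c" "c \<le> q" "f c = 0"
      using IVT'[of f p 0 q] pq by auto
    have "c \<noteq> p" "c \<noteq> q" using c(3) ne by (auto simp: f_def)
    then have c': "p < c" "c < q" using c by auto
    define r where "r = norm (\<gamma> q - \<gamma> c)"
    have rp: "norm (\<gamma> p - \<gamma> c) = r" using c(3) by (simp add: f_def r_def norm_minus_commute)
    have left: "(\<gamma> u - \<gamma> c) \<bullet> T (\<gamma> x) \<le> 0"
      if "u \<in> {m - d2<..<m + d2}" "x \<in> {u..c}" for u x
    proof -
      have "1/2 * (c - u) \<le> (\<gamma> c - \<gamma> u) \<bullet> T (\<gamma> x)"
        using that c' pq \<delta> d2 by (intro sec) auto
      then show ?thesis using that by (simp add: inner_diff_left)
    qed
    have right: "0 \<le> (\<gamma> u - \<gamma> c) \<bullet> T (\<gamma> x)"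
      if "u \<in> {m - d2<..<m + d2}" "x \<in> {c..u}" for u x
    proof -
      have "1/2 * (u - c) \<le> (\<gamma> u - \<gamma> c) \<bullet> T (\<gamma> x)"
        using that c' pq \<delta> d2 by (intro sec) auto
      then show ?thesis using that by (simp add: inner_diff_left)
    qed
    define w where "w u = (\<gamma> u - \<gamma> c) \<bullet> (\<gamma> u - \<gamma> c)" for u
    have w_norm: "w u = (norm (\<gamma> u - \<gamma> c))\<^sup>2" for u by (simp add: w_def power2_norm_eq_inner)
    have w_deriv: "(w has_real_derivative 2 * ((\<gamma> u - \<gamma> c) \<bullet> T (\<gamma> u))) (at u)"
      if "u \<in> {m - d2<..<m + d2}" for u
    proof -
      have u: "u \<in> {s<..<t}" using that d2 by auto
      then have "(\<gamma> has_vector_derivative T (\<gamma> u)) (at u)"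
        using \<gamma>'[of u] at_within_Icc_at[of s u t] by auto
      then have d: "((\<lambda>u. \<gamma> u - \<gamma> c) has_vector_derivative T (\<gamma> u)) (at u)"
        using has_vector_derivative_diff[OF _ has_vector_derivative_const[of "\<gamma> c"]] by fastforce
      have "((\<lambda>u. (\<gamma> u - \<gamma> c) \<bullet> (\<gamma> u - \<gamma> c)) has_vector_derivative
          ((\<gamma> u - \<gamma> c) \<bullet> T (\<gamma> u) + T (\<gamma> u) \<bullet> (\<gamma> u - \<gamma> c))) (at u)"
        by (rule bounded_bilinear.has_vector_derivative[OF bounded_bilinear_inner d d])
      then show ?thesis
        unfolding w_def[abs_def] has_real_derivative_iff_has_vector_derivative
        by (rule has_vector_derivative_eq_rhs) (simp add: inner_commute)
    qed
    have w_cont: "continuous_on {a..b} w" if "m - d2 < a" "b < m + d2" for a b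
      using that by (intro continuous_at_imp_continuous_on ballI DERIV_isCont[OF w_deriv]) auto
    have w_inc: "w a < w b" if ab: "c \<le> a" "a < b" "b < m + d2" for a b
    proof (rule DERIV_pos_imp_increasing_open[OF ab(2)])
      fix x assume x: "a < x" "x < b"
      then have xm: "x \<in> {m - d2<..<m + d2}" using ab c' pq \<delta> by auto
      have "1/2 * (x - c) \<le> (\<gamma> x - \<gamma> c) \<bullet> T (\<gamma> x)"
        using x ab c' pq \<delta> d2 by (intro sec) auto
      then have "0 < 2 * ((\<gamma> x - \<gamma> c) \<bullet> T (\<gamma> x))" using x ab by auto
      then show "\<exists>y. DERIV w x :> y \<and> 0 < y" using w_deriv[OF xm] by blast
    qed (use ab c' pq \<delta> in \<open>intro w_cont; auto\<close>)
    have w_dec: "w b < w a" if ab: "b \<le> c" "a < b" "m - d2 < a" for a b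
    proof (rule DERIV_neg_imp_decreasing_open[OF ab(2)])
      fix x assume x: "a < x" "x < b"
      then have xm: "x \<in> {m - d2<..<m + d2}" using ab c' pq \<delta> by auto
      have "1/2 * (c - x) \<le> (\<gamma> c - \<gamma> x) \<bullet> T (\<gamma> x)"
        using x ab c' pq \<delta> d2 by (intro sec) auto
      then have "2 * ((\<gamma> x - \<gamma> c) \<bullet> T (\<gamma> x)) < 0" using x ab by (auto simp: inner_diff_left)
      then show "\<exists>y. DERIV w x :> y \<and> y < 0" using w_deriv[OF xm] by blast
    qed (use ab c' pq \<delta> in \<open>intro w_cont; auto\<close>)
    have wr: "w p = r\<^sup>2" "w q = r\<^sup>2" using rp by (simp_all add: w_norm r_def)
    have r0: "r \<ge> 0" by (simp add: r_def)
    have inball: "\<gamma> u \<in> ball (\<gamma> c) r \<longleftrightarrow> w u < r\<^sup>2" for u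
      using power_strict_mono[of "norm (\<gamma> u - \<gamma> c)" r 2] power2_less_imp_less[of "norm (\<gamma> u - \<gamma> c)" r] r0
      unfolding w_norm mem_ball dist_norm norm_minus_commute[of "\<gamma> c"] by fastforce
    have dle: "norm (\<gamma> u - \<gamma> v) \<le> \<bar>u - v\<bar>" if "u \<in> {s..t}" "v \<in> {s..t}" for u v
      using unit_speed_dist_le[OF \<gamma>' _ that(2,1)] n1 by simp
    have "norm (\<gamma> c - \<gamma> m) < \<delta>" using dle[of c m] c' pq st m by auto
    moreover have "r < 2 * \<delta>" using dle[of q c] c' pq st by (auto simp: r_def)
    ultimately have small: "norm (\<gamma> c - \<gamma> m) + r < R" using \<delta> by linarith
    have ball: "L \<inter> ball (\<gamma> c) r = \<gamma> ` {p<..<q}"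
    proof (intro equalityI subsetI)
      fix y assume y: "y \<in> L \<inter> ball (\<gamma> c) r"
      then have "dist y (\<gamma> m) < R"
        using small dist_triangle[of y "\<gamma> m" "\<gamma> c"] by (auto simp: dist_norm norm_minus_commute)
      then obtain u where u: "u \<in> {m - d2<..<m + d2}" "y = \<gamma> u" using R y by blast
      then have wu: "w u < r\<^sup>2" using y inball by blast
      have "\<not> q \<le> u" using w_inc[of q u] u wu wr c' by (cases "u = q") auto
      moreover have "\<not> u \<le> p" using w_dec[of p u] u wu wr c' by (cases "u = p") auto
      ultimately show "y \<in> \<gamma> ` {p<..<q}" using u by auto
    next
      fix y assume "y \<in> \<gamma> ` {p<..<q}"
      then obtain u where u: "u \<in> {p<..<q}" "y = \<gamma> u" by blast
      have "w u < r\<^sup>2"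
      proof (cases "u \<le> c")
        case True
        then show ?thesis using w_dec[of u p] u wr pq \<delta> by auto
      next
        case False
        then show ?thesis using w_inc[of u q] u wr pq \<delta> by auto
      qed
      then show "y \<in> L \<inter> ball (\<gamma> c) r" using inball u gL st by auto
    qed
    have "e \<bullet> T (\<gamma> p) - e \<bullet> T (\<gamma> q) =
      (LINT z|\<mu>. indicator (\<gamma> ` {p<..<q}) (fst z) * (e \<bullet> (2 *\<^sub>R (fst z - snd z))))"
    proof (rule arc_balance_symmetric[OF lk S H \<nu> bal etb ap null \<mu> X fin st(1) c' st(2) rp _ ball])
      show "norm (\<gamma> q - \<gamma> c) = r" by (simp add: r_def)
      show "(\<gamma> u - \<gamma> c) \<bullet> T (\<gamma> u) \<le> 0" if "u \<in> {p..c}" for u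
        using that c' pq \<delta> by (intro left) auto
      show "0 \<le> (\<gamma> u - \<gamma> c) \<bullet> T (\<gamma> u)" if "u \<in> {c..q}" for u
        using that c' pq \<delta> by (intro right) auto
    qed
    then show ?thesis using st by blast
  qed
  then show ?thesis using \<delta>(1) by blast
qed

section \<open>Struts in one-to-one contact\<close>

text \<open>The component along \<open>e\<close> of \<open>\<Omega>(X)\<close>, for the strut force
  measure \<Omega>.\<close>

definition strut_force :: "(vec3 \<times> vec3) measure \<Rightarrow> vec3 set \<Rightarrow> vec3 \<Rightarrow> real" where
  "strut_force \<mu> X e = (LINT z|\<mu>. indicator X (fst z) * (e \<bullet> (2 *\<^sub>R (fst z - snd z))))"

text \<open>At a point that is no end of the link the tangent set is a full line, so the inequality
  of the normal cone holds in both directions and becomes an equation.\<close>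

lemma StrutD:
  assumes "(x, y) \<in> Strut \<sigma> L T" "Thi \<sigma> L T = 1"
  shows "x \<in> L" "y \<in> L" "norm (x - y) = 1" "(y, x) \<in> Strut \<sigma> L T"
    "\<lbrakk>\<not> initial_point L T x; \<not> terminal_point L T x\<rbrakk> \<Longrightarrow> (y - x) \<bullet> T x = 0"
    "\<lbrakk>\<not> initial_point L T y; \<not> terminal_point L T y\<rbrakk> \<Longrightarrow> (y - x) \<bullet> T y = 0"
proof -
  have perp: "(p - z) \<bullet> T z = 0"
    if "p \<in> normal_cone L T z" "\<not> initial_point L T z" "\<not> terminal_point L T z" for p z
  proof -
    have "z + r *\<^sub>R T z \<in> tangent_line L T z" for r
      using that unfolding tangent_line_def by blast
    then have "(p - z) \<bullet> (z + r *\<^sub>R T z - z) \<le> 0" for r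
      using that(1) unfolding normal_cone_def by blast
    from this[of 1] this[of "-1"] show ?thesis by simp
  qed
  have s: "x \<in> L" "y \<in> L" "x \<noteq> y" "x \<in> normal_cone L T y" "y \<in> normal_cone L T x"
    "ereal (norm (x - y)) = 1"
    using assms unfolding Strut_def by auto
  show "x \<in> L" "y \<in> L" using s by auto
  show "norm (x - y) = 1" using s(6) by (simp add: one_ereal_def)
  show "(y, x) \<in> Strut \<sigma> L T" using assms(1) unfolding Strut_def by (auto simp: norm_minus_commute)
  show "(y - x) \<bullet> T x = 0" if "\<not> initial_point L T x" "\<not> terminal_point L T x"
    using perp[OF s(5) that] .
  show "(y - x) \<bullet> T y = 0" if "\<not> initial_point L T y" "\<not> terminal_point L T y"
    using perp[OF s(4) that] by (simp add: inner_diff_left)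
qed

text \<open>Action equals reaction: exchanging the ends of a strut preserves \<mu> and changes the
  sign of \<open>x - y\<close>.\<close>

lemma strut_force_reverse:
  assumes \<mu>: "strut_measure \<sigma> L T \<mu>"
    and X: "X \<in> sets borel" "Y \<in> sets borel"
    and iff: "\<And>x y. (x, y) \<in> Strut \<sigma> L T \<Longrightarrow> y \<in> Y \<longleftrightarrow> x \<in> X"
    and thi: "Thi \<sigma> L T = 1"
  shows "strut_force \<mu> Y e = - strut_force \<mu> X e"
proof -
  let ?S = "Strut \<sigma> L T"
  have sets\<mu>: "sets \<mu> = sets (restrict_space borel ?S)"
    using \<mu> unfolding strut_measure_def radon_measure_on_def by blast
  have sp: "space \<mu> = ?S" using sets\<mu> by (rule space_of_sets_restrict_borel)
  have inv: "distr \<mu> \<mu> prod.swap = \<mu>" using \<mu> unfolding strut_measure_def by blast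
  have "prod.swap \<in> measurable (restrict_space borel ?S) (restrict_space borel ?S)"
  proof (rule measurable_restrict_space2)
    have "continuous_on UNIV (prod.swap :: vec3 \<times> vec3 \<Rightarrow> vec3 \<times> vec3)"
      by (auto simp: prod.swap_def intro!: continuous_intros)
    then show "prod.swap \<in> borel_measurable (restrict_space borel ?S)"
      by (intro measurable_restrict_space1 borel_measurable_continuous_onI)
    show "prod.swap \<in> space (restrict_space borel ?S) \<rightarrow> ?S"
      using StrutD(4) thi by (auto simp: space_restrict_space)
  qed
  then have sw: "prod.swap \<in> measurable \<mu> \<mu>" using measurable_cong_sets[OF sets\<mu> sets\<mu>] by blast
  define f where "f z = indicator Y (fst z) * (e \<bullet> (2 *\<^sub>R (fst z - snd z)))" for z :: "vec3 \<times> vec3"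
  have "f \<in> borel_measurable borel"
    unfolding f_def[abs_def]
  proof (rule borel_measurable_times)
    have "fst \<in> measurable (borel :: (vec3 \<times> vec3) measure) (borel :: vec3 measure)"
      by (intro borel_measurable_continuous_onI continuous_intros)
    from measurable_compose[OF this borel_measurable_indicator[OF X(2)]]
    show "(\<lambda>z::vec3 \<times> vec3. indicator Y (fst z) :: real) \<in> borel_measurable borel" .
    show "(\<lambda>z::vec3 \<times> vec3. e \<bullet> (2 *\<^sub>R (fst z - snd z))) \<in> borel_measurable borel"
      by (intro borel_measurable_continuous_onI continuous_intros)
  qed
  then have mf: "f \<in> borel_measurable \<mu>"
    using measurable_restrict_space1 measurable_cong_sets[OF sets\<mu> refl] by blast
  have "strut_force \<mu> Y e = (LINT z|distr \<mu> \<mu> prod.swap. f z)"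
    unfolding inv by (simp add: strut_force_def f_def)
  also have "\<dots> = (LINT z|\<mu>. f (prod.swap z))" by (rule integral_distr[OF sw mf])
  also have "\<dots> = (LINT z|\<mu>. - (indicator X (fst z) * (e \<bullet> (2 *\<^sub>R (fst z - snd z)))))"
  proof (rule Bochner_Integration.integral_cong[OF refl])
    fix z assume "z \<in> space \<mu>"
    then obtain x y where z: "z = (x, y)" "(x, y) \<in> ?S" unfolding sp by (cases z) auto
    then show "f (prod.swap z) = - (indicator X (fst z) * (e \<bullet> (2 *\<^sub>R (fst z - snd z))))"
      using iff[OF z(2)] by (simp add: f_def indicator_def inner_diff_right)
  qed
  finally show ?thesis by (simp add: strut_force_def)
qed

lemma radon_compact:
  fixes X :: "'a::t2_space set"
  assumes "radon_measure_on X M" "compact K" "K \<subseteq> X"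
  shows "K \<in> sets M" "emeasure M K < \<infinity>"
proof -
  have "sets M = sets (restrict_space borel X)" using assms(1) by (simp add: radon_measure_on_def)
  moreover have "K = X \<inter> K" using assms(3) by blast
  moreover have "K \<in> sets borel" using assms(2) by (rule borel_compact)
  ultimately show "K \<in> sets M" by (metis sets_restrict_space image_eqI)
  show "emeasure M K < \<infinity>" using assms unfolding radon_measure_on_def by blast
qed

text \<open>The difference of the tangents at \<open>p\<close> and \<open>q\<close> is the strut
  force on the arc between them. The struts of this arc are precisely those of its image under
  \<phi>, which therefore receives the opposite force, and the two differences cancel. The sign
  \<open>c\<close> accounts for an image arc traversed backwards.\<close>

lemma tangent_sum_locally_constant:
  assumes lk: "link L T" and S: "arclength_measure L T S" and H: "endpoint_constraints L T H0 H1"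
    and thi: "Thi \<sigma> L T = 1" and \<mu>: "strut_measure \<sigma> L T \<mu>"
    and \<nu>: "kink_measure \<sigma> L T \<nu>" and bal: "balanced_by L T S H0 H1 \<mu> \<nu>"
    and pa: "arc_param L T ga sa ta" and pb: "arc_param L T gb sb tb"
    and null: "emeasure \<nu> {c \<in> Kink \<sigma> L T. fst c \<in> ga ` {sa..ta} \<union> gb ` {sb..tb}} = 0"
    and hom: "homeomorphism (ga ` {sa..ta}) (gb ` {sb..tb}) \<phi> \<psi>"
    and st: "\<And>a. a \<in> ga ` {sa..ta} \<Longrightarrow> (a, \<phi> a) \<in> Strut \<sigma> L T"
    and uq: "\<And>x y. (x, y) \<in> Strut \<sigma> L T \<Longrightarrow> (x \<in> ga ` {sa..ta} \<longrightarrow> y = \<phi> x) \<and> (y \<in> gb ` {sb..tb} \<longrightarrow> x = \<psi> y)"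
    and \<tau>: "continuous_on {sa..ta} \<tau>" "\<tau> ` {sa..ta} = {sb..tb}"
    and g\<tau>: "\<And>s. s \<in> {sa..ta} \<Longrightarrow> gb (\<tau> s) = \<phi> (ga s)"
    and mono: "c = 1 \<and> strict_mono_on {sa..ta} \<tau> \<or> c = -1 \<and> strict_antimono_on {sa..ta} \<tau>"
    and m: "m \<in> {sa<..<ta}"
  shows "\<exists>d>0. \<forall>p q. m - d < p \<and> p < q \<and> q < m + d \<longrightarrow>
    T (ga p) + c *\<^sub>R T (gb (\<tau> p)) = T (ga q) + c *\<^sub>R T (gb (\<tau> q))"
proof -
  let ?A = "ga ` {sa..ta}" and ?B = "gb ` {sb..tb}" and ?S = "Strut \<sigma> L T"
  have rad: "radon_measure_on ?S \<mu>" and sets\<mu>: "sets \<mu> = sets (restrict_space borel ?S)"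
    using \<mu> unfolding strut_measure_def radon_measure_on_def by blast+
  have sets\<nu>: "sets \<nu> = sets (restrict_space borel (Kink \<sigma> L T))"
    using \<nu> unfolding kink_measure_def radon_measure_on_def by blast
  have c\<phi>: "continuous_on ?A \<phi>" "continuous_on ?B \<psi>" "\<phi> ` ?A = ?B" "\<psi> ` ?B = ?A"
    "\<And>x. x \<in> ?A \<Longrightarrow> \<psi> (\<phi> x) = x" "\<And>y. y \<in> ?B \<Longrightarrow> \<phi> (\<psi> y) = y"
    using hom by (auto simp: homeomorphism_def)
  have ca: "continuous_on {sa..ta} ga" and cb: "continuous_on {sb..tb} gb"
    using pa pb arc_param_continuous by blast+
  have compA: "compact ?A" and compB: "compact ?B"
    using ca cb by (auto intro: compact_continuous_image)
  have inja: "inj_on ga {sa..ta}" and injb: "inj_on gb {sb..tb}"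
    using pa pb by (auto simp: arc_param_def)
  have nullset: "{c \<in> Kink \<sigma> L T. fst c \<in> ?A \<union> ?B} \<in> null_sets \<nu>"
  proof -
    have "closed (?A \<union> ?B)" using compA compB by (intro closed_Un compact_imp_closed)
    then have "closed (fst -` (?A \<union> ?B) :: circ set)" by (rule closed_vimage_fst)
    then have "fst -` (?A \<union> ?B) \<in> sets (borel :: circ measure)" by (rule borel_closed)
    moreover have "{c \<in> Kink \<sigma> L T. fst c \<in> ?A \<union> ?B} = Kink \<sigma> L T \<inter> fst -` (?A \<union> ?B)" by auto
    ultimately have "{c \<in> Kink \<sigma> L T. fst c \<in> ?A \<union> ?B} \<in> sets \<nu>"
      unfolding sets\<nu> sets_restrict_space by blast
    then show ?thesis using null by auto
  qed
  have sp\<nu>: "space \<nu> = Kink \<sigma> L T" using sets\<nu> by (rule space_of_sets_restrict_borel)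
  have AEa: "AE z in \<nu>. fst z \<notin> ?A" and AEb: "AE z in \<nu>. fst z \<notin> ?B"
    by (rule AE_I'[OF nullset]; auto simp: sp\<nu>)+
  \<comment> \<open>The struts based on an arc form the graph of a continuous map over a compact
    set, so their \<mu>-measure is finite.\<close>
  have KA: "{z \<in> ?S. fst z \<in> ?A} = (\<lambda>a. (a, \<phi> a)) ` ?A"
  proof (intro equalityI subsetI)
    fix z assume "z \<in> {z \<in> ?S. fst z \<in> ?A}"
    then obtain x y where "z = (x, y)" "(x, y) \<in> ?S" "x \<in> ?A" by (cases z) auto
    then show "z \<in> (\<lambda>a. (a, \<phi> a)) ` ?A" using uq by blast
  qed (use st in auto)
  have KB: "{z \<in> ?S. fst z \<in> ?B} = (\<lambda>b. (b, \<psi> b)) ` ?B"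
  proof (intro equalityI subsetI)
    fix z assume "z \<in> {z \<in> ?S. fst z \<in> ?B}"
    then obtain x y where z: "z = (x, y)" "(x, y) \<in> ?S" "x \<in> ?B" by (cases z) auto
    then have "(y, x) \<in> ?S" using StrutD(4) thi by blast
    then show "z \<in> (\<lambda>b. (b, \<psi> b)) ` ?B" using uq z by blast
  next
    fix z assume "z \<in> (\<lambda>b. (b, \<psi> b)) ` ?B"
    then obtain b where b: "b \<in> ?B" "z = (b, \<psi> b)" by blast
    then have "\<psi> b \<in> ?A" "\<phi> (\<psi> b) = b" using c\<phi> by auto
    then have "(\<psi> b, b) \<in> ?S" using st by metis
    then show "z \<in> {z \<in> ?S. fst z \<in> ?B}" using StrutD(4) thi b by auto
  qed
  have "compact {z \<in> ?S. fst z \<in> ?A}" "compact {z \<in> ?S. fst z \<in> ?B}"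
    unfolding KA KB by (intro compact_continuous_image continuous_intros c\<phi> compA compB)+
  then have finA: "{z \<in> ?S. fst z \<in> ?A} \<in> sets \<mu>" "emeasure \<mu> {z \<in> ?S. fst z \<in> ?A} < \<infinity>"
    and finB: "{z \<in> ?S. fst z \<in> ?B} \<in> sets \<mu>" "emeasure \<mu> {z \<in> ?S. fst z \<in> ?B} < \<infinity>"
    using radon_compact[OF rad] by blast+
  have Sx: "x \<in> L \<and> norm (x - y) = 1" if "(x, y) \<in> ?S" for x y using StrutD that thi by blast
  have etb: "empty_tangent_balls L T" using Thi_one_imp_empty_tangent_balls[OF lk thi] .
  have smono: "x \<noteq> y \<Longrightarrow> x \<in> {sa..ta} \<Longrightarrow> y \<in> {sa..ta} \<Longrightarrow> \<tau> x \<noteq> \<tau> y" for x y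
    using mono unfolding monotone_on_def by (metis linorder_neqE_linordered_idom less_irrefl)
  have \<tau>I: "\<tau> s \<in> {sb..tb}" if "s \<in> {sa..ta}" for s using \<tau>(2) that by blast
  have \<tau>m: "sb < \<tau> m" "\<tau> m < tb"
  proof -
    have "m \<in> {sa..ta}" "sa \<in> {sa..ta}" "ta \<in> {sa..ta}" using m by auto
    then have "\<tau> sa \<in> {sb..tb}" "\<tau> ta \<in> {sb..tb}" using \<tau>I by blast+
    moreover have "\<tau> sa < \<tau> m \<and> \<tau> m < \<tau> ta \<or> \<tau> ta < \<tau> m \<and> \<tau> m < \<tau> sa"
      using mono m unfolding monotone_on_def by auto
    ultimately show "sb < \<tau> m" "\<tau> m < tb" by auto
  qed
  obtain d1 where d1: "d1 > 0" and balA: "\<And>p q e. \<lbrakk>m - d1 < p; p < q; q < m + d1\<rbrakk> \<Longrightarrow> sa < p \<and> q < ta \<and>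
      e \<bullet> T (ga p) - e \<bullet> T (ga q) = strut_force \<mu> (ga ` {p<..<q}) e"
    using arc_balance_local[OF lk S H \<nu> bal etb pa AEa sets\<mu> Sx finA, of m] m
    unfolding strut_force_def by auto
  obtain d2 where d2: "d2 > 0" and balB: "\<And>p q e. \<lbrakk>\<tau> m - d2 < p; p < q; q < \<tau> m + d2\<rbrakk> \<Longrightarrow>
      e \<bullet> T (gb p) - e \<bullet> T (gb q) = strut_force \<mu> (gb ` {p<..<q}) e"
    using arc_balance_local[OF lk S H \<nu> bal etb pb AEb sets\<mu> Sx finB \<tau>m]
    unfolding strut_force_def by blast
  have "continuous (at m) \<tau>" using \<tau>(1) m by (simp add: continuous_on_interior)
  then obtain d3 where d3: "d3 > 0" "\<And>s. dist s m < d3 \<Longrightarrow> dist (\<tau> s) (\<tau> m) < d2"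
    using d2 unfolding continuous_at_eps_delta by blast
  define d where "d = min d1 d3"
  have d: "d > 0" "d \<le> d1" "d \<le> d3" using d1 d3 by (auto simp: d_def)
  have "T (ga p) + c *\<^sub>R T (gb (\<tau> p)) = T (ga q) + c *\<^sub>R T (gb (\<tau> q))"
    if pq: "m - d < p" "p < q" "q < m + d" for p q
  proof -
    have in1: "sa < p" "q < ta" using balA[of p q] pq d by auto
    have nearp: "dist (\<tau> p) (\<tau> m) < d2" "dist (\<tau> q) (\<tau> m) < d2"
      by (rule d3(2), use pq d in \<open>simp add: dist_real_def\<close>)+
    define lo hi where "lo = min (\<tau> p) (\<tau> q)" and "hi = max (\<tau> p) (\<tau> q)"
    have lohi: "lo < hi" using smono[of p q] pq in1 by (auto simp: lo_def hi_def)
    have near: "\<tau> m - d2 < lo" "hi < \<tau> m + d2"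
      using nearp by (auto simp: lo_def hi_def dist_real_def)
    \<comment> \<open>Open arcs have to correspond exactly, so that the same struts are counted on
      both sides, with those at the ends left out of both.\<close>
    have im: "\<tau> ` {p<..<q} = {lo<..<hi}"
    proof (intro equalityI subsetI)
      fix w assume "w \<in> \<tau> ` {p<..<q}"
      then obtain u where u: "u \<in> {p<..<q}" "w = \<tau> u" by blast
      then have "\<tau> p < \<tau> u \<and> \<tau> u < \<tau> q \<or> \<tau> q < \<tau> u \<and> \<tau> u < \<tau> p"
        using mono in1 unfolding monotone_on_def by auto
      then show "w \<in> {lo<..<hi}" using u by (auto simp: lo_def hi_def)
    next
      fix w assume w: "w \<in> {lo<..<hi}"
      have "continuous_on {p..q} \<tau>" using in1 by (intro continuous_on_subset[OF \<tau>(1)]) auto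
      then have "is_interval (\<tau> ` {p..q})"
        unfolding is_interval_connected_1 by (rule connected_continuous_image) simp
      moreover have "lo \<in> \<tau> ` {p..q}" "hi \<in> \<tau> ` {p..q}"
        using pq by (auto simp: lo_def hi_def min_def max_def)
      ultimately have "w \<in> \<tau> ` {p..q}" using w unfolding is_interval_1 by (meson greaterThanLessThan_iff less_imp_le)
      then obtain u where u: "u \<in> {p..q}" "w = \<tau> u" by blast
      moreover have "w \<noteq> \<tau> p" "w \<noteq> \<tau> q" using w by (auto simp: lo_def hi_def)
      ultimately have "u \<in> {p<..<q}" by (cases "u = p"; cases "u = q") auto
      then show "w \<in> \<tau> ` {p<..<q}" using u by blast
    qed
    have gim: "gb ` {lo<..<hi} = \<phi> ` ga ` {p<..<q}"
      unfolding im[symmetric] image_image using in1 by (intro image_cong g\<tau>) auto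
    have borel_arc: "g ` {x<..<y} \<in> sets borel"
      if "continuous_on {x..y} g" "inj_on g {x..y}" for g :: "real \<Rightarrow> vec3" and x y
    proof -
      have "g ` {x<..<y} = g ` {x..y} - g ` ({x, y} \<inter> {x..y})"
        using that(2) by (subst inj_on_image_set_diff[symmetric, of g "{x..y}"]) (auto intro!: arg_cong[of _ _ "(`) g"])
      moreover have "compact (g ` {x..y})" "finite (g ` ({x, y} \<inter> {x..y}))"
        using that(1) by (auto intro: compact_continuous_image)
      ultimately show ?thesis by (simp add: borel_compact finite_imp_closed borel_closed sets.Diff)
    qed
    have loI: "sb \<le> lo" "hi \<le> tb" using \<tau>I[of p] \<tau>I[of q] in1 pq by (auto simp: lo_def hi_def)
    have rev: "strut_force \<mu> (gb ` {lo<..<hi}) e = - strut_force \<mu> (ga ` {p<..<q}) e" for e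
    proof (rule strut_force_reverse[OF \<mu> _ _ _ thi])
      show "ga ` {p<..<q} \<in> sets borel"
        using in1 pq by (intro borel_arc continuous_on_subset[OF ca] inj_on_subset[OF inja]) auto
      show "gb ` {lo<..<hi} \<in> sets borel"
        using loI by (intro borel_arc continuous_on_subset[OF cb] inj_on_subset[OF injb]) auto
      fix x y assume xy: "(x, y) \<in> ?S"
      show "y \<in> gb ` {lo<..<hi} \<longleftrightarrow> x \<in> ga ` {p<..<q}"
      proof
        assume "y \<in> gb ` {lo<..<hi}"
        then obtain u where u: "u \<in> {p<..<q}" "y = \<phi> (ga u)" unfolding gim by blast
        then have uA: "ga u \<in> ?A" using in1 by auto
        then have "y \<in> ?B" using u c\<phi>(3) by blast
        then have "x = \<psi> y" using uq[OF xy] by blast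
        then have "x = ga u" using u c\<phi>(5)[OF uA] by simp
        then show "x \<in> ga ` {p<..<q}" using u by blast
      next
        assume x: "x \<in> ga ` {p<..<q}"
        then have "x \<in> ?A" using in1 by auto
        then have "y = \<phi> x" using uq[OF xy] by blast
        then show "y \<in> gb ` {lo<..<hi}" unfolding gim using x by blast
      qed
    qed
    have eA: "e \<bullet> T (ga p) - e \<bullet> T (ga q) = strut_force \<mu> (ga ` {p<..<q}) e" for e
      using balA[of p q] pq d by auto
    have eB: "e \<bullet> T (gb lo) - e \<bullet> T (gb hi) = - strut_force \<mu> (ga ` {p<..<q}) e" for e
      using balB[OF near(1) lohi near(2)] rev by simp
    \<comment> \<open>If \<tau> decreases, the ends of the image arc are exchanged, and
      \<open>c = -1\<close> restores the sign.\<close>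
    have eB': "c * (e \<bullet> T (gb (\<tau> p)) - e \<bullet> T (gb (\<tau> q))) = - strut_force \<mu> (ga ` {p<..<q}) e" for e
    proof (cases "c = 1")
      case True
      then have "\<tau> p < \<tau> q" using mono in1 pq unfolding monotone_on_def by auto
      then show ?thesis using eB[of e] True by (simp add: lo_def hi_def)
    next
      case False
      then have "c = -1" "\<tau> q < \<tau> p" using mono in1 pq unfolding monotone_on_def by auto
      then show ?thesis using eB[of e] by (simp add: lo_def hi_def)
    qed
    have "e \<bullet> (T (ga p) + c *\<^sub>R T (gb (\<tau> p))) = e \<bullet> (T (ga q) + c *\<^sub>R T (gb (\<tau> q)))" for e
      using eA[of e] eB'[of e] by (simp add: inner_add_right algebra_simps)
    then show ?thesis by (metis vector_eq_ldot)
  qed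
  then show ?thesis using d(1) by blast
qed

section \<open>Classification of contact pairs\<close>

lemma vector_derivative_zero_imp_constant:
  assumes "\<And>s. s \<in> {a..b} \<Longrightarrow> (f has_vector_derivative 0) (at s within {a..b::real})"
  shows "\<exists>k. \<forall>s\<in>{a..b}. f s = k"
proof -
  obtain k where "\<And>s. s \<in> {a..b} \<Longrightarrow> f s = k"
    by (rule has_vector_derivative_zero_constant[OF convex_real_interval(5) assms]) (assumption, rule that, blast)
  then show ?thesis by blast
qed

lemma dist_inner_bound:
  fixes d x :: "'a::real_inner"
  assumes "norm x = 1" "norm (d - h *\<^sub>R x) \<le> \<eta> * h"
  shows "(1 - \<eta>) * h \<le> d \<bullet> x"
proof -
  have "\<bar>(d - h *\<^sub>R x) \<bullet> x\<bar> \<le> \<eta> * h"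
    using Cauchy_Schwarz_ineq2[of "d - h *\<^sub>R x" x] assms by simp
  then have "\<bar>d \<bullet> x - h\<bar> \<le> \<eta> * h" using assms(1) by (simp add: inner_diff_left norm_eq_1)
  then show ?thesis by (simp add: abs_le_iff algebra_simps)
qed

text \<open>The parameter change is a translation.  If the constant \<open>V = \<alpha> + \<beta>\<close> is not zero, both curves
  progress at the same rate in the direction \<open>V\<close>; if \<open>V = 0\<close>, the perpendicularity of the struts
  makes the tangents turn at the rate \<open>1 + d\<tau>/ds\<close> with respect to \<open>s\<close>, which is at most \<open>2\<close>, and
  symmetrically.\<close>

lemma contact_parameter_translation:
  fixes a b \<alpha> \<beta> :: "real \<Rightarrow> vec3"
  assumes s01: "s0 < s1" and t01: "t0 < t1"
    and a': "\<And>s. s \<in> {s0..s1} \<Longrightarrow> (a has_vector_derivative \<alpha> s) (at s within {s0..s1})"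
    and b': "\<And>s. s \<in> {t0..t1} \<Longrightarrow> (b has_vector_derivative \<beta> s) (at s within {t0..t1})"
    and lip: "2-lipschitz_on {s0..s1} \<alpha>" "2-lipschitz_on {t0..t1} \<beta>"
    and n1: "\<And>s. s \<in> {s0..s1} \<Longrightarrow> norm (\<alpha> s) = 1" "\<And>s. s \<in> {t0..t1} \<Longrightarrow> norm (\<beta> s) = 1"
    and \<tau>: "continuous_on {s0..s1} \<tau>" "strict_mono_on {s0..s1} \<tau>" "\<tau> ` {s0..s1} = {t0..t1}"
    and unit: "\<And>s. s \<in> {s0..s1} \<Longrightarrow> norm (b (\<tau> s) - a s) = 1"
    and perp: "\<And>s. s \<in> {s0..s1} \<Longrightarrow> (b (\<tau> s) - a s) \<bullet> \<alpha> s = 0"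
      "\<And>s. s \<in> {s0..s1} \<Longrightarrow> (b (\<tau> s) - a s) \<bullet> \<beta> (\<tau> s) = 0"
    and V: "\<And>s. s \<in> {s0..s1} \<Longrightarrow> \<alpha> s + \<beta> (\<tau> s) = V"
  shows "\<exists>k. \<forall>s\<in>{s0..s1}. \<tau> s = s + k"
proof (cases "V = 0")
  case False
  \<comment> \<open>Two unit vectors with sum \<open>V\<close> have the same inner product with
    \<open>V\<close>, namely half its squared norm.\<close>
  define c where "c = (V \<bullet> V) / 2"
  have c: "c > 0" using False by (simp add: c_def)
  have \<tau>I: "\<tau> s \<in> {t0..t1}" if "s \<in> {s0..s1}" for s using \<tau>(3) that by blast
  have \<alpha>V: "\<alpha> s \<bullet> V = c" "\<beta> (\<tau> s) \<bullet> V = c" if s: "s \<in> {s0..s1}" for s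
    using n1(1)[OF s] n1(2)[OF \<tau>I[OF s]] unfolding c_def V[OF s, symmetric]
    by (simp_all add: inner_add_left inner_add_right norm_eq_1 inner_commute)
  have \<beta>V: "\<beta> t \<bullet> V = c" if "t \<in> {t0..t1}" for t using \<alpha>V(2) that \<tau>(3) by (metis imageE)
  have "\<exists>k. \<forall>s\<in>{s0..s1}. a s \<bullet> V - c * s = k"
  proof -
    have "((\<lambda>s. a s \<bullet> V - c * s) has_vector_derivative 0) (at s within {s0..s1})" if "s \<in> {s0..s1}" for s
      using has_vector_derivative_diff[OF bounded_linear.has_vector_derivative[OF bounded_linear_inner_left a'[OF that], of V]
          has_vector_derivative_mult_right[OF has_vector_derivative_id, of c]] \<alpha>V[OF that] by simp
    then show ?thesis by (rule vector_derivative_zero_imp_constant)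
  qed
  then obtain ka where ka: "\<And>s. s \<in> {s0..s1} \<Longrightarrow> a s \<bullet> V - c * s = ka" by blast
  have "\<exists>k. \<forall>s\<in>{t0..t1}. b s \<bullet> V - c * s = k"
  proof -
    have "((\<lambda>s. b s \<bullet> V - c * s) has_vector_derivative 0) (at s within {t0..t1})" if "s \<in> {t0..t1}" for s
      using has_vector_derivative_diff[OF bounded_linear.has_vector_derivative[OF bounded_linear_inner_left b'[OF that], of V]
          has_vector_derivative_mult_right[OF has_vector_derivative_id, of c]] \<beta>V[OF that] by simp
    then show ?thesis by (rule vector_derivative_zero_imp_constant)
  qed
  then obtain kb where kb: "\<And>s. s \<in> {t0..t1} \<Longrightarrow> b s \<bullet> V - c * s = kb" by blast
  have "\<tau> s = s + (ka - kb) / c" if s: "s \<in> {s0..s1}" for s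
  proof -
    have "(b (\<tau> s) - a s) \<bullet> V = 0" using perp[OF s] V[OF s, symmetric] by (simp add: inner_add_right)
    then have "c * \<tau> s + kb = c * s + ka" using ka[OF s] kb[OF \<tau>I[OF s]] by (simp add: inner_diff_left)
    then show ?thesis using c by (simp add: field_simps)
  qed
  then show ?thesis by blast
next
  case True
  have \<tau>I: "\<tau> s \<in> {t0..t1}" if "s \<in> {s0..s1}" for s using \<tau>(3) that by blast
  have \<beta>\<alpha>: "\<beta> (\<tau> s) = - \<alpha> s" if "s \<in> {s0..s1}" for s
    using V[OF that] True by (simp add: add_eq_0_iff)
  define g where "g s = \<tau> s - s" for s
  have lipg: "dist (g s) (g s') \<le> 0 * (s' - s)" if "s \<in> {s0..s1}" "s' \<in> {s0..s1}" "s \<le> s'" for s s'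
  proof (rule lipschitz_from_infinitesimal[where a = s0 and b = s1])
    fix \<epsilon> :: real assume "\<epsilon> > 0"
    \<comment> \<open>The bound \<open>e \<le> 1\<close> makes \<open>1 + e\<close> at most 2 in the
      final estimate, and \<open>2 * e \<le> \<epsilon>\<close> absorbs this factor.\<close>
    define e where "e = min 1 (\<epsilon> / 2)"
    have e: "e > 0" "e \<le> 1" "2 * e \<le> \<epsilon>" using \<open>\<epsilon> > 0\<close> by (auto simp: e_def)
    define \<eta> where "\<eta> = e / (2 + e)"
    have \<eta>: "\<eta> > 0" "(2 + e) * (1 - \<eta>) = 2" using e by (auto simp: \<eta>_def field_simps)
    obtain d1 where d1: "d1 > 0" and lina: "\<And>u v x. \<lbrakk>u \<in> {s0..s1}; v \<in> {s0..s1}; u \<le> v; v - u < d1; x \<in> {u..v}\<rbrakk>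
        \<Longrightarrow> norm (a v - a u - (v - u) *\<^sub>R \<alpha> x) \<le> \<eta> * (v - u)"
      using uniform_linearization[OF a' lipschitz_on_continuous_on[OF lip(1)] \<eta>(1)] by blast
    obtain d2 where d2: "d2 > 0" and linb: "\<And>u v x. \<lbrakk>u \<in> {t0..t1}; v \<in> {t0..t1}; u \<le> v; v - u < d2; x \<in> {u..v}\<rbrakk>
        \<Longrightarrow> norm (b v - b u - (v - u) *\<^sub>R \<beta> x) \<le> \<eta> * (v - u)"
      using uniform_linearization[OF b' lipschitz_on_continuous_on[OF lip(2)] \<eta>(1)] by blast
    have "uniformly_continuous_on {s0..s1} \<tau>"
      using \<tau>(1) compact_uniformly_continuous compact_Icc by blast
    then obtain d3 where d3: "d3 > 0"
      and uc: "\<And>u v. \<lbrakk>u \<in> {s0..s1}; v \<in> {s0..s1}; dist v u < d3\<rbrakk> \<Longrightarrow> dist (\<tau> v) (\<tau> u) < d2"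
      using d2 unfolding uniformly_continuous_on_def by metis
    have "dist (g s) (g s') \<le> (0 + \<epsilon>) * (s' - s)"
      if s: "s \<in> {s0..s1}" "s' \<in> {s0..s1}" "s \<le> s'" "s' - s < min d1 d3" for s s'
    proof -
      define t t' where "t = \<tau> s" and "t' = \<tau> s'"
      have t: "t \<in> {t0..t1}" "t' \<in> {t0..t1}" using \<tau>I s by (auto simp: t_def t'_def)
      have tle: "t \<le> t'" unfolding t_def t'_def
        using strict_mono_on_leD[OF \<tau>(2)] s by blast
      have "t' - t < d2" using uc[of s s'] s tle by (simp add: t_def t'_def dist_real_def)
      then have B: "(1 - \<eta>) * (t' - t) \<le> (b t' - b t) \<bullet> \<beta> t"
        using t tle n1(2) by (intro dist_inner_bound linb) auto
      have A: "(1 - \<eta>) * (s' - s) \<le> (a s' - a s) \<bullet> \<alpha> s"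
        using s n1(1) by (intro dist_inner_bound lina) auto
      have bt: "\<beta> t = - \<alpha> s" "\<beta> t' = - \<alpha> s'" using \<beta>\<alpha> s by (auto simp: t_def t'_def)
      have p: "(b t' - a s') \<bullet> \<alpha> s' = 0" "(b t - a s) \<bullet> \<alpha> s = 0" and u: "norm (b t' - a s') = 1"
        using perp unit s by (auto simp: t_def t'_def)
      \<comment> \<open>The strut at \<open>s\<close> is perpendicular to \<open>\<alpha> s\<close>
        and the one at \<open>s'\<close> to \<open>\<alpha> s'\<close>. With opposite tangents the
        progress on both arcs adds up along \<open>\<alpha> s\<close>, so only a change of the
        tangent can compensate for it.\<close>
      have "(1 - \<eta>) * (t' - t) + (1 - \<eta>) * (s' - s) \<le> - ((b t' - a s') \<bullet> \<alpha> s)"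
        using A B p(2) bt by (simp add: inner_diff_left)
      also have "\<dots> = (b t' - a s') \<bullet> (\<alpha> s' - \<alpha> s)" using p(1) by (simp add: inner_diff_right)
      also have "\<dots> \<le> norm (\<alpha> s' - \<alpha> s)"
        using norm_cauchy_schwarz[of "b t' - a s'" "\<alpha> s' - \<alpha> s"] u by simp
      finally have main: "(1 - \<eta>) * ((t' - t) + (s' - s)) \<le> norm (\<alpha> s' - \<alpha> s)" by (simp add: algebra_simps)
      have la: "norm (\<alpha> s' - \<alpha> s) \<le> 2 * (s' - s)"
        using lipschitz_onD[OF lip(1) s(2,1)] s by (simp add: dist_norm)
      have lb: "norm (\<alpha> s' - \<alpha> s) \<le> 2 * (t' - t)"
        using lipschitz_onD[OF lip(2) t(2,1)] tle bt by (simp add: dist_norm norm_minus_commute)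
      \<comment> \<open>If the turning is at most twice the progress \<open>y\<close> on one arc,
        \<open>main\<close> shows that the other arc progresses hardly faster. Both arcs obey the
        turning bound, so neither outruns the other.\<close>
      have key: "x \<le> (1 + e) * y" if "(1 - \<eta>) * (x + y) \<le> 2 * y" for x y :: real
      proof -
        have "(2 + e) * ((1 - \<eta>) * (x + y)) \<le> (2 + e) * (2 * y)" using that e by (intro mult_left_mono) auto
        then have "2 * (x + y) \<le> (2 + e) * (2 * y)" using \<eta>(2) by (simp add: mult.assoc[symmetric])
        then show ?thesis by (simp add: algebra_simps)
      qed
      have 1: "t' - t \<le> (1 + e) * (s' - s)" using key main la by (meson order_trans)
      have 2: "s' - s \<le> (1 + e) * (t' - t)"
      proof (rule key)
        show "(1 - \<eta>) * (s' - s + (t' - t)) \<le> 2 * (t' - t)"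
          using main lb by (simp add: add.commute)
      qed
      have "e * (t' - t) \<le> e * ((1 + e) * (s' - s))" using 1 e by (intro mult_left_mono) auto
      also have "\<dots> \<le> e * (2 * (s' - s))" using e s by (intro mult_left_mono mult_right_mono) auto
      also have "\<dots> = (2 * e) * (s' - s)" by simp
      also have "\<dots> \<le> \<epsilon> * (s' - s)" using e s by (intro mult_right_mono) auto
      finally have 3: "e * (t' - t) \<le> \<epsilon> * (s' - s)" .
      have 4: "e * (s' - s) \<le> \<epsilon> * (s' - s)" using e s by (intro mult_right_mono) auto
      have "(t' - t) - (s' - s) \<le> \<epsilon> * (s' - s)" "(s' - s) - (t' - t) \<le> \<epsilon> * (s' - s)"
        using 1 2 3 4 by (simp_all add: algebra_simps)
      then have "\<bar>(t' - t) - (s' - s)\<bar> \<le> \<epsilon> * (s' - s)" by (simp add: abs_le_iff)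
      moreover have "dist (g s) (g s') = \<bar>(t' - t) - (s' - s)\<bar>"
        by (simp add: g_def t_def t'_def dist_real_def abs_minus_commute algebra_simps)
      ultimately show ?thesis by simp
    qed
    then show "\<exists>\<delta>>0. \<forall>x\<in>{s0..s1}. \<forall>y\<in>{s0..s1}. x \<le> y \<longrightarrow> y - x < \<delta> \<longrightarrow>
        dist (g x) (g y) \<le> (0 + \<epsilon>) * (y - x)"
      using d1 d3 by (intro exI[of _ "min d1 d3"]) auto
  qed (use that in auto)
  have "\<tau> s = s + g s0" if s: "s \<in> {s0..s1}" for s
  proof -
    have "g s0 = g s" using lipg[of s0 s] s s01 by simp
    then show ?thesis by (simp add: g_def)
  qed
  then show ?thesis by blast
qed

section \<open>Lower bound for the pitch\<close>

lemma sin_mult_over_tendsto: "((\<lambda>h::real. sin (k * h) / h) \<longlongrightarrow> k) (at_right 0)"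
proof -
  have "((\<lambda>h. sin (k * h)) has_real_derivative k) (at 0)"
    by (auto intro!: derivative_eq_intros)
  then have "((\<lambda>h. sin (k * h) / h) \<longlongrightarrow> k) (at 0)" by (simp add: DERIV_def)
  then show ?thesis by (rule filterlim_mono) (auto intro: at_le)
qed

text \<open>Here \<open>Q h\<close> is the squared distance from a point of one strand to the point \<open>h\<close> further along the
  other one, and \<open>P h\<close> is the component of the difference along the tangent.  The assumed inequality
  keeps the other strand out of the tangent balls; to second order in \<open>h\<close> it reads
  \<open>c (1 + c) \<ge> 0\<close> for the cosine \<open>c\<close> of the angle between the tangents.\<close>

lemma pitch_bound:
  fixes v \<omega> :: real
  assumes vw: "v\<^sup>2 + \<omega>\<^sup>2 = 4" "v > 0" "\<omega> > 0" and "l > 0"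
    and Q: "\<And>h. Q h = h\<^sup>2 * v\<^sup>2 / 4 + (1 + cos (\<omega> * h)) / 2"
    and P: "\<And>h. P h = h * v\<^sup>2 / 4 - \<omega> * sin (\<omega> * h) / 4"
    and le: "\<And>h. \<lbrakk>0 < h; h < l\<rbrakk> \<Longrightarrow> Q h - (P h)\<^sup>2 \<le> (Q h)\<^sup>2"
  shows "\<omega> \<le> v"
proof -
  \<comment> \<open>For unit vectors whose sum has norm \<open>v\<close> and whose difference has
    norm \<omega>, this is their inner product.\<close>
  define c where "c = (v\<^sup>2 - \<omega>\<^sup>2) / 4"
  have Qeq: "(Q h - 1) / h\<^sup>2 = v\<^sup>2 / 4 - (sin (\<omega> / 2 * h) / h)\<^sup>2" if "h > 0" for h
  proof -
    have "cos (\<omega> * h) = 1 - 2 * (sin (\<omega> / 2 * h))\<^sup>2"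
      using cos_double_sin[of "\<omega> / 2 * h"] by (simp add: mult.assoc[symmetric])
    then have "Q h - 1 = h\<^sup>2 * (v\<^sup>2 / 4) - (sin (\<omega> / 2 * h))\<^sup>2"
      by (simp add: Q diff_divide_distrib)
    then show ?thesis using that by (simp add: diff_divide_distrib power_divide)
  qed
  have "((\<lambda>h. v\<^sup>2 / 4 - (sin (\<omega> / 2 * h) / h)\<^sup>2) \<longlongrightarrow> v\<^sup>2 / 4 - (\<omega> / 2)\<^sup>2) (at_right 0)"
    by (intro tendsto_intros sin_mult_over_tendsto)
  moreover have "v\<^sup>2 / 4 - (\<omega> / 2)\<^sup>2 = c" by (simp add: c_def power_divide diff_divide_distrib)
  ultimately have "((\<lambda>h. v\<^sup>2 / 4 - (sin (\<omega> / 2 * h) / h)\<^sup>2) \<longlongrightarrow> c) (at_right 0)" by simp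
  moreover have "\<forall>\<^sub>F h in at_right 0. v\<^sup>2 / 4 - (sin (\<omega> / 2 * h) / h)\<^sup>2 = (Q h - 1) / h\<^sup>2"
    using Qeq by (auto simp: eventually_at_right_field intro: exI[of _ 1])
  ultimately have limQ1: "((\<lambda>h. (Q h - 1) / h\<^sup>2) \<longlongrightarrow> c) (at_right 0)"
    by (rule Lim_transform_eventually)
  have limQ: "(Q \<longlongrightarrow> 0\<^sup>2 * v\<^sup>2 / 4 + (1 + cos (\<omega> * 0)) / 2) (at_right 0)"
    unfolding Q[abs_def] by (intro tendsto_intros) auto
  have "((\<lambda>h. v\<^sup>2 / 4 - \<omega> / 4 * (sin (\<omega> * h) / h)) \<longlongrightarrow> v\<^sup>2 / 4 - \<omega> / 4 * \<omega>) (at_right 0)"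
    by (intro tendsto_intros sin_mult_over_tendsto)
  moreover have "v\<^sup>2 / 4 - \<omega> / 4 * \<omega> = c" by (simp add: c_def power2_eq_square diff_divide_distrib)
  ultimately have "((\<lambda>h. v\<^sup>2 / 4 - \<omega> / 4 * (sin (\<omega> * h) / h)) \<longlongrightarrow> c) (at_right 0)" by simp
  moreover have "\<forall>\<^sub>F h in at_right 0. v\<^sup>2 / 4 - \<omega> / 4 * (sin (\<omega> * h) / h) = P h / h"
    by (auto simp: eventually_at_right_field P field_simps intro: exI[of _ 1])
  ultimately have limP: "((\<lambda>h. P h / h) \<longlongrightarrow> c) (at_right 0)"
    by (rule Lim_transform_eventually)
  have "((\<lambda>h. Q h * ((Q h - 1) / h\<^sup>2) + (P h / h)\<^sup>2) \<longlongrightarrow> 1 * c + c\<^sup>2) (at_right 0)"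
    using limQ by (intro tendsto_intros limQ1 limP) simp
  moreover have "\<forall>\<^sub>F h in at_right 0. 0 \<le> Q h * ((Q h - 1) / h\<^sup>2) + (P h / h)\<^sup>2"
    unfolding eventually_at_right_field
  proof (intro exI conjI allI impI)
    fix h assume h: "0 < h" "h < l"
    have "Q h * ((Q h - 1) / h\<^sup>2) + (P h / h)\<^sup>2 = ((Q h)\<^sup>2 - Q h + (P h)\<^sup>2) / h\<^sup>2"
      using h by (simp add: field_simps power2_eq_square)
    then show "0 \<le> Q h * ((Q h - 1) / h\<^sup>2) + (P h / h)\<^sup>2" using le[OF h] by simp
  qed (use \<open>l > 0\<close> in auto)
  ultimately have "0 \<le> 1 * c + c\<^sup>2" by (intro tendsto_lowerbound) auto
  then have "0 \<le> c * (1 + c)" by (simp add: algebra_simps power2_eq_square)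
  \<comment> \<open>Since \<open>v > 0\<close> the tangents are not opposite, so
    \<open>1 + c\<close> is positive and the sign of the product is that of
    \<open>c\<close>.\<close>
  moreover have "1 + c = v\<^sup>2 / 2" using vw by (simp add: c_def field_simps)
  then have "1 + c > 0" using zero_less_power[OF vw(2), of 2] by linarith
  ultimately have "0 \<le> c" by (simp add: zero_le_mult_iff)
  then have "\<omega>\<^sup>2 \<le> v\<^sup>2" by (simp add: c_def)
  then show ?thesis by (rule power2_le_imp_le) (use vw in simp)
qed

text \<open>The parallelogram law for the two tangents relates drift and rotation: the squares of
  \<open>v\<close> and \<omega> add up to 4. The alternatives are \<omega> = 0 (lines),
  \<open>v = 0\<close> (circle) and both positive (helix). The angle is \<open>\<omega> * s\<close>
  and the height \<open>v * s / 2\<close>, whence the pitch \<open>v / \<omega>\<close>.\<close>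

lemma parallel_pair_classification:
  fixes a b \<alpha> \<beta> :: "real \<Rightarrow> vec3"
  assumes s01: "s0 < s1" and inj: "inj_on a {s0..s1}"
    and a': "\<And>s. s \<in> {s0..s1} \<Longrightarrow> (a has_vector_derivative \<alpha> s) (at s within {s0..s1})"
    and b': "\<And>s. s \<in> {s0..s1} \<Longrightarrow> (b has_vector_derivative \<beta> s) (at s within {s0..s1})"
    and cont: "continuous_on {s0..s1} \<alpha>" "continuous_on {s0..s1} \<beta>"
    and n1: "\<And>s. s \<in> {s0..s1} \<Longrightarrow> norm (\<alpha> s) = 1" "\<And>s. s \<in> {s0..s1} \<Longrightarrow> norm (\<beta> s) = 1"
    and unit: "\<And>s. s \<in> {s0..s1} \<Longrightarrow> norm (b s - a s) = 1"
    and perp: "\<And>s. s \<in> {s0..s1} \<Longrightarrow> (b s - a s) \<bullet> \<alpha> s = 0"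
      "\<And>s. s \<in> {s0..s1} \<Longrightarrow> (b s - a s) \<bullet> \<beta> s = 0"
    and V: "\<And>s. s \<in> {s0..s1} \<Longrightarrow> \<alpha> s + \<beta> s = V"
    and balls: "\<And>s y n. \<lbrakk>s \<in> {s0..s1}; y \<in> a ` {s0..s1} \<union> b ` {s0..s1}; n \<bullet> \<alpha> s = 0\<rbrakk>
      \<Longrightarrow> (y - a s) \<bullet> n \<le> norm n * (norm (y - a s))\<^sup>2"
  shows "(\<exists>k\<ge>1. double_helix_piece k (a ` {s0..s1}) (b ` {s0..s1}))
    \<or> opposite_segments (a ` {s0..s1}) (b ` {s0..s1})
    \<or> antipodal_circle_arcs (a ` {s0..s1}) (b ` {s0..s1})"
proof -
  let ?I = "{s0..s1}"
  define u w where "u s = b s - a s" and "w s = \<beta> s - \<alpha> s" for s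
  define v where "v = norm V"
  define \<omega> where "\<omega> = norm (w s0)"
  have s0: "s0 \<in> ?I" using s01 by simp
  have nw2: "(norm (w s))\<^sup>2 = 4 - v\<^sup>2" if s: "s \<in> ?I" for s
    unfolding v_def w_def V[OF s, symmetric] power2_norm_eq_inner
    using n1[OF s] by (simp add: inner_add_left inner_add_right inner_diff_left inner_diff_right
        norm_eq_1 inner_commute)
  have nw: "norm (w s) = \<omega>" if "s \<in> ?I" for s
    unfolding \<omega>_def using nw2[OF that] nw2[OF s0] by (metis norm_ge_zero power2_eq_imp_eq)
  have v\<omega>: "v\<^sup>2 + \<omega>\<^sup>2 = 4" using nw2[OF s0] by (simp add: \<omega>_def)
  have v0: "v \<ge> 0" and \<omega>0: "\<omega> \<ge> 0" by (simp_all add: v_def \<omega>_def)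
  have u': "(u has_vector_derivative w s) (at s within ?I)" if "s \<in> ?I" for s
    unfolding u_def[abs_def] w_def by (intro has_vector_derivative_diff a' b' that)
  have cw: "continuous_on ?I w" unfolding w_def[abs_def] by (intro continuous_intros cont)
  have nu: "norm (u s) = 1" if "s \<in> ?I" for s using unit[OF that] by (simp add: u_def)
  define mid where "mid s = (1/2) *\<^sub>R (a s + b s) - s *\<^sub>R ((1/2) *\<^sub>R V)" for s
  have "(mid has_vector_derivative 0) (at s within ?I)" if s: "s \<in> ?I" for s
  proof -
    have "((\<lambda>s. (1/2) *\<^sub>R (a s + b s)) has_vector_derivative (1/2) *\<^sub>R (\<alpha> s + \<beta> s)) (at s within ?I)"
      by (intro bounded_linear.has_vector_derivative[OF bounded_linear_scaleR_right]
          has_vector_derivative_add a' b' s)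
    moreover have "((\<lambda>s. s *\<^sub>R ((1/2) *\<^sub>R V)) has_vector_derivative 1 *\<^sub>R ((1/2) *\<^sub>R V)) (at s within ?I)"
      by (rule bounded_linear.has_vector_derivative[OF bounded_linear_scaleR_left has_vector_derivative_id])
    ultimately show ?thesis
      unfolding mid_def[abs_def] using has_vector_derivative_diff V[OF s] by fastforce
  qed
  then obtain m0 where m0: "\<And>s. s \<in> ?I \<Longrightarrow> mid s = m0"
    using vector_derivative_zero_imp_constant by blast
  have ab: "a s = m0 + s *\<^sub>R ((1/2) *\<^sub>R V) - (1/2) *\<^sub>R u s" "b s = m0 + s *\<^sub>R ((1/2) *\<^sub>R V) + (1/2) *\<^sub>R u s"
    if s: "s \<in> ?I" for s
  proof -
    have h: "(1/2) *\<^sub>R x + (1/2) *\<^sub>R x = x" for x :: vec3 by (simp flip: scaleR_left_distrib)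
    have "m0 + s *\<^sub>R ((1/2) *\<^sub>R V) = (1/2) *\<^sub>R a s + (1/2) *\<^sub>R b s"
      unfolding m0[OF s, symmetric] mid_def by (simp add: scaleR_add_right)
    then show "a s = m0 + s *\<^sub>R ((1/2) *\<^sub>R V) - (1/2) *\<^sub>R u s" "b s = m0 + s *\<^sub>R ((1/2) *\<^sub>R V) + (1/2) *\<^sub>R u s"
      using h[of "a s"] h[of "b s"] by (simp_all add: u_def scaleR_diff_right)
  qed
  have "\<exists>e. norm e = 1 \<and> V = v *\<^sub>R e \<and> (\<forall>s\<in>?I. e \<bullet> u s = 0)"
  proof (cases "V = 0")
    case False
    have "V \<bullet> u s = 0" if s: "s \<in> ?I" for s
      using perp[OF s] V[OF s, symmetric] by (simp add: u_def inner_add_right inner_commute)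
    then show ?thesis using False
      by (intro exI[of _ "(1 / v) *\<^sub>R V"]) (simp add: v_def)
  next
    case True
    \<comment> \<open>The normal of the plane spanned by one tangent and the strut at the same
      point; this is the only candidate for the plane of the circle.\<close>
    define e where "e = cross3 (\<alpha> s0) (u s0)"
    have \<alpha>u: "\<alpha> s0 \<bullet> u s0 = 0" using perp[OF s0] by (simp add: u_def inner_commute)
    note e = cross_orthonormal[OF n1(1)[OF s0] nu[OF s0] \<alpha>u, folded e_def]
    have ab0: "a s = m0 - (1/2) *\<^sub>R u s" "b s = m0 + (1/2) *\<^sub>R u s" if "s \<in> ?I" for s
      using ab[OF that] True by simp_all
    \<comment> \<open>With the midpoint fixed, all points lie on the sphere of radius 1/2 about
      \<open>m0\<close>, on the boundary of the tangent ball in direction \<open>u s0\<close>.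
      Tilting this normal by \<open>h\<close> towards \<open>e\<close> changes its length only to
      second order, while a height \<open>X\<close> over the plane enters to first order. So
      \<open>X\<close> must vanish.\<close>
    have flat: "(y - a s0) \<bullet> e = 0" if y: "y \<in> a ` ?I \<union> b ` ?I" for y
    proof -
      define d where "d = y - a s0"
      define X where "X = d \<bullet> e"
      have "\<exists>z. norm z = 1 \<and> y = m0 + (1/2) *\<^sub>R z"
      proof (cases "y \<in> a ` ?I")
        case True
        then obtain s where "s \<in> ?I" "y = a s" by blast
        then show ?thesis using ab0 nu by (intro exI[of _ "- u s"]) simp
      next
        case False
        then obtain s where "s \<in> ?I" "y = b s" using y by blast
        then show ?thesis using ab0 nu by (intro exI[of _ "u s"]) simp
      qed
      then obtain z where z: "norm z = 1" "y = m0 + (1/2) *\<^sub>R z" by blast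
      have dz: "d = (1/2) *\<^sub>R (z + u s0)" using z ab0[OF s0] by (simp add: d_def algebra_simps)
      have du: "d \<bullet> u s0 = d \<bullet> d"
        unfolding dz using z(1) nu[OF s0]
        by (simp add: inner_add_left inner_add_right norm_eq_1 inner_commute)
      have "h * X \<le> h\<^sup>2 / 2 * (d \<bullet> d)" for h
      proof -
        define n where "n = u s0 + h *\<^sub>R e"
        have "(norm n)\<^sup>2 = 1 + h\<^sup>2"
          unfolding power2_norm_eq_inner n_def using nu[OF s0] e
          by (simp add: inner_add_left inner_add_right norm_eq_1 inner_commute power2_eq_square)
        also have "\<dots> \<le> (1 + h\<^sup>2 / 2)\<^sup>2"
          using zero_le_power2[of "h\<^sup>2 / 2"] by (simp add: power2_sum)
        finally have nn: "norm n \<le> 1 + h\<^sup>2 / 2" by (rule power2_le_imp_le) simp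
        have "n \<bullet> \<alpha> s0 = 0" using \<alpha>u e by (simp add: n_def inner_add_left inner_add_right inner_commute)
        then have "d \<bullet> n \<le> norm n * (norm d)\<^sup>2" unfolding d_def by (rule balls[OF s0 y])
        also have "\<dots> \<le> (1 + h\<^sup>2 / 2) * (norm d)\<^sup>2" using nn by (intro mult_right_mono) auto
        finally show ?thesis
          using du by (simp add: n_def inner_add_right X_def power2_norm_eq_inner algebra_simps)
      qed
      note ineq = this
      show ?thesis
      proof (cases "d = 0")
        case False
        then have dd: "d \<bullet> d > 0" by simp
        \<comment> \<open>This \<open>h\<close> makes the difference of the two sides of
          \<open>ineq\<close> largest.\<close>
        have "X / (d \<bullet> d) * X \<le> (X / (d \<bullet> d))\<^sup>2 / 2 * (d \<bullet> d)" by (rule ineq)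
        then have "X * X \<le> X * X / 2" using dd by (simp add: field_simps power2_eq_square)
        then have "X\<^sup>2 \<le> 0" by (simp add: power2_eq_square)
        then have "X = 0" by simp
        then show ?thesis by (simp add: X_def d_def)
      qed (simp add: d_def)
    qed
    have "e \<bullet> u s = 0" if "s \<in> ?I" for s
      using flat[of "a s"] flat[of "b s"] that by (simp add: u_def inner_diff_left inner_diff_right inner_commute)
    then show ?thesis using e True by (intro exI[of _ e]) (simp add: v_def)
  qed
  then obtain e where e: "norm e = 1" "V = v *\<^sub>R e" "\<And>s. s \<in> ?I \<Longrightarrow> e \<bullet> u s = 0" by blast
  obtain p q where pq: "norm p = 1" "norm q = 1" "p \<bullet> q = 0" "p \<bullet> e = 0" "q \<bullet> e = 0"
    and us: "\<And>s. s \<in> ?I \<Longrightarrow> u s = cos (\<omega> * s) *\<^sub>R p + sin (\<omega> * s) *\<^sub>R q"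
    and ws: "\<And>s. s \<in> ?I \<Longrightarrow> w s = \<omega> *\<^sub>R (cos (\<omega> * s) *\<^sub>R q - sin (\<omega> * s) *\<^sub>R p)"
    using planar_unit_speed_curve[OF s01 u' cw nu nw e(1,3)] by blast
  define f where "f x = m0 + x$1 *\<^sub>R p + x$2 *\<^sub>R q + x$3 *\<^sub>R e" for x :: vec3
  have iso: "dist (f x) (f y) = dist x y" for x y
    unfolding f_def using orthonormal_frame_isometry[OF pq(1,2) e(1) pq(3,4,5)] .
  have af: "a s = f ((1/2) *\<^sub>R vector [- cos (\<omega> * s), - sin (\<omega> * s), v * s])"
    and bf: "b s = f ((1/2) *\<^sub>R vector [cos (\<omega> * s), sin (\<omega> * s), v * s])" if s: "s \<in> ?I" for s
    unfolding ab[OF s] us[OF s] e(2) f_def by (simp_all add: algebra_simps)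
  show ?thesis
  proof (cases "\<omega> = 0")
    case True
    then have "v\<^sup>2 = 2\<^sup>2" using v\<omega> by simp
    then have "v = 2" by (rule power2_eq_imp_eq) (use v0 in auto)
    have "congruent_pair (a ` ?I) (b ` ?I) ((\<lambda>z. vector [- 1/2, 0, z]) ` ?I) ((\<lambda>z. vector [1/2, 0, z]) ` ?I)"
      unfolding congruent_pair_def
    proof (intro exI[of _ f] conjI allI iso)
      have h: "(1/2) *\<^sub>R vector [x, y, 2 * z] = (vector [x / 2, y / 2, z] :: vec3)" for x y z
        by (simp add: vec_eq_iff forall_3)
      show "a ` ?I = f ` (\<lambda>z. vector [- 1/2, 0, z]) ` ?I"
        unfolding image_image by (rule image_cong) (simp_all add: af True \<open>v = 2\<close> h)
      show "b ` ?I = f ` (\<lambda>z. vector [1/2, 0, z]) ` ?I"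
        unfolding image_image by (rule image_cong) (simp_all add: bf True \<open>v = 2\<close> h)
    qed
    then show ?thesis using s01 unfolding opposite_segments_def by blast
  next
    case False
    then have \<omega>: "\<omega> > 0" using \<omega>0 by simp
    define k where "k = v / \<omega>"
    have I\<omega>: "{\<omega> * s0..\<omega> * s1} = (*) \<omega> ` ?I" using \<omega> by simp
    have kw: "k * (\<omega> * s) = v * s" for s using \<omega> by (simp add: k_def)
    have cong: "congruent_pair (a ` ?I) (b ` ?I)
        ((\<lambda>\<theta>. (1/2) *\<^sub>R vector [- cos \<theta>, - sin \<theta>, k * \<theta>]) ` {\<omega> * s0..\<omega> * s1})
        ((\<lambda>\<theta>. (1/2) *\<^sub>R vector [cos \<theta>, sin \<theta>, k * \<theta>]) ` {\<omega> * s0..\<omega> * s1})"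
      unfolding congruent_pair_def
    proof (intro exI[of _ f] conjI allI iso)
      show "a ` ?I = f ` (\<lambda>\<theta>. (1/2) *\<^sub>R vector [- cos \<theta>, - sin \<theta>, k * \<theta>]) ` {\<omega> * s0..\<omega> * s1}"
        unfolding I\<omega> image_image kw by (rule image_cong[OF refl af])
      show "b ` ?I = f ` (\<lambda>\<theta>. (1/2) *\<^sub>R vector [cos \<theta>, sin \<theta>, k * \<theta>]) ` {\<omega> * s0..\<omega> * s1}"
        unfolding I\<omega> image_image kw by (rule image_cong[OF refl bf])
    qed
    have lt: "\<omega> * s0 < \<omega> * s1" using \<omega> s01 by simp
    show ?thesis
    proof (cases "v = 0")
      case True
      then have "\<omega>\<^sup>2 = 2\<^sup>2" using v\<omega> by simp
      then have \<omega>2: "\<omega> = 2" by (rule power2_eq_imp_eq) (use \<omega>0 in auto)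
      \<comment> \<open>At rotation speed 2 the arc returns to its start after the length
        \<open>pi\<close>, which injectivity of \<open>a\<close> forbids.\<close>
      have "s1 < s0 + pi"
      proof (rule ccontr)
        assume "\<not> s1 < s0 + pi"
        then have I: "s0 + pi \<in> ?I" using pi_gt_zero by simp
        have "a (s0 + pi) = a s0"
          unfolding af[OF I] af[OF s0] using True
          by (simp add: \<omega>2 distrib_left)
        then show False using inj_onD[OF inj _ I s0] pi_gt_zero by simp
      qed
      then have "\<omega> * s1 < \<omega> * s0 + 2 * pi" by (simp add: \<omega>2)
      moreover have "k = 0" using True by (simp add: k_def)
      ultimately show ?thesis
        using cong lt unfolding antipodal_circle_arcs_def by auto
    next
      case False
      then have v: "v > 0" using v0 by simp
      have "\<omega> \<le> v"
      proof (rule pitch_bound[OF v\<omega> v \<omega>, where l = "s1 - s0"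
            and Q = "\<lambda>h. h\<^sup>2 * v\<^sup>2 / 4 + (1 + cos (\<omega> * h)) / 2"
            and P = "\<lambda>h. h * v\<^sup>2 / 4 - \<omega> * sin (\<omega> * h) / 4"])
        fix h assume h: "0 < h" "h < s1 - s0"
        define s where "s = s0 + h"
        have s: "s \<in> ?I" and hs: "h = s - s0" using h by (simp_all add: s_def)
        define D where "D = b s - a s0"
        \<comment> \<open>The part of \<open>D\<close> normal to the tangent gives the strongest
          ball condition at \<open>a s0\<close>: its length is at most the squared length of
          \<open>D\<close>. Squaring yields the hypothesis of \<open>pitch_bound\<close>.\<close>
        define n where "n = D - (D \<bullet> \<alpha> s0) *\<^sub>R \<alpha> s0"
        have \<alpha>\<alpha>: "\<alpha> s0 \<bullet> \<alpha> s0 = 1" using n1[OF s0] by (simp add: norm_eq_1)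
        have na: "n \<bullet> \<alpha> s0 = 0" using \<alpha>\<alpha> by (simp add: n_def inner_diff_left)
        have Dn: "D \<bullet> n = (norm n)\<^sup>2"
          using na by (simp add: n_def power2_norm_eq_inner inner_diff_left inner_diff_right inner_commute)
        have "D \<bullet> n \<le> norm n * (norm D)\<^sup>2"
          unfolding D_def using s by (intro balls[OF s0 _ na]) auto
        then have "norm n * norm n \<le> norm n * (norm D)\<^sup>2" unfolding Dn by (simp add: power2_eq_square)
        then have "norm n \<le> (norm D)\<^sup>2" by (cases "n = 0") auto
        then have "(norm n)\<^sup>2 \<le> ((norm D)\<^sup>2)\<^sup>2" by (intro power_mono) auto
        moreover have "(norm n)\<^sup>2 = (norm D)\<^sup>2 - (D \<bullet> \<alpha> s0)\<^sup>2"
          unfolding Dn[symmetric] by (simp add: n_def inner_diff_right power2_norm_eq_inner flip: power2_eq_square)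
        moreover have "D = (h * v / 2) *\<^sub>R e + (1/2) *\<^sub>R (u s + u s0)"
          unfolding D_def ab(2)[OF s] ab(1)[OF s0] e(2) hs by (simp add: algebra_simps diff_divide_distrib)
        note D = this
        have uu: "u s0 \<bullet> u s = cos (\<omega> * h)" "u s \<bullet> u s0 = cos (\<omega> * h)"
        proof -
          show "u s0 \<bullet> u s = cos (\<omega> * h)"
            unfolding us[OF s] us[OF s0] using pq cos_diff[of "\<omega> * s" "\<omega> * s0"]
            by (simp add: inner_add_left inner_add_right norm_eq_1 inner_commute s_def algebra_simps)
          then show "u s \<bullet> u s0 = cos (\<omega> * h)" by (simp add: inner_commute)
        qed
        have "(norm D)\<^sup>2 = h\<^sup>2 * v\<^sup>2 / 4 + (1 + cos (\<omega> * h)) / 2"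
          unfolding power2_norm_eq_inner D using e(1) e(3)[OF s] e(3)[OF s0] nu[OF s] nu[OF s0] uu
          by (simp add: inner_add_left inner_add_right norm_eq_1 inner_commute power2_eq_square field_simps)
        moreover have "D \<bullet> \<alpha> s0 = h * v\<^sup>2 / 4 - \<omega> * sin (\<omega> * h) / 4"
        proof -
          have \<alpha>: "\<alpha> s0 = (v / 2) *\<^sub>R e - (1/2) *\<^sub>R w s0"
          proof -
            have "v *\<^sub>R e = \<alpha> s0 + \<beta> s0" using V[OF s0] e(2) by simp
            then have "2 *\<^sub>R \<alpha> s0 = v *\<^sub>R e - w s0" by (simp add: w_def scaleR_2)
            then have "(1/2) *\<^sub>R (2 *\<^sub>R \<alpha> s0) = (1/2) *\<^sub>R (v *\<^sub>R e - w s0)" by simp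
            then show ?thesis by (simp add: scaleR_diff_right)
          qed
          have ew: "e \<bullet> w s0 = 0" "w s0 \<bullet> e = 0"
            unfolding ws[OF s0] using pq by (simp_all add: inner_diff_left inner_diff_right inner_commute)
          have "u s0 \<bullet> w s0 = 0"
            unfolding ws[OF s0] us[OF s0] using pq
            by (simp add: inner_diff_left inner_diff_right inner_add_left inner_add_right norm_eq_1 inner_commute)
          moreover have "u s \<bullet> w s0 = \<omega> * sin (\<omega> * h)"
          proof -
            have "u s \<bullet> w s0 = \<omega> * (sin (\<omega> * s) * cos (\<omega> * s0) - cos (\<omega> * s) * sin (\<omega> * s0))"
              unfolding ws[OF s0] us[OF s] using pq
              by (simp add: inner_diff_left inner_diff_right inner_add_left inner_add_right norm_eq_1 inner_commute)
            then show ?thesis by (simp add: hs right_diff_distrib sin_diff)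
          qed
          ultimately show ?thesis
            unfolding D \<alpha> using e(1) e(3)[OF s] e(3)[OF s0] ew
            by (simp add: inner_add_left inner_add_right inner_diff_left inner_diff_right norm_eq_1 inner_commute
                power2_eq_square field_simps)
        qed
        ultimately show "h\<^sup>2 * v\<^sup>2 / 4 + (1 + cos (\<omega> * h)) / 2 - (h * v\<^sup>2 / 4 - \<omega> * sin (\<omega> * h) / 4)\<^sup>2
            \<le> (h\<^sup>2 * v\<^sup>2 / 4 + (1 + cos (\<omega> * h)) / 2)\<^sup>2" by simp
      qed (use s01 in auto)
      then have "k \<ge> 1" using \<omega> by (simp add: k_def)
      then show ?thesis using cong lt unfolding double_helix_piece_def by blast
    qed
  qed
qed

text \<open>Once \<tau> is known to be a translation, shifting the parameter of \<open>b\<close>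
  puts both curves over one interval, with partners at equal parameters.\<close>

lemma contact_pair_classification:
  fixes a b \<alpha> \<beta> :: "real \<Rightarrow> vec3"
  assumes s01: "s0 < s1" and t01: "t0 < t1" and inj: "inj_on a {s0..s1}"
    and a': "\<And>s. s \<in> {s0..s1} \<Longrightarrow> (a has_vector_derivative \<alpha> s) (at s within {s0..s1})"
    and b': "\<And>s. s \<in> {t0..t1} \<Longrightarrow> (b has_vector_derivative \<beta> s) (at s within {t0..t1})"
    and lip: "2-lipschitz_on {s0..s1} \<alpha>" "2-lipschitz_on {t0..t1} \<beta>"
    and n1: "\<And>s. s \<in> {s0..s1} \<Longrightarrow> norm (\<alpha> s) = 1" "\<And>s. s \<in> {t0..t1} \<Longrightarrow> norm (\<beta> s) = 1"
    and \<tau>: "continuous_on {s0..s1} \<tau>" "strict_mono_on {s0..s1} \<tau>" "\<tau> ` {s0..s1} = {t0..t1}"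
    and unit: "\<And>s. s \<in> {s0..s1} \<Longrightarrow> norm (b (\<tau> s) - a s) = 1"
    and perp: "\<And>s. s \<in> {s0..s1} \<Longrightarrow> (b (\<tau> s) - a s) \<bullet> \<alpha> s = 0"
      "\<And>s. s \<in> {s0..s1} \<Longrightarrow> (b (\<tau> s) - a s) \<bullet> \<beta> (\<tau> s) = 0"
    and V: "\<And>s. s \<in> {s0..s1} \<Longrightarrow> \<alpha> s + \<beta> (\<tau> s) = V"
    and balls: "\<And>s y n. \<lbrakk>s \<in> {s0..s1}; y \<in> a ` {s0..s1} \<union> b ` {t0..t1}; n \<bullet> \<alpha> s = 0\<rbrakk>
      \<Longrightarrow> (y - a s) \<bullet> n \<le> norm n * (norm (y - a s))\<^sup>2"
  shows "(\<exists>k\<ge>1. double_helix_piece k (a ` {s0..s1}) (b ` {t0..t1}))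
    \<or> opposite_segments (a ` {s0..s1}) (b ` {t0..t1})
    \<or> antipodal_circle_arcs (a ` {s0..s1}) (b ` {t0..t1})"
proof -
  obtain k where k: "\<And>s. s \<in> {s0..s1} \<Longrightarrow> \<tau> s = s + k"
    using contact_parameter_translation[OF s01 t01 a' b' lip n1 \<tau> unit perp V] by blast
  have \<tau>I: "s + k \<in> {t0..t1}" if "s \<in> {s0..s1}" for s using \<tau>(3) that k by (metis imageI)
  have im: "(\<lambda>s. s + k) ` {s0..s1} = {t0..t1}" using \<tau>(3) k by (metis (no_types, lifting) image_cong)
  have bim: "b ` {t0..t1} = (\<lambda>s. b (s + k)) ` {s0..s1}" unfolding im[symmetric] image_image ..
  show ?thesis
    unfolding bim
  proof (rule parallel_pair_classification[OF s01 inj a'])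
    fix s assume s: "s \<in> {s0..s1}"
    have "((b \<circ> (\<lambda>s. s + k)) has_vector_derivative 1 *\<^sub>R \<beta> (s + k)) (at s within {s0..s1})"
    proof (rule vector_diff_chain_within)
      show "((\<lambda>s. s + k) has_vector_derivative 1) (at s within {s0..s1})"
        by (auto intro!: derivative_eq_intros)
      show "(b has_vector_derivative \<beta> (s + k)) (at (s + k) within (\<lambda>s. s + k) ` {s0..s1})"
        unfolding im by (rule b'[OF \<tau>I[OF s]])
    qed
    then show "((\<lambda>s. b (s + k)) has_vector_derivative \<beta> (s + k)) (at s within {s0..s1})"
      by (simp add: o_def)
    show "norm (\<alpha> s) = 1" "norm (\<beta> (s + k)) = 1" "norm (b (s + k) - a s) = 1"
      "(b (s + k) - a s) \<bullet> \<alpha> s = 0" "(b (s + k) - a s) \<bullet> \<beta> (s + k) = 0" "\<alpha> s + \<beta> (s + k) = V"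
      using n1 unit perp V k s \<tau>I by (metis)+
  next
    show "continuous_on {s0..s1} \<alpha>" by (rule lipschitz_on_continuous_on[OF lip(1)])
    show "continuous_on {s0..s1} (\<lambda>s. \<beta> (s + k))"
      by (rule continuous_on_compose2[OF lipschitz_on_continuous_on[OF lip(2)]])
        (use \<tau>I in \<open>auto intro!: continuous_intros\<close>)
    fix s y n assume "s \<in> {s0..s1}" "y \<in> a ` {s0..s1} \<union> (\<lambda>s. b (s + k)) ` {s0..s1}" "n \<bullet> \<alpha> s = 0"
    then show "(y - a s) \<bullet> n \<le> norm n * (norm (y - a s))\<^sup>2" using balls unfolding bim by blast
  qed
qed

text \<open>Force balance gives constancy only near interior points; continuity extends it to the
  ends of the arc.\<close>

lemma locally_constant_Icc:
  fixes f :: "real \<Rightarrow> 'a::real_normed_vector"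
  assumes "a < b" and cont: "continuous_on {a..b} f"
    and loc: "\<And>m. m \<in> {a<..<b} \<Longrightarrow> \<exists>d>0. \<forall>p q. m - d < p \<and> p < q \<and> q < m + d \<longrightarrow> f p = f q"
  shows "\<exists>V. \<forall>s\<in>{a..b}. f s = V"
proof -
  have "(f has_vector_derivative 0) (at m within {a<..<b})" if m: "m \<in> {a<..<b}" for m
  proof -
    obtain d where d: "d > 0" "\<And>p q. \<lbrakk>m - d < p; p < q; q < m + d\<rbrakk> \<Longrightarrow> f p = f q"
      using loc[OF m] by blast
    have eq: "f m = f s" if "s \<in> ball m d" for s
    proof (cases s m rule: linorder_cases)
      case less
      then show ?thesis using d(2)[of s m] that d(1) by (auto simp: dist_real_def)
    next
      case greater
      then show ?thesis using d(2)[of m s] that d(1) by (auto simp: dist_real_def)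
    qed simp
    have "(f has_vector_derivative 0) (at m)"
      by (rule has_vector_derivative_transform_within_open[OF has_vector_derivative_const[of "f m"], where S = "ball m d"])
        (use d(1) eq in auto)
    then show ?thesis by (rule has_vector_derivative_at_within)
  qed
  then obtain V where V: "\<And>s. s \<in> {a<..<b} \<Longrightarrow> f s = V"
    by (rule has_vector_derivative_zero_constant[OF convex_real_interval(8)]) (assumption, rule that, blast)
  have cl: "closure {a<..<b} = {a..b}" using \<open>a < b\<close> by simp
  have "f s = V" if "s \<in> {a..b}" for s
    by (rule continuous_constant_on_closure[of "{a<..<b}" f V]) (use cont V that cl in auto)
  then show ?thesis by blast
qed

text \<open>At an end of the link the normal cone gives merely an inequality, so perpendicularity of
  struts at the ends of the arcs is recovered as a limit.\<close>

lemma zero_on_Icc: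
  fixes f :: "real \<Rightarrow> real"
  assumes "a < b" "continuous_on {a..b} f" "\<And>s. s \<in> {a<..<b} \<Longrightarrow> f s = 0" "s \<in> {a..b}"
  shows "f s = 0"
proof -
  have cl: "closure {a<..<b} = {a..b}" using \<open>a < b\<close> by simp
  show ?thesis
    by (rule continuous_constant_on_closure[of "{a<..<b}" f 0]) (use assms cl in auto)
qed

theorem proposition3p21:
  fixes \<sigma> :: real
    and L A B :: "vec3 set"
    and T :: "vec3 \<Rightarrow> vec3"
    and S :: "vec3 measure"
    and H0 H1 :: "vec3 \<Rightarrow> vec3 set"
    and \<mu> :: "(vec3 \<times> vec3) measure"
    and \<nu> :: "circ measure"
  assumes "\<sigma> \<ge> 1/2"
    and "link L T"
    and "arclength_measure L T S"
    and "endpoint_constraints L T H0 H1"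
    and "Thi \<sigma> L T = 1"
    and "strut_measure \<sigma> L T \<mu>"
    and "kink_measure \<sigma> L T \<nu>"
    and "balanced_by L T S H0 H1 \<mu> \<nu>"
    and "subarc L T A"
    and "subarc L T B"
    and "emeasure \<nu> {c \<in> Kink \<sigma> L T. fst c \<in> A \<union> B} = 0"
    and "one_to_one_contact \<sigma> L T A B"
  shows "(\<exists>k\<ge>1. double_helix_piece k A B) \<or> opposite_segments A B \<or> antipodal_circle_arcs A B"
proof -
  note lk = assms(2) and thi = assms(5)
  have etb: "empty_tangent_balls L T" using Thi_one_imp_empty_tangent_balls[OF lk thi] .
  obtain ga sa ta where pa: "arc_param L T ga sa ta" and A: "ga ` {sa..ta} = A"
    using subarc_imp_arc_param[OF assms(9)] .
  obtain gb sb tb where pb: "arc_param L T gb sb tb" and B: "gb ` {sb..tb} = B"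
    using subarc_imp_arc_param[OF assms(10)] .
  obtain \<phi> \<psi> where hom: "homeomorphism A B \<phi> \<psi>"
    and st: "\<And>a. a \<in> A \<Longrightarrow> (a, \<phi> a) \<in> Strut \<sigma> L T"
    and uq: "\<And>x y. (x, y) \<in> Strut \<sigma> L T \<Longrightarrow> (x \<in> A \<longrightarrow> y = \<phi> x) \<and> (y \<in> B \<longrightarrow> x = \<psi> y)"
    using assms(12) unfolding one_to_one_contact_def by blast
  have sta: "sa < ta" and stb: "sb < tb" and inja: "inj_on ga {sa..ta}" and injb: "inj_on gb {sb..tb}"
    and LA: "A \<subseteq> L" and LB: "B \<subseteq> L"
    and ga': "\<And>u. u \<in> {sa..ta} \<Longrightarrow> (ga has_vector_derivative T (ga u)) (at u within {sa..ta})"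
    and gb': "\<And>u. u \<in> {sb..tb} \<Longrightarrow> (gb has_vector_derivative T (gb u)) (at u within {sb..tb})"
    using pa pb A B by (auto simp: arc_param_def)
  have ca: "continuous_on {sa..ta} ga" and cb: "continuous_on {sb..tb} gb"
    using pa pb arc_param_continuous by blast+
  obtain h where h: "homeomorphism {sb..tb} B gb h"
    using homeomorphism_compact[OF compact_Icc cb B injb] by blast
  obtain g where g: "homeomorphism {sa..ta} A ga g"
    using homeomorphism_compact[OF compact_Icc ca A inja] by blast
  \<comment> \<open>The map \<phi> expressed in arclength parameters. A continuous injection between
    intervals is monotone, so only its direction remains open.\<close>
  define \<tau> where "\<tau> = h \<circ> (\<phi> \<circ> ga)"
  have hom\<tau>: "homeomorphism {sa..ta} {sb..tb} \<tau> (g \<circ> \<psi> \<circ> gb)"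
    unfolding \<tau>_def
    using homeomorphism_compose[OF homeomorphism_compose[OF g hom] homeomorphism_symD[OF h]]
    by (simp add: comp_assoc)
  have c\<tau>: "continuous_on {sa..ta} \<tau>" and im\<tau>: "\<tau> ` {sa..ta} = {sb..tb}" and inj\<tau>: "inj_on \<tau> {sa..ta}"
    using hom\<tau> by (auto simp: homeomorphism_def intro: inj_on_inverseI)
  have \<tau>I: "\<tau> s \<in> {sb..tb}" if "s \<in> {sa..ta}" for s using im\<tau> that by blast
  have g\<tau>: "gb (\<tau> s) = \<phi> (ga s)" if "s \<in> {sa..ta}" for s
  proof -
    have "ga s \<in> A" using A that by blast
    then have "\<phi> (ga s) \<in> B" using hom by (auto simp: homeomorphism_def)
    then show ?thesis using h by (simp add: \<tau>_def homeomorphism_def)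
  qed
  have strut: "(ga s, gb (\<tau> s)) \<in> Strut \<sigma> L T" if "s \<in> {sa..ta}" for s
    using st[of "ga s"] g\<tau>[OF that] A that by auto
  define Ta Tb where "Ta s = T (ga s)" and "Tb t = T (gb t)" for s t
  have lipa: "2-lipschitz_on {sa..ta} Ta" and lipb: "2-lipschitz_on {sb..tb} Tb"
    unfolding Ta_def[abs_def] Tb_def[abs_def] using arc_param_tangent_lipschitz[OF lk etb] pa pb by blast+
  have n1: "norm (Ta s) = 1" if "s \<in> {sa..ta}" for s
    unfolding Ta_def using norm_tangent[OF lk] LA A that by blast
  have n1b: "norm (Tb s) = 1" if "s \<in> {sb..tb}" for s
    unfolding Tb_def using norm_tangent[OF lk] LB B that by blast
  have cont: "continuous_on {sa..ta} Ta" "continuous_on {sa..ta} (\<lambda>s. Tb (\<tau> s))" "continuous_on {sa..ta} (\<lambda>s. gb (\<tau> s))"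
    using lipschitz_on_continuous_on[OF lipa]
      continuous_on_compose2[OF lipschitz_on_continuous_on[OF lipb] c\<tau>]
      continuous_on_compose2[OF cb c\<tau>] im\<tau> by auto
  have mono: "strict_mono_on {sa..ta} \<tau> \<or> strict_antimono_on {sa..ta} \<tau>"
    using injective_eq_monotone_map[of "{sa..ta}" \<tau>] c\<tau> inj\<tau> by (simp add: is_interval_cc)
  have \<tau>int: "\<tau> s \<in> {sb<..<tb}" if s: "s \<in> {sa<..<ta}" for s
  proof -
    have "\<tau> sa \<in> {sb..tb}" "\<tau> ta \<in> {sb..tb}" using \<tau>I sta by auto
    moreover have "\<tau> sa < \<tau> s \<and> \<tau> s < \<tau> ta \<or> \<tau> ta < \<tau> s \<and> \<tau> s < \<tau> sa"
      using mono s unfolding monotone_on_def by auto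
    ultimately show ?thesis by auto
  qed
  have perpa: "(gb (\<tau> s) - ga s) \<bullet> Ta s = 0" if "s \<in> {sa..ta}" for s
  proof (rule zero_on_Icc[OF sta _ _ that])
    show "continuous_on {sa..ta} (\<lambda>s. (gb (\<tau> s) - ga s) \<bullet> Ta s)"
      by (intro continuous_intros cont ca)
    fix s assume s: "s \<in> {sa<..<ta}"
    then show "(gb (\<tau> s) - ga s) \<bullet> Ta s = 0"
      unfolding Ta_def using StrutD(5)[OF strut thi] arc_param_not_end[OF pa s] by auto
  qed
  have perpb: "(gb (\<tau> s) - ga s) \<bullet> Tb (\<tau> s) = 0" if "s \<in> {sa..ta}" for s
  proof (rule zero_on_Icc[OF sta _ _ that])
    show "continuous_on {sa..ta} (\<lambda>s. (gb (\<tau> s) - ga s) \<bullet> Tb (\<tau> s))"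
      by (intro continuous_intros cont ca)
    fix s assume s: "s \<in> {sa<..<ta}"
    then show "(gb (\<tau> s) - ga s) \<bullet> Tb (\<tau> s) = 0"
      unfolding Tb_def using StrutD(6)[OF strut thi] arc_param_not_end[OF pb \<tau>int[OF s]] by auto
  qed
  have unit: "norm (gb (\<tau> s) - ga s) = 1" if "s \<in> {sa..ta}" for s
    using StrutD(3)[OF strut[OF that] thi] by (simp add: norm_minus_commute)
  have sum_const: "\<exists>V. \<forall>s\<in>{sa..ta}. Ta s + c *\<^sub>R Tb (\<tau> s) = V"
    if c: "c = 1 \<and> strict_mono_on {sa..ta} \<tau> \<or> c = -1 \<and> strict_antimono_on {sa..ta} \<tau>" for c
  proof (rule locally_constant_Icc[OF sta])
    show "continuous_on {sa..ta} (\<lambda>s. Ta s + c *\<^sub>R Tb (\<tau> s))" by (intro continuous_intros cont)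
    show "\<exists>d>0. \<forall>p q. m - d < p \<and> p < q \<and> q < m + d \<longrightarrow> Ta p + c *\<^sub>R Tb (\<tau> p) = Ta q + c *\<^sub>R Tb (\<tau> q)"
      if "m \<in> {sa<..<ta}" for m
      unfolding Ta_def Tb_def
      by (rule tangent_sum_locally_constant[OF lk assms(3,4) thi assms(6-8) pa pb _ _ _ _ c\<tau> im\<tau> _ c that,
            where \<phi> = \<phi> and \<psi> = \<psi>])
        (use assms(11) hom st uq g\<tau> A B in auto)
  qed
  have balls: "(y - ga s) \<bullet> n \<le> norm n * (norm (y - ga s))\<^sup>2"
    if "s \<in> {sa..ta}" "y \<in> A \<union> B" "n \<bullet> Ta s = 0" for s y n
  proof -
    have "ga s \<in> L" "y \<in> L" using that A LA LB by auto
    then show ?thesis using etb that(3) unfolding empty_tangent_balls_def Ta_def by blast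
  qed
  show ?thesis
  proof (cases "strict_mono_on {sa..ta} \<tau>")
    case True
    obtain V where V: "\<And>s. s \<in> {sa..ta} \<Longrightarrow> Ta s + 1 *\<^sub>R Tb (\<tau> s) = V"
      using sum_const[of 1] True by blast
    show ?thesis
      unfolding A[symmetric] B[symmetric]
      by (rule contact_pair_classification[OF sta stb inja, where \<alpha> = Ta and \<beta> = Tb and \<tau> = \<tau> and V = V])
        (use ga' gb' lipa lipb n1 n1b c\<tau> True im\<tau> unit perpa perpb V balls A B in \<open>auto simp: Ta_def Tb_def\<close>)
  next
    \<comment> \<open>Traversing \<open>B\<close> backwards makes the change of parameter
      increasing. The reversed curve has tangents \<open>- Tb\<close>, which fits the sum with
      \<open>c = -1\<close>.\<close>
    case False
    then have anti: "strict_antimono_on {sa..ta} \<tau>" using mono by blast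
    obtain V where V: "\<And>s. s \<in> {sa..ta} \<Longrightarrow> Ta s + (-1) *\<^sub>R Tb (\<tau> s) = V"
      using sum_const[of "-1"] anti by blast
    have im: "uminus ` {- tb..- sb} = {sb..tb}" by auto
    have B': "(\<lambda>t. gb (- t)) ` {- tb..- sb} = B"
      using B unfolding im[symmetric] image_image .
    show ?thesis
      unfolding A[symmetric] B'[symmetric]
    proof (rule contact_pair_classification[OF sta _ inja, where \<alpha> = Ta and \<beta> = "\<lambda>t. - Tb (- t)"
          and \<tau> = "\<lambda>s. - \<tau> s" and V = V])
      fix t assume t: "t \<in> {- tb..- sb}"
      have "((gb \<circ> uminus) has_vector_derivative (-1) *\<^sub>R Tb (- t)) (at t within {- tb..- sb})"
      proof (rule vector_diff_chain_within)
        show "(uminus has_vector_derivative -1) (at t within {- tb..- sb})"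
          by (auto intro!: derivative_eq_intros)
        show "(gb has_vector_derivative Tb (- t)) (at (- t) within uminus ` {- tb..- sb})"
          unfolding im Tb_def using t by (intro gb') auto
      qed
      then show "((\<lambda>t. gb (- t)) has_vector_derivative - Tb (- t)) (at t within {- tb..- sb})"
        by (simp add: o_def)
    next
      show "2-lipschitz_on {- tb..- sb} (\<lambda>t. - Tb (- t))"
      proof (rule lipschitz_onI)
        fix x y assume "x \<in> {- tb..- sb}" "y \<in> {- tb..- sb}"
        then have "dist (Tb (- x)) (Tb (- y)) \<le> 2 * dist (- x) (- y)"
          by (intro lipschitz_onD[OF lipb]) auto
        then show "dist (- Tb (- x)) (- Tb (- y)) \<le> 2 * dist x y" by (simp add: dist_minus)
      qed simp
      show "strict_mono_on {sa..ta} (\<lambda>s. - \<tau> s)" using anti unfolding monotone_on_def by auto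
      show "(\<lambda>s. - \<tau> s) ` {sa..ta} = {- tb..- sb}"
        using im\<tau> by (metis image_image image_uminus_atLeastAtMost)
    qed (use ga' lipa n1 n1b c\<tau> unit perpa perpb V balls A B' stb in
          \<open>auto simp: Ta_def intro: continuous_on_minus\<close>)
  qed
qed

end
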